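(* Let $a,b\ge1$ be integers, $q=a/b$, and let $\sigma$ be the endomorphism of $\mathrm{Free}_2(\mathcal V)$ with $\sigma(x_0)=\big[((x_0\to x_1)\to x_1)\to x_0\star(x_0\to x_1)\big]^a$ and $\sigma(x_1)=\big[(x_0\to x_1)\to x_1\big]^b$, where $t^k$ is the $k$-fold $\star$-power. Let $\bar s:(0,1]^2\to(0,1]^2$, $\bar s(p)=(\sigma(x_0)(p),\sigma(x_1)(p))$, and let $\tilde s:[0,1]\to[0,1]$ be $\tilde s(x)=x\big((1-2q)x+q\big)^{-1}$ for $0\le x\le1/2$ and $\tilde s(x)=(1-x)\big((1-2q)(1-x)+q\big)^{-1}$ for $1/2<x\le1$. Let $\lambda$ be Lebesgue measure on $[0,1]$. Then: (1) if $q>1$, $\lambda$-almost every point of $[0,1]$ is attracted to $0$ under iteration of $\tilde s$; (2) if $q<1$, there is a unique $\tilde s$-invariant Borel probability measure $\mu\ll\lambda$, and $\tilde s$ is exact with respect to $\mu$; (3) if $q=1$, then (3.1) $\sigma$ is generic, (3.2) no point of $(0,1]^2$ has a dense orbit under $\bar s$, and (3.3) there is no Borel probability measure $\mu$ on $[0,1]$ with $\lambda\ll\mu$ such that $\tilde s$ preserves $\mu$ and is ergodic with respect to $\mu$.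
   Context: $\mathcal V$ is the variety generated by $M=((0,1],\star,\to,1)$, $\star$ the product of reals, $a\to b=\min\{1,b/a\}$; $\mathrm{Free}_2(\mathcal V)$ is the algebra of functions $(0,1]^2\to(0,1]$ generated by the projections $x_0,x_1$ under pointwise operations. ($\tilde s$ is the induced action of $\sigma$ on the simplex $\{u\in(-\infty,0]^2:u_0+u_1=-1\}$ identified with $[0,1]$ via $x\mapsto(-1+x,-x)$.) Genericity: a filter is the preimage of $1$ under a homomorphism; $X$ is the set of proper prime filters of $\mathrm{Free}_2(\mathcal V)$ with subbasis $O_t=\{\mathfrak p:t\notin\mathfrak p\}$; $\pi(p)=\{t:t(p)=1\}$ for $p\in(0,1]^2\setminus\{(1,1)\}$; $\lambda_X(A)=\mathrm{Leb}(\pi^{-1}[A])$; $S(\mathfrak p)=\sigma^{-1}[\mathfrak p]$. A probability $\mu$ on $X$ is algebraically equivalent to $\lambda_X$ if $\mu(A)=\lambda_X(R^{-1}[A])$ where $R(\mathfrak p)=\rho^{-1}[\mathfrak p]$ for some automorphism $\rho$ of $\mathrm{Free}_2(\mathcal V)$. $\sigma$ is generic if for every such $\mu$, $\mu$-almost every point of $X$ has dense orbit $\{S^k(x):k\ge0\}$. Exactness of $\tilde s$ w.r.t. invariant $\mu$: the tail $\sigma$-algebra $\bigcap_{k\ge0}\tilde s^{-k}\mathcal B$ contains only sets of $\mu$-measure $0$ or $1$; ergodicity: $\tilde s^{-1}A=A$ implies $\mu(A)\in\{0,1\}$. *)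

theory Defs
  imports "HOL-Algebra.Group" "HOL-Probability.Probability_Measure"
begin

record 'a hoop = "'a monoid" +
  imp :: "'a \<Rightarrow> 'a \<Rightarrow> 'a" (infixr \<open>\<leadsto>\<index>\<close> 65)

definition closed_alg :: "'a hoop \<Rightarrow> bool" where
  "closed_alg B \<longleftrightarrow> \<one>\<^bsub>B\<^esub> \<in> carrier B \<and>
     (\<forall>x\<in>carrier B. \<forall>y\<in>carrier B. x \<otimes>\<^bsub>B\<^esub> y \<in> carrier B \<and> x \<leadsto>\<^bsub>B\<^esub> y \<in> carrier B)"

text \<open>\<^term>\<open>hom\<close> of the library only preserves the product.\<close>

definition hoop_hom :: "'a hoop \<Rightarrow> 'b hoop \<Rightarrow> ('a \<Rightarrow> 'b) set" where
  "hoop_hom A B = {h \<in> hom A B. h \<one>\<^bsub>A\<^esub> = \<one>\<^bsub>B\<^esub> \<and>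
     (\<forall>x\<in>carrier A. \<forall>y\<in>carrier A. h (x \<leadsto>\<^bsub>A\<^esub> y) = h x \<leadsto>\<^bsub>B\<^esub> h y)}"

definition M_alg :: "real hoop" where
  "M_alg = \<lparr>carrier = {0<..1}, monoid.mult = (*), one = 1, imp = (\<lambda>a b. min 1 (b / a))\<rparr>"

datatype hterm = Var nat | One | Star hterm hterm | Imp hterm hterm

primrec hval :: "'a hoop \<Rightarrow> (nat \<Rightarrow> 'a) \<Rightarrow> hterm \<Rightarrow> 'a" where
  "hval B e (Var n) = e n"
| "hval B e One = \<one>\<^bsub>B\<^esub>"
| "hval B e (Star s t) = hval B e s \<otimes>\<^bsub>B\<^esub> hval B e t"
| "hval B e (Imp s t) = hval B e s \<leadsto>\<^bsub>B\<^esub> hval B e t"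

definition satisfies_eq :: "'a hoop \<Rightarrow> hterm \<Rightarrow> hterm \<Rightarrow> bool" where
  "satisfies_eq B s t \<longleftrightarrow> (\<forall>e. range e \<subseteq> carrier B \<longrightarrow> hval B e s = hval B e t)"

text \<open>Membership in the variety generated by M, taken as the equational class of M.\<close>

definition in_variety :: "'a hoop \<Rightarrow> bool" where
  "in_variety B \<longleftrightarrow> closed_alg B \<and> (\<forall>s t. satisfies_eq M_alg s t \<longrightarrow> satisfies_eq B s t)"

definition Q :: "(real \<times> real) set" where
  "Q = {0<..1} \<times> {0<..1}"

text \<open>Functions on Q are represented by their extensional versions (undefined outside Q),
  so that equality of elements is equality as functions on Q.\<close>

definition x0 :: "real \<times> real \<Rightarrow> real" where "x0 = restrict fst Q"
definition x1 :: "real \<times> real \<Rightarrow> real" where "x1 = restrict snd Q"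

inductive_set free2_carrier :: "(real \<times> real \<Rightarrow> real) set" where
  "x0 \<in> free2_carrier"
| "x1 \<in> free2_carrier"
| "(\<lambda>p\<in>Q. \<one>\<^bsub>M_alg\<^esub>) \<in> free2_carrier"
| "f \<in> free2_carrier \<Longrightarrow> g \<in> free2_carrier \<Longrightarrow> (\<lambda>p\<in>Q. f p \<otimes>\<^bsub>M_alg\<^esub> g p) \<in> free2_carrier"
| "f \<in> free2_carrier \<Longrightarrow> g \<in> free2_carrier \<Longrightarrow> (\<lambda>p\<in>Q. f p \<leadsto>\<^bsub>M_alg\<^esub> g p) \<in> free2_carrier"

definition Free2 :: "(real \<times> real \<Rightarrow> real) hoop" where
  "Free2 = \<lparr>carrier = free2_carrier,
     monoid.mult = (\<lambda>f g. \<lambda>p\<in>Q. f p \<otimes>\<^bsub>M_alg\<^esub> g p),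
     one = (\<lambda>p\<in>Q. \<one>\<^bsub>M_alg\<^esub>),
     imp = (\<lambda>f g. \<lambda>p\<in>Q. f p \<leadsto>\<^bsub>M_alg\<^esub> g p)\<rparr>"

definition endomorphism :: "((real \<times> real \<Rightarrow> real) \<Rightarrow> (real \<times> real \<Rightarrow> real)) \<Rightarrow> bool" where
  "endomorphism s \<longleftrightarrow> s \<in> hoop_hom Free2 Free2"

definition automorphism :: "((real \<times> real \<Rightarrow> real) \<Rightarrow> (real \<times> real \<Rightarrow> real)) \<Rightarrow> bool" where
  "automorphism r \<longleftrightarrow> endomorphism r \<and> bij_betw r (carrier Free2) (carrier Free2)"

text \<open>The codomain ranges over algebras whose elements are sets of functions. This is no
  restriction: replacing the codomain by the image of \<open>h\<close>, which is isomorphic to a quotient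
  of \<^term>\<open>Free2\<close>, does not change the preimage of 1, and the elements of a quotient are
  subsets of \<^term>\<open>carrier Free2\<close>.\<close>

definition is_filter :: "(real \<times> real \<Rightarrow> real) set \<Rightarrow> bool" where
  "is_filter F \<longleftrightarrow> (\<exists>(B :: (real \<times> real \<Rightarrow> real) set hoop) h.
     in_variety B \<and> h \<in> hoop_hom Free2 B \<and> F = {t \<in> carrier Free2. h t = \<one>\<^bsub>B\<^esub>})"

text \<open>Primeness says that the quotient by F is totally ordered; the improper filter
  is prime in this sense, whence the separate properness condition.\<close>

definition prime_filter :: "(real \<times> real \<Rightarrow> real) set \<Rightarrow> bool" where
  "prime_filter F \<longleftrightarrow> is_filter F \<and>
     (\<forall>t\<in>carrier Free2. \<forall>u\<in>carrier Free2. t \<leadsto>\<^bsub>Free2\<^esub> u \<in> F \<or> u \<leadsto>\<^bsub>Free2\<^esub> t \<in> F)"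

definition X_set :: "(real \<times> real \<Rightarrow> real) set set" where
  "X_set = {F. prime_filter F \<and> F \<noteq> carrier Free2}"

definition O_open :: "(real \<times> real \<Rightarrow> real) \<Rightarrow> (real \<times> real \<Rightarrow> real) set set" where
  "O_open t = {F \<in> X_set. t \<notin> F}"

text \<open>The sets \<^term>\<open>O_open t\<close> cover \<^term>\<open>X_set\<close> by properness, so \<^term>\<open>X_set\<close> is the
  underlying set of this topology.\<close>

definition X_top :: "(real \<times> real \<Rightarrow> real) set topology" where
  "X_top = topology_generated_by {O_open t | t. t \<in> carrier Free2}"

definition X_borel :: "(real \<times> real \<Rightarrow> real) set measure" where
  "X_borel = sigma X_set {U. openin X_top U}"

definition point_filter :: "real \<times> real \<Rightarrow> (real \<times> real \<Rightarrow> real) set" where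
  "point_filter p = {t \<in> carrier Free2. t p = 1}"

definition lambda_X :: "(real \<times> real \<Rightarrow> real) set measure" where
  "lambda_X = distr (restrict_space lborel (Q - {(1, 1)})) X_borel point_filter"

definition dual_map ::
  "((real \<times> real \<Rightarrow> real) \<Rightarrow> (real \<times> real \<Rightarrow> real))
    \<Rightarrow> (real \<times> real \<Rightarrow> real) set \<Rightarrow> (real \<times> real \<Rightarrow> real) set" where
  "dual_map s F = {t \<in> carrier Free2. s t \<in> F}"

definition alg_equiv_lambda_X :: "(real \<times> real \<Rightarrow> real) set measure \<Rightarrow> bool" where
  "alg_equiv_lambda_X \<mu> \<longleftrightarrow> prob_space \<mu> \<and> sets \<mu> = sets X_borel \<and>
     (\<exists>r. automorphism r \<and>
       (\<forall>A\<in>sets X_borel. emeasure \<mu> A = emeasure lambda_X (dual_map r -` A \<inter> X_set)))"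

definition dense_orbit :: "'a topology \<Rightarrow> ('a \<Rightarrow> 'a) \<Rightarrow> 'a \<Rightarrow> bool" where
  "dense_orbit T f x \<longleftrightarrow> T closure_of {(f ^^ k) x | k. True} = topspace T"

definition generic :: "((real \<times> real \<Rightarrow> real) \<Rightarrow> (real \<times> real \<Rightarrow> real)) \<Rightarrow> bool" where
  "generic s \<longleftrightarrow> (\<forall>\<mu>. alg_equiv_lambda_X \<mu> \<longrightarrow> (AE F in \<mu>. dense_orbit X_top (dual_map s) F))"

definition sbar ::
  "((real \<times> real \<Rightarrow> real) \<Rightarrow> (real \<times> real \<Rightarrow> real)) \<Rightarrow> real \<times> real \<Rightarrow> real \<times> real" where
  "sbar s p = (s x0 p, s x1 p)"

text \<open>Only the values on [0,1] matter, where the denominators are positive for q > 0.\<close>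

definition stilde :: "real \<Rightarrow> real \<Rightarrow> real" where
  "stilde q x = (if x \<le> 1 / 2 then x / ((1 - 2 * q) * x + q)
                 else (1 - x) / ((1 - 2 * q) * (1 - x) + q))"

definition leb01 :: "real measure" where
  "leb01 = restrict_space lborel {0..1}"

definition borel_prob01 :: "real measure \<Rightarrow> bool" where
  "borel_prob01 \<mu> \<longleftrightarrow> prob_space \<mu> \<and> sets \<mu> = sets (restrict_space borel {0..1})"

definition preserves :: "('a \<Rightarrow> 'a) \<Rightarrow> 'a measure \<Rightarrow> bool" where
  "preserves T \<mu> \<longleftrightarrow> T \<in> measurable \<mu> \<mu> \<and>
     (\<forall>A\<in>sets \<mu>. emeasure \<mu> (T -` A \<inter> space \<mu>) = emeasure \<mu> A)"

definition ergodic :: "('a \<Rightarrow> 'a) \<Rightarrow> 'a measure \<Rightarrow> bool" where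
  "ergodic T \<mu> \<longleftrightarrow>
     (\<forall>A\<in>sets \<mu>. T -` A \<inter> space \<mu> = A \<longrightarrow> emeasure \<mu> A = 0 \<or> emeasure \<mu> A = 1)"

definition exact :: "('a \<Rightarrow> 'a) \<Rightarrow> 'a measure \<Rightarrow> bool" where
  "exact T \<mu> \<longleftrightarrow>
     (\<forall>A \<in> (\<Inter>k. {(T ^^ k) -` B \<inter> space \<mu> | B. B \<in> sets \<mu>}).
        emeasure \<mu> A = 0 \<or> emeasure \<mu> A = 1)"

end

(*
  In the coordinate y = (1-x)/x the map is y |-> q(y-1) for y >= 1 and y |-> q(1/y-1) for y < 1;
  both branches are Moebius, and so are all inverse branches of the iterates.  Hence everything
  reduces to explicit densities c/(x-p) for the transfer operator and to distortion estimates on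
  the cylinders.

  For q > 1 the set of points that never enter the basin [0,xs) of 0, where xs is the
  repelling fixed point, is null, because the density 1/(x-c) with 0 < c < xs strictly decreases under the transfer operator.  For q < 1 the density
  1/((1-q)+(2q-1)x) is invariant, and uniformly bounded distortion on the cylinders gives exactness,
  hence ergodicity and uniqueness.  For q = 1 one gets the Farey map: its invariant density 1/x is
  not integrable, whereas every sigma-finite invariant measure dominated by an ergodic invariant
  probability is a finite multiple of it (sublevel sets of the density are invariant).  Moreover
  almost every orbit meets a given set of positive measure.  Genericity follows, since in logarithmic
  coordinates elements of the free algebra are positively homogeneous and Lipschitz, so that
  a nontrivial element is < 1 on an open cone, and automorphisms preserve null sets.
*)
theory Submission imports Defs begin

text \<open>One pole governs the three regimes. The density \<open>1/((1-q)+(2q-1)x)\<close>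
  formally solves the transfer equation for every q. If q is not 1/2, its pole is
  \<open>(q-1)/(2q-1)\<close>, the fixed point other than 0 of the Moebius map that extends the left
  branch. For q < 1 the pole lies outside [0,1], so the density is bounded above and below. For q =
  1 it merges with the fixed point 0, which becomes parabolic, and the mass is infinite. For q > 1
  it is the repelling point inside (0,1/2); moving the pole below that point restores integrability
  to its right, and the price, a strict loss under the transfer operator, is exactly what makes the
  surviving set null. For genericity, an orbit of filters is dense once every t other than 1 has an
  iterate \<open>(\<sigma> ^^ k) t\<close> outside the filter. As there are countably many t,
  density reduces to countably many null sets in the square, each contained in a bundle of rays over
  a null set of directions. That no point of the square has a dense orbit rests on the product of
  the coordinates, which is monotone along orbits.\<close>

section \<open>Transfer formulas for the interval map\<close>

text \<open>The inverse branches of \<^term>\<open>stilde q\<close> are \<^term>\<open>psi q\<close> and \<open>1 - psi q\<close>.\<close>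

definition psi :: "real \<Rightarrow> real \<Rightarrow> real" where
  "psi q z = q * z / (1 + (2 * q - 1) * z)"

definition dpsi :: "real \<Rightarrow> real \<Rightarrow> real" where
  "dpsi q z = q / (1 + (2 * q - 1) * z)\<^sup>2"

lemma psi_denom_pos:
  assumes "q > 0" "0 \<le> z" "z \<le> 1"
  shows "1 + (2 * q - 1) * z > (0::real)"
proof -
  have e: "1 + (2 * q - 1) * z = (1 - z) + 2 * (q * z)" by (simp add: algebra_simps)
  show ?thesis
  proof (cases "z > 0")
    case True
    then have "q * z > 0" using assms by simp
    then show ?thesis unfolding e using assms by linarith
  qed (use assms in auto)
qed

lemma stilde_denom_pos:
  assumes "q > 0" "0 \<le> x" "x \<le> 1 / 2"
  shows "(1 - 2 * q) * x + q > (0::real)"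
proof -
  have e: "(1 - 2 * q) * x + q = x + 2 * (q * (1/2 - x))" by (simp add: algebra_simps)
  show ?thesis
  proof (cases "x < 1/2")
    case True
    then have "q * (1/2 - x) > 0" using assms by simp
    then show ?thesis unfolding e using assms by linarith
  next
    case False
    then have "x = 1/2" using assms by simp
    then show ?thesis by (simp add: field_simps)
  qed
qed

lemma psi_le_half: "q > 0 \<Longrightarrow> 0 \<le> z \<Longrightarrow> z \<le> 1 \<Longrightarrow> psi q z \<le> 1/2"
  unfolding psi_def using psi_denom_pos[of q z] by (simp add: field_simps)

lemma dpsi_nonneg: "q > 0 \<Longrightarrow> 0 \<le> dpsi q z"
  by (simp add: dpsi_def)

lemma stilde_left: "x \<le> 1 / 2 \<Longrightarrow> stilde q x = x / ((1 - 2 * q) * x + q)"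
  by (simp add: stilde_def)

lemma stilde_right: "q > 0 \<Longrightarrow> 1 / 2 \<le> x \<Longrightarrow> stilde q x = (1 - x) / ((1 - 2 * q) * (1 - x) + q)"
proof (cases "x = 1/2")
  case True
  then have "1 - x = x" by simp
  then show ?thesis using True by (simp only: stilde_left)
qed (simp add: stilde_def)

lemma stilde_psi:
  assumes "q > 0" "0 \<le> z" "z \<le> 1"
  shows "stilde q (psi q z) = z"
proof -
  define s where "s = 1 + (2 * q - 1) * z"
  have s: "s > 0" unfolding s_def by (rule psi_denom_pos[OF assms])
  have p: "psi q z = q * z / s" by (simp add: psi_def s_def)
  have "(1 - 2 * q) * (q * z / s) + q = q * ((1 - 2*q) * z + s) / s"
    using s by (simp add: field_simps)
  also have "\<dots> = q / s" by (simp add: s_def algebra_simps)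
  finally show ?thesis
    using assms s stilde_left[OF psi_le_half[OF assms]] by (simp add: p)
qed

lemma stilde_range:
  assumes "q > 0" "x \<in> {0..1}" shows "stilde q x \<in> {0..1}"
proof -
  have main: "y / ((1 - 2 * q) * y + q) \<in> {0..1}" if y: "0 \<le> y" "y \<le> 1/2" for y
  proof -
    have "0 < (1 - 2 * q) * y + q" by (rule stilde_denom_pos[OF assms(1) y])
    moreover have "q * y * 2 \<le> q" using y assms(1) by simp
    ultimately show ?thesis using y by (auto simp: field_simps)
  qed
  show ?thesis unfolding stilde_def using main[of x] main[of "1-x"] assms(2) by auto
qed

lemma stilde_pow_range: "q > 0 \<Longrightarrow> x \<in> {0..1} \<Longrightarrow> (stilde q ^^ n) x \<in> {0..1}"
  by (induction n) (use stilde_range in auto)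

lemma stilde_measurable [measurable]: "stilde q \<in> borel_measurable borel"
  unfolding stilde_def by measurable

lemma funpow_measurable [measurable]:
  assumes [measurable]: "f \<in> measurable M M" shows "(f ^^ n) \<in> measurable M M"
  by (induction n) (auto intro: measurable_comp[OF _ assms])

lemma psi_deriv:
  assumes "q > 0" "z \<in> {0..1}"
  shows "(psi q has_real_derivative dpsi q z) (at z)"
proof -
  have "1 + (2 * q - 1) * z > 0" using psi_denom_pos assms by auto
  then show ?thesis unfolding psi_def dpsi_def
    by (auto intro!: derivative_eq_intros simp: power2_eq_square) (simp add: field_simps)
qed

lemma dpsi_cont: "q > 0 \<Longrightarrow> continuous_on {0..1} (dpsi q)"
  unfolding dpsi_def by (intro continuous_intros) (use psi_denom_pos in \<open>auto simp: less_le\<close>)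

text \<open>Substitution \<open>x = psi q z\<close>, which carries [0,1] onto the left half. As
  \<open>stilde q\<close> undoes \<open>psi q\<close>, membership of the image in \<open>A\<close>
  turns into membership of z.\<close>

lemma nn_integral_stilde_left:
  fixes h :: "real \<Rightarrow> real"
  assumes q: "q > 0" and [measurable]: "h \<in> borel_measurable borel" "A \<in> sets borel"
  shows "(\<integral>\<^sup>+x. ennreal (h x) * indicator {x. x \<in> {0..1/2} \<and> stilde q x \<in> A} x \<partial>lborel)
       = (\<integral>\<^sup>+z. ennreal (h (psi q z) * dpsi q z) * indicator (A \<inter> {0..1}) z \<partial>lborel)"
proof -
  let ?f = "\<lambda>x. h x * indicator A (stilde q x)"
  have e: "psi q 0 = 0" "psi q 1 = 1/2" using q by (auto simp: psi_def)
  have "(\<integral>\<^sup>+x. ennreal (h x) * indicator {x. x \<in> {0..1/2} \<and> stilde q x \<in> A} x \<partial>lborel)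
     = (\<integral>\<^sup>+x. ennreal (?f x * indicator {psi q 0..psi q 1} x) \<partial>lborel)"
    unfolding e by (intro nn_integral_cong) (auto split: split_indicator)
  also have "\<dots> = (\<integral>\<^sup>+x. ennreal (?f (psi q x) * dpsi q x * indicator {0..1} x) \<partial>lborel)"
    by (rule nn_integral_substitution)
       (auto simp: set_borel_measurable_def psi_deriv[OF q] dpsi_cont[OF q] dpsi_nonneg[OF q]
          simp del: times_divide_eq_right)
  also have "\<dots> = (\<integral>\<^sup>+z. ennreal (h (psi q z) * dpsi q z) * indicator (A \<inter> {0..1}) z \<partial>lborel)"
    using stilde_psi[OF q] dpsi_nonneg[OF q]
    by (intro nn_integral_cong) (auto split: split_indicator simp: ennreal_mult'')
  finally show ?thesis .
qed

text \<open>The reflection x -> 1-x exchanges the branches, so this is the left formula for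
  \<open>h (1 - x)\<close>.\<close>

lemma nn_integral_stilde_right:
  fixes h :: "real \<Rightarrow> real"
  assumes q: "q > 0" and [measurable]: "h \<in> borel_measurable borel" "A \<in> sets borel"
  shows "(\<integral>\<^sup>+x. ennreal (h x) * indicator {x. x \<in> {1/2<..1} \<and> stilde q x \<in> A} x \<partial>lborel)
       = (\<integral>\<^sup>+z. ennreal (h (1 - psi q z) * dpsi q z) * indicator (A \<inter> {0..1}) z \<partial>lborel)"
proof -
  have "(\<integral>\<^sup>+x. ennreal (h x) * indicator {x. x \<in> {1/2<..1} \<and> stilde q x \<in> A} x \<partial>lborel)
     = (\<integral>\<^sup>+x. ennreal (h (1 - x)) * indicator {x. x \<in> {1/2<..1} \<and> stilde q x \<in> A} (1 - x) \<partial>lborel)"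
    by (subst nn_integral_real_affine[where c = "-1" and t = 1]) auto
  also have "\<dots> = (\<integral>\<^sup>+x. ennreal (h (1 - x)) * indicator {x. x \<in> {0..1/2} \<and> stilde q x \<in> A} x \<partial>lborel)"
  proof (intro nn_integral_cong_AE)
    \<comment> \<open>The reflected domain is [0,1/2) instead of [0,1/2]; they differ in the point
      1/2 only.\<close>
    have "AE x in lborel. x \<noteq> (1/2::real)" by (rule AE_lborel_singleton)
    then show "AE x in lborel. ennreal (h (1 - x)) * indicator {x. x \<in> {1/2<..1} \<and> stilde q x \<in> A} (1 - x)
       = ennreal (h (1 - x)) * indicator {x. x \<in> {0..1/2} \<and> stilde q x \<in> A} x"
      by eventually_elim (auto split: split_indicator simp: stilde_def)
  qed
  also have "\<dots> = (\<integral>\<^sup>+z. ennreal (h (1 - psi q z) * dpsi q z) * indicator (A \<inter> {0..1}) z \<partial>lborel)"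
    by (rule nn_integral_stilde_left[OF q]) auto
  finally show ?thesis .
qed

lemma psi_measurable [measurable]: "psi q \<in> borel_measurable borel"
  unfolding psi_def by measurable

lemma dpsi_measurable [measurable]: "dpsi q \<in> borel_measurable borel"
  unfolding dpsi_def by measurable

text \<open>The integrand on the right is the transfer operator applied to \<open>h\<close>. Fixed
  points of it are invariant densities; densities that it decreases strictly show that surviving
  sets are null.\<close>

lemma nn_integral_stilde:
  fixes h :: "real \<Rightarrow> real"
  assumes q: "q > 0" and [measurable]: "h \<in> borel_measurable borel" "A \<in> sets borel"
    and nn: "\<And>x. h x \<ge> 0"
  shows "(\<integral>\<^sup>+x. ennreal (h x) * indicator {x. x \<in> {0..1} \<and> stilde q x \<in> A} x \<partial>lborel)
       = (\<integral>\<^sup>+z. ennreal ((h (psi q z) + h (1 - psi q z)) * dpsi q z) * indicator (A \<inter> {0..1}) z \<partial>lborel)"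
proof -
  have "(\<integral>\<^sup>+x. ennreal (h x) * indicator {x. x \<in> {0..1} \<and> stilde q x \<in> A} x \<partial>lborel)
     = (\<integral>\<^sup>+x. ennreal (h x) * indicator {x. x \<in> {0..1/2} \<and> stilde q x \<in> A} x
        + ennreal (h x) * indicator {x. x \<in> {1/2<..1} \<and> stilde q x \<in> A} x \<partial>lborel)"
    by (intro nn_integral_cong) (auto split: split_indicator)
  also have "\<dots> = (\<integral>\<^sup>+z. ennreal (h (psi q z) * dpsi q z) * indicator (A \<inter> {0..1}) z \<partial>lborel)
     + (\<integral>\<^sup>+z. ennreal (h (1 - psi q z) * dpsi q z) * indicator (A \<inter> {0..1}) z \<partial>lborel)"
    by (subst nn_integral_add) (simp_all only: nn_integral_stilde_left[OF q assms(2,3)] nn_integral_stilde_right[OF q assms(2,3)], measurable)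
  also have "\<dots> = (\<integral>\<^sup>+z. ennreal ((h (psi q z) + h (1 - psi q z)) * dpsi q z) * indicator (A \<inter> {0..1}) z \<partial>lborel)"
    by (subst nn_integral_add[symmetric])
       (auto intro!: nn_integral_cong split: split_indicator simp: nn dpsi_nonneg[OF q] distrib_right simp flip: ennreal_plus)
  finally show ?thesis .
qed

section \<open>The attracting case\<close>

lemma AE_leb01: "(AE x in leb01. P x) \<longleftrightarrow> (AE x in lborel. x \<in> {0..1} \<longrightarrow> P x)"
  unfolding leb01_def by (subst AE_restrict_space_iff) auto

text \<open>Left of the repelling fixed point the denominator of the left branch exceeds 1. It
  decreases in x, so its value \<open>c\<close> at the starting point bounds it from below along the
  whole shrinking orbit and gives decay at rate \<open>1 / c\<close>.\<close>

lemma stilde_attracted: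
  assumes q: "q > 1" and x: "0 \<le> x" "x < (q - 1) / (2 * q - 1)"
  shows "(\<lambda>n. (stilde q ^^ n) x) \<longlonglongrightarrow> 0"
proof -
  define c where "c = (1 - 2 * q) * x + q"
  have q2: "2 * q - 1 > 0" using q by simp
  have "(2 * q - 1) * x < q - 1" using x q2 by (simp add: field_simps)
  then have c: "c > 1" unfolding c_def by (simp add: algebra_simps)
  have "(q - 1) / (2 * q - 1) \<le> 1/2" using q2 by (simp add: field_simps)
  then have half: "x \<le> 1/2" using x by linarith
  have bd: "0 \<le> (stilde q ^^ n) x \<and> (stilde q ^^ n) x \<le> x * (1 / c) ^ n" for n
  proof (induction n)
    case 0
    then show ?case using x by simp
  next
    case (Suc n)
    let ?y = "(stilde q ^^ n) x"
    have "x * (1 / c) ^ n \<le> x * 1"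
      using c x by (intro mult_left_mono power_le_one) auto
    then have y: "0 \<le> ?y" "?y \<le> x" using Suc by auto
    have "(2 * q - 1) * ?y \<le> (2 * q - 1) * x" using y q2 by (intro mult_left_mono) auto
    then have c': "c \<le> (1 - 2 * q) * ?y + q" unfolding c_def by (simp add: algebra_simps)
    have e: "stilde q ?y = ?y / ((1 - 2 * q) * ?y + q)" using y half by (intro stilde_left) auto
    have "?y / ((1 - 2 * q) * ?y + q) \<le> ?y / c"
      using c' c y by (intro divide_left_mono) auto
    also have "\<dots> \<le> x * (1 / c) ^ n / c" using Suc c by (intro divide_right_mono) auto
    finally have "stilde q ?y \<le> x * (1 / c) ^ Suc n" by (simp add: e mult.commute)
    moreover have "0 \<le> stilde q ?y" unfolding e using y c' c by simp
    ultimately show ?case by simp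
  qed
  have "(\<lambda>n. x * (1 / c) ^ n) \<longlonglongrightarrow> x * 0"
    using c by (intro tendsto_mult_left LIMSEQ_power_zero) simp
  then have lim: "(\<lambda>n. x * (1 / c) ^ n) \<longlonglongrightarrow> 0" by simp
  show ?thesis
    by (rule tendsto_sandwich[OF _ _ tendsto_const lim]) (rule always_eventually, use bd in blast)+
qed

(* With this density the transfer operator strictly decreases the mass, because its pole
   lies below the repelling fixed point. *)
lemma transfer_density_less:
  assumes q: "q > 1" and c: "0 < c" "c < (q - 1) / (2 * q - 1)" and z: "(q - 1) / (2 * q - 1) \<le> z" "z \<le> 1"
  shows "c < psi q z" "psi q z < 1 - c"
    "(1 / (psi q z - c) + 1 / (1 - psi q z - c)) * dpsi q z < 1 / (z - c)"
proof -
  \<comment> \<open>This is \<open>(2q-1)\<close> times the distance of \<open>c\<close> from the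
    repelling fixed point. At \<open>m = 0\<close> the inequality below degenerates to the equality
    for the invariant density.\<close>
  define m where "m = q - 1 - c * (2 * q - 1)"
  define s where "s = 1 + (2 * q - 1) * z"
  have q2: "2 * q - 1 > 0" using q by simp
  have m: "m > 0" using c q2 by (simp add: m_def field_simps)
  have zc: "c < z" using c z by linarith
  have z0: "0 < z" using zc c by linarith
  have s: "s > 0" using q2 z0 by (simp add: s_def add_pos_pos)
  have "(q - 1) / (2 * q - 1) \<le> 1/2" using q2 q by (simp add: field_simps)
  then have c2: "c < 1/2" using c by linarith
  \<comment> \<open>\<open>A / s\<close> and \<open>B / s\<close> are the values of
    \<open>psi q z - c\<close> and \<open>1 - psi q z - c\<close>. Their sum is constant, which
    cancels the factor \<open>s\<close> left over from \<open>dpsi\<close>.\<close>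
  define A where "A = (m + 1) * z - c"
  define B where "B = 1 - c + m * z"
  have "m * z > 0" using m z0 by simp
  then have A: "A > 0" and B: "B > 0" using zc c2 by (auto simp: A_def B_def distrib_right)
  have p: "psi q z = q * z / s" by (simp add: psi_def s_def)
  have eA: "psi q z - c = A / s"
  proof -
    have "psi q z - c = (q * z - c * s) / s" using s by (simp add: p diff_divide_distrib)
    also have "q * z - c * s = A" by (simp add: A_def s_def m_def algebra_simps)
    finally show ?thesis .
  qed
  have eB: "1 - psi q z - c = B / s"
  proof -
    have "1 - psi q z - c = (s - q * z - c * s) / s" using s by (simp add: p diff_divide_distrib)
    also have "s - q * z - c * s = B" by (simp add: B_def s_def m_def algebra_simps)
    finally show ?thesis .
  qed
  have "A / s > 0" "B / s > 0" using A B s by simp_all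
  then show "c < psi q z" "psi q z < 1 - c" using eA eB by linarith+
  have AB: "A + B = (1 - 2 * c) * s" by (simp add: A_def B_def m_def s_def algebra_simps)
  have "(1 / (psi q z - c) + 1 / (1 - psi q z - c)) * dpsi q z = (s / A + s / B) * (q / s\<^sup>2)"
    by (simp add: eA eB dpsi_def s_def)
  also have "\<dots> = q * (A + B) / (s * A * B)"
    using A B s by (simp add: field_simps power2_eq_square)
  also have "\<dots> = q * (1 - 2 * c) / (A * B)"
    unfolding AB using s by (simp add: mult.assoc)
  also have "\<dots> < 1 / (z - c)"
  proof -
    have "A * B - q * (1 - 2 * c) * (z - c) = m * ((m + 1) * z\<^sup>2 - 2 * c * z + c)"
    proof -
      have "q * (1 - 2 * c) = m + 1 - c" by (simp add: m_def algebra_simps)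
      then show ?thesis unfolding A_def B_def by (simp only:) (simp add: algebra_simps power2_eq_square)
    qed
    also have "(m + 1) * z\<^sup>2 - 2 * c * z + c = m * z\<^sup>2 + (z - c)\<^sup>2 + c * (1 - c)"
      by (simp add: algebra_simps power2_eq_square)
    also have "m * (m * z\<^sup>2 + (z - c)\<^sup>2 + c * (1 - c)) > 0"
      using m z0 c c2 by (intro mult_pos_pos add_nonneg_pos) auto
    finally have "q * (1 - 2 * c) * (z - c) < A * B" by simp
    then show ?thesis using A B zc by (simp add: field_simps)
  qed
  finally show "(1 / (psi q z - c) + 1 / (1 - psi q z - c)) * dpsi q z < 1 / (z - c)" .
qed

text \<open>The survivor set \<open>K\<close> is contained in its own preimage, so its
  \<open>h\<close>-mass is at most that of the preimage, which equals the \<open>g\<close>-mass of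
  \<open>K\<close> for the transferred density \<open>g\<close>. As \<open>g < h\<close> on
  \<open>K\<close> and these masses are finite, \<open>K\<close> is null.\<close>

lemma stilde_AE_attracted:
  assumes q: "q > 1"
  shows "AE x in leb01. (\<lambda>n. (stilde q ^^ n) x) \<longlonglongrightarrow> 0"
proof -
  define xs where "xs = (q - 1) / (2 * q - 1)"
  have q0: "q > 0" using q by simp
  have xs: "0 < xs" "xs < 1" using q by (auto simp: xs_def field_simps)
  \<comment> \<open>Any value strictly between 0 and \<open>xs\<close> serves.\<close>
  define c where "c = xs / 2"
  have c: "0 < c" "c < xs" using xs by (auto simp: c_def)
  define K where "K = {x \<in> {0..1}. \<forall>n. xs \<le> (stilde q ^^ n) x}"
  have [measurable]: "K \<in> sets borel" unfolding K_def by measurable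
  \<comment> \<open>Cutting off below \<open>xs\<close> keeps \<open>h\<close> nonnegative and
    bounded. In \<open>g\<close> it can only remove terms, so the strict inequality
    survives.\<close>
  define h where "h x = (if xs \<le> x then 1 / (x - c) else 0)" for x
  have hn: "h x \<ge> 0" for x using c by (auto simp: h_def)
  have [measurable]: "h \<in> borel_measurable borel" unfolding h_def by measurable
  define g where "g z = (h (psi q z) + h (1 - psi q z)) * dpsi q z" for z
  have [measurable]: "g \<in> borel_measurable borel" unfolding g_def by measurable
  have gn: "g z \<ge> 0" for z unfolding g_def using hn dpsi_nonneg[OF q0] by simp
  have KT: "x \<in> {0..1} \<and> stilde q x \<in> K" if "x \<in> K" for x
  proof -
    have "xs \<le> (stilde q ^^ n) (stilde q x)" for n
    proof -
      have "xs \<le> (stilde q ^^ Suc n) x" using that unfolding K_def by blast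
      then show ?thesis by (simp only: funpow_Suc_right o_def)
    qed
    then show ?thesis using that stilde_range[OF q0, of x] by (auto simp: K_def)
  qed
  have Kxs: "xs \<le> x" if "x \<in> K" for x
    using that unfolding K_def by (auto dest: spec[of _ 0])
  have less: "g z < h z" if "z \<in> K" for z
  proof -
    have z: "xs \<le> z" "z \<le> 1" "0 \<le> z" using Kxs[OF that] that by (auto simp: K_def)
    note t = transfer_density_less[OF q, of c z, folded xs_def, OF c z(1,2)]
    have "h (psi q z) \<le> 1 / (psi q z - c)" "h (1 - psi q z) \<le> 1 / (1 - psi q z - c)"
      using t(1,2) by (auto simp: h_def)
    then have "g z \<le> (1 / (psi q z - c) + 1 / (1 - psi q z - c)) * dpsi q z"
      unfolding g_def by (intro mult_right_mono add_mono dpsi_nonneg[OF q0]) auto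
    also have "\<dots> < 1 / (z - c)" by (rule t(3))
    finally show ?thesis using z by (simp add: h_def)
  qed
  let ?I = "\<lambda>f. \<integral>\<^sup>+x. ennreal (f x) * indicator K x \<partial>lborel"
  have "?I h \<le> (\<integral>\<^sup>+x. ennreal (h x) * indicator {x. x \<in> {0..1} \<and> stilde q x \<in> K} x \<partial>lborel)"
    using KT by (intro nn_integral_mono) (auto split: split_indicator)
  also have "\<dots> = (\<integral>\<^sup>+z. ennreal (g z) * indicator (K \<inter> {0..1}) z \<partial>lborel)"
    unfolding g_def by (intro nn_integral_stilde[OF q0]) (auto simp: hn)
  also have "K \<inter> {0..1} = K" by (auto simp: K_def)
  finally have le: "?I h \<le> ?I g" .
  have fin: "?I g < \<infinity>"
  proof -
    have "?I g \<le> ?I h" using less_imp_le[OF less] by (intro nn_integral_mono) (auto split: split_indicator intro!: ennreal_leI)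
    also have "?I h \<le> (\<integral>\<^sup>+x. ennreal (1 / (xs - c)) * indicator {0..1::real} x \<partial>lborel)"
    proof (intro nn_integral_mono)
      fix x
      have "h x \<le> 1 / (xs - c)"
      proof (cases "xs \<le> x")
        case True
        then show ?thesis using c by (simp add: h_def frac_le)
      qed (use c in \<open>simp add: h_def\<close>)
      then show "ennreal (h x) * indicator K x \<le> ennreal (1 / (xs - c)) * indicator {0..1} x"
        by (auto split: split_indicator intro!: ennreal_leI simp: K_def)
    qed
    also have "\<dots> = ennreal (1 / (xs - c)) * emeasure lborel {0..1::real}"
      by (rule nn_integral_cmult_indicator) simp
    also have "\<dots> < \<infinity>" by (simp add: ennreal_mult_less_top)
    finally show ?thesis .
  qed
  have "?I g + ?I (\<lambda>z. h z - g z) = ?I h"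
  proof (subst nn_integral_add[symmetric])
    have "ennreal (g z) + ennreal (h z - g z) = ennreal (h z)" if "z \<in> K" for z
      using less[OF that] gn[of z] by (simp flip: ennreal_plus)
    then show "(\<integral>\<^sup>+x. ennreal (g x) * indicator K x + ennreal (h x - g x) * indicator K x \<partial>lborel) = ?I h"
      by (intro nn_integral_cong) (auto split: split_indicator)
  qed auto
  with le fin have "?I (\<lambda>z. h z - g z) = 0"
    using ennreal_add_left_cancel_le[of "?I g" "?I (\<lambda>z. h z - g z)" 0] by auto
  then have "AE z in lborel. ennreal (h z - g z) * indicator K z = 0"
    by (subst (asm) nn_integral_0_iff_AE) auto
  then have "AE z in lborel. z \<notin> K"
  proof eventually_elim
    case (elim z)
    show ?case
    proof
      assume "z \<in> K"
      then have "ennreal (h z - g z) = 0" "h z - g z > 0" using elim less[of z] by auto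
      then show False by (simp add: ennreal_eq_0_iff)
    qed
  qed
  then have "AE x in lborel. x \<in> {0..1} \<longrightarrow> (\<lambda>n. (stilde q ^^ n) x) \<longlonglongrightarrow> 0"
  proof eventually_elim
    case (elim x)
    show ?case
    proof
      assume x: "x \<in> {0..1}"
      then obtain n where n: "(stilde q ^^ n) x < xs" using elim by (auto simp: K_def not_le)
      have "(\<lambda>k. (stilde q ^^ k) ((stilde q ^^ n) x)) \<longlonglongrightarrow> 0"
        using stilde_pow_range[OF q0 x, of n] n by (intro stilde_attracted[OF q]) (auto simp: xs_def)
      then have "(\<lambda>k. (stilde q ^^ (k + n)) x) \<longlonglongrightarrow> 0" by (simp add: funpow_add)
      then show "(\<lambda>k. (stilde q ^^ k) x) \<longlonglongrightarrow> 0" by (rule LIMSEQ_offset)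
    qed
  qed
  then show ?thesis by (simp add: AE_leb01)
qed

section \<open>Invariant densities and ergodicity\<close>

lemma preserves_vimage:
  assumes "preserves T \<mu>" "A \<in> sets \<mu>"
  shows "T -` A \<inter> space \<mu> \<in> sets \<mu>" "emeasure \<mu> (T -` A \<inter> space \<mu>) = emeasure \<mu> A"
  using assms by (auto simp: preserves_def measurable_sets)

text \<open>\<open>ergodic\<close> speaks only of sets equal to their preimage. An almost invariant
  \<open>B\<close> is replaced by the set of points whose orbit is eventually in \<open>B\<close>;
  that set is strictly invariant and agrees with \<open>B\<close> almost everywhere.\<close>

lemma ergodic_AE_invariant:
  assumes "prob_space \<mu>" and pres: "preserves T \<mu>" and erg: "ergodic T \<mu>"
    and [measurable]: "B \<in> sets \<mu>" and inv: "AE x in \<mu>. T x \<in> B \<longleftrightarrow> x \<in> B"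
  shows "(AE x in \<mu>. x \<in> B) \<or> (AE x in \<mu>. x \<notin> B)"
proof -
  interpret prob_space \<mu> by fact
  have T [measurable]: "T \<in> measurable \<mu> \<mu>" using pres by (simp add: preserves_def)
  have Tn [measurable]: "(T ^^ n) \<in> measurable \<mu> \<mu>" for n by simp
  have sp: "T x \<in> space \<mu>" if "x \<in> space \<mu>" for x using measurable_space[OF T that] .
  have pull: "AE x in \<mu>. P (T x)" if "AE x in \<mu>. P x" for P
  proof -
    from that obtain N where N: "{x \<in> space \<mu>. \<not> P x} \<subseteq> N" "N \<in> sets \<mu>" "emeasure \<mu> N = 0"
      by (auto elim: AE_E)
    show ?thesis
      using N preserves_vimage[OF pres N(2)] sp by (intro AE_I[of _ _ "T -` N \<inter> space \<mu>"]) auto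
  qed
  have "AE x in \<mu>. (T ^^ n) x \<in> B \<longleftrightarrow> x \<in> B" for n
  proof (induction n)
    case (Suc n)
    from pull[OF Suc] inv show ?case by eventually_elim (simp add: funpow_swap1)
  qed simp
  then have all: "AE x in \<mu>. \<forall>n. (T ^^ n) x \<in> B \<longleftrightarrow> x \<in> B" by (simp add: AE_all_countable)
  define B' where "B' = {x \<in> space \<mu>. \<exists>N. \<forall>n\<ge>N. (T ^^ n) x \<in> B}"
  have [measurable]: "B' \<in> sets \<mu>" unfolding B'_def by measurable
  have eq: "(\<exists>N. \<forall>n\<ge>N. (T ^^ n) (T x) \<in> B) \<longleftrightarrow> (\<exists>N. \<forall>n\<ge>N. (T ^^ n) x \<in> B)" for x
  proof
    assume "\<exists>N. \<forall>n\<ge>N. (T ^^ n) (T x) \<in> B"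
    then obtain N where N: "\<forall>n\<ge>N. (T ^^ Suc n) x \<in> B" by (auto simp: funpow_swap1)
    have "(T ^^ n) x \<in> B" if "n \<ge> Suc N" for n
      using N[rule_format, of "n - 1"] that by (cases n) auto
    then show "\<exists>N. \<forall>n\<ge>N. (T ^^ n) x \<in> B" by blast
  next
    assume "\<exists>N. \<forall>n\<ge>N. (T ^^ n) x \<in> B"
    then obtain N where N: "\<forall>n\<ge>N. (T ^^ n) x \<in> B" by blast
    have "(T ^^ n) (T x) \<in> B" if "n \<ge> N" for n
      using N[rule_format, of "Suc n"] that by (simp add: funpow_swap1)
    then show "\<exists>N. \<forall>n\<ge>N. (T ^^ n) (T x) \<in> B" by blast
  qed
  have "T -` B' \<inter> space \<mu> = B'" using sp by (auto simp: B'_def eq)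
  then have e01: "emeasure \<mu> B' = 0 \<or> emeasure \<mu> B' = 1" using erg by (auto simp: ergodic_def)
  have BB: "AE x in \<mu>. x \<in> B \<longleftrightarrow> x \<in> B'"
    using all AE_space by eventually_elim (auto simp: B'_def)
  have z: "AE x in \<mu>. x \<notin> B'" if "emeasure \<mu> B' = 0"
    using that by (intro AE_not_in) (auto simp: null_sets_def)
  have o: "AE x in \<mu>. x \<in> B'" if "emeasure \<mu> B' = 1"
    using that by (intro prob_eq_1[THEN iffD1]) (auto simp: emeasure_eq_measure)
  from e01 z o have "(AE x in \<mu>. x \<in> B') \<or> (AE x in \<mu>. x \<notin> B')" by blast
  then show ?thesis
  proof
    assume "AE x in \<mu>. x \<in> B'"
    with BB have "AE x in \<mu>. x \<in> B" by eventually_elim simp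
    then show ?thesis ..
  next
    assume "AE x in \<mu>. x \<notin> B'"
    with BB have "AE x in \<mu>. x \<notin> B" by eventually_elim simp
    then show ?thesis ..
  qed
qed

(* The sublevel set B of the density is compared with its preimage: both have the same \<mu>- and
   \<nu>-measure, which is impossible if they differ by a set of positive \<mu>-measure. *)
lemma invariant_density_dichotomy:
  fixes t :: real
  assumes "prob_space \<mu>" and pres: "preserves T \<mu>" and erg: "ergodic T \<mu>"
    and [measurable]: "f \<in> borel_measurable \<mu>" and pres': "preserves T (density \<mu> f)"
  shows "(AE x in \<mu>. f x < ennreal t) \<or> (AE x in \<mu>. ennreal t \<le> f x)"
proof -
  interpret prob_space \<mu> by fact
  let ?\<nu> = "density \<mu> f"
  have T [measurable]: "T \<in> measurable \<mu> \<mu>" using pres by (simp add: preserves_def)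
  define B where "B = {x \<in> space \<mu>. f x < ennreal t}"
  define C where "C = T -` B \<inter> space \<mu>"
  have B [measurable]: "B \<in> sets \<mu>" unfolding B_def by measurable
  have C [measurable]: "C \<in> sets \<mu>" unfolding C_def by measurable
  have em: "emeasure \<mu> C = emeasure \<mu> B" unfolding C_def by (rule preserves_vimage[OF pres B])
  have en: "emeasure ?\<nu> C = emeasure ?\<nu> B"
    using preserves_vimage(2)[OF pres', of B] by (simp add: C_def)
  have upper: "emeasure ?\<nu> D \<le> ennreal t * emeasure \<mu> D" if "D \<in> sets \<mu>" "D \<subseteq> B" for D
  proof -
    have "emeasure ?\<nu> D = (\<integral>\<^sup>+x. f x * indicator D x \<partial>\<mu>)" using that by (simp add: emeasure_density)
    also have "\<dots> \<le> (\<integral>\<^sup>+x. ennreal t * indicator D x \<partial>\<mu>)"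
      using that by (intro nn_integral_mono) (auto split: split_indicator simp: B_def)
    also have "\<dots> = ennreal t * emeasure \<mu> D" by (rule nn_integral_cmult_indicator) fact
    finally show ?thesis .
  qed
  \<comment> \<open>Inside \<open>B\<close> the density is below \<open>t\<close>, so the second
    measure is finite there even if its total mass is not. The cancellations below depend on
    this.\<close>
  have fin: "emeasure ?\<nu> D \<noteq> \<infinity>" if "D \<in> sets \<mu>" "D \<subseteq> B" for D
  proof -
    have "ennreal t * emeasure \<mu> D < \<infinity>"
      by (simp add: less_top[symmetric] ennreal_mult_eq_top_iff)
    then show ?thesis using upper[OF that] by (auto simp: top_unique)
  qed
  have split: "emeasure M B = emeasure M (B - C) + emeasure M (B \<inter> C)"
    "emeasure M C = emeasure M (C - B) + emeasure M (B \<inter> C)" if "sets M = sets \<mu>" for M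
  proof -
    have "B \<in> sets M" "C \<in> sets M" using that by auto
    moreover have "(B - C) \<inter> (B \<inter> C) = {}" "(C - B) \<inter> (B \<inter> C) = {}" by auto
    moreover have "B - C \<union> B \<inter> C = B" "C - B \<union> B \<inter> C = C" by auto
    ultimately show "emeasure M B = emeasure M (B - C) + emeasure M (B \<inter> C)"
      "emeasure M C = emeasure M (C - B) + emeasure M (B \<inter> C)"
      using plus_emeasure[of "B - C" M "B \<inter> C"] plus_emeasure[of "C - B" M "B \<inter> C"] by auto
  qed
  have m: "emeasure \<mu> (B - C) = emeasure \<mu> (C - B)"
    using em split[of \<mu>] ennreal_add_left_cancel[of "emeasure \<mu> (B \<inter> C)"] by (simp add: add.commute)
  have n: "emeasure ?\<nu> (B - C) = emeasure ?\<nu> (C - B)"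
    using en split[of ?\<nu>] fin[of "B \<inter> C"] ennreal_add_left_cancel[of "emeasure ?\<nu> (B \<inter> C)"]
    by (simp add: add.commute)
  have tB: "(\<integral>\<^sup>+x. ennreal t * indicator (B - C) x \<partial>\<mu>) = ennreal t * emeasure \<mu> (B - C)"
    by (rule nn_integral_cmult_indicator) measurable
  have "ennreal t * emeasure \<mu> (C - B) = (\<integral>\<^sup>+x. ennreal t * indicator (C - B) x \<partial>\<mu>)"
    by (rule nn_integral_cmult_indicator[symmetric]) measurable
  also have "\<dots> \<le> (\<integral>\<^sup>+x. f x * indicator (C - B) x \<partial>\<mu>)"
    by (intro nn_integral_mono) (auto split: split_indicator simp: B_def C_def)
  also have "\<dots> = emeasure ?\<nu> (B - C)" unfolding n by (simp add: emeasure_density)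
  finally have ge: "ennreal t * emeasure \<mu> (B - C) \<le> emeasure ?\<nu> (B - C)" by (simp only: m)
  have "AE x in \<mu>. x \<notin> B - C"
  proof -
    \<comment> \<open>\<open>B - C\<close> and \<open>C - B\<close> have equal mass under both
      measures, yet \<open>f < t\<close> on the first and \<open>t \<le> f\<close> on the second. So
      the deficit \<open>t - f\<close> integrates to 0 over \<open>B - C\<close>, although it is
      positive there.\<close>
    let ?d = "\<lambda>x. (ennreal t - f x) * indicator (B - C) x"
    have "(\<integral>\<^sup>+x. f x * indicator (B - C) x \<partial>\<mu>) + (\<integral>\<^sup>+x. ?d x \<partial>\<mu>) = (\<integral>\<^sup>+x. ennreal t * indicator (B - C) x \<partial>\<mu>)"
      by (subst nn_integral_add[symmetric])
        (auto intro!: nn_integral_cong split: split_indicator simp: B_def add_diff_inverse_ennreal less_imp_le)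
    then have "emeasure ?\<nu> (B - C) + (\<integral>\<^sup>+x. ?d x \<partial>\<mu>) \<le> emeasure ?\<nu> (B - C)"
      using ge by (simp only: tB) (simp add: emeasure_density)
    then have "(\<integral>\<^sup>+x. ?d x \<partial>\<mu>) = 0"
      using fin[of "B - C"] ennreal_add_left_cancel_le[of "emeasure ?\<nu> (B - C)" _ 0] by auto
    then have "AE x in \<mu>. ?d x = 0" by (subst (asm) nn_integral_0_iff_AE) auto
    then show ?thesis
      by eventually_elim (auto split: split_indicator_asm simp: B_def diff_eq_0_iff_ennreal)
  qed
  moreover have "AE x in \<mu>. x \<notin> C - B"
  proof -
    have "emeasure \<mu> (B - C) = 0"
      using calculation by (subst (asm) AE_iff_measurable[where N = "B - C"]) (auto simp: B_def)
    then show ?thesis using m by (intro AE_not_in) (auto simp: null_sets_def)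
  qed
  ultimately have "AE x in \<mu>. T x \<in> B \<longleftrightarrow> x \<in> B"
    using AE_space by eventually_elim (auto simp: C_def)
  from ergodic_AE_invariant[OF \<open>prob_space \<mu>\<close> pres erg B this] show ?thesis
  proof
    assume "AE x in \<mu>. x \<in> B"
    then have "AE x in \<mu>. f x < ennreal t" by eventually_elim (auto simp: B_def)
    then show ?thesis ..
  next
    assume "AE x in \<mu>. x \<notin> B"
    then have "AE x in \<mu>. ennreal t \<le> f x" using AE_space by eventually_elim (auto simp: B_def)
    then show ?thesis ..
  qed
qed

text \<open>By the dichotomy at level 1 the Radon-Nikodym derivative is below 1 almost everywhere or
  at least 1 almost everywhere. Since it integrates to 1, it is 1.\<close>

lemma ergodic_unique:
  assumes "prob_space \<mu>" "preserves T \<mu>" "ergodic T \<mu>"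
    and "prob_space \<nu>" "preserves T \<nu>" "sets \<nu> = sets \<mu>" "absolutely_continuous \<mu> \<nu>"
  shows "\<nu> = \<mu>"
proof -
  interpret prob_space \<mu> by fact
  interpret N: prob_space \<nu> by fact
  define f where "f = RN_deriv \<mu> \<nu>"
  have [measurable]: "f \<in> borel_measurable \<mu>" unfolding f_def by simp
  have d: "density \<mu> f = \<nu>" unfolding f_def by (rule density_RN_deriv) fact+
  have int: "(\<integral>\<^sup>+x. f x \<partial>\<mu>) = 1"
  proof -
    have "emeasure \<nu> (space \<mu>) = 1" using N.emeasure_space_1 sets_eq_imp_space_eq[OF assms(6)] by simp
    then show ?thesis unfolding d[symmetric] by (simp add: emeasure_density cong: nn_integral_cong)
  qed
  have "preserves T (density \<mu> f)" using assms(5) d by simp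
  then have "(AE x in \<mu>. f x < 1) \<or> (AE x in \<mu>. 1 \<le> f x)"
    using invariant_density_dichotomy[of \<mu> T f 1] assms(1-3) by simp
  then have "AE x in \<mu>. f x = 1"
  proof
    assume "AE x in \<mu>. f x < 1"
    then have "AE x in \<mu>. 1 - f x \<noteq> 0" "AE x in \<mu>. f x + (1 - f x) = 1"
      by (eventually_elim, auto simp: diff_eq_0_iff_ennreal add_diff_inverse_ennreal less_imp_le)+
    have "(\<integral>\<^sup>+x. f x \<partial>\<mu>) + (\<integral>\<^sup>+x. 1 - f x \<partial>\<mu>) = (\<integral>\<^sup>+x. 1 \<partial>\<mu>)"
      using \<open>AE x in \<mu>. f x + (1 - f x) = 1\<close>
      by (subst nn_integral_add[symmetric]) (simp, simp, rule nn_integral_cong_AE)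
    then have "1 + (\<integral>\<^sup>+x. 1 - f x \<partial>\<mu>) = 1 + 0" using int by (simp add: emeasure_space_1)
    then have "(\<integral>\<^sup>+x. 1 - f x \<partial>\<mu>) = 0" by (subst (asm) ennreal_add_left_cancel) auto
    then have "AE x in \<mu>. 1 - f x = 0" by (subst (asm) nn_integral_0_iff_AE) auto
    with \<open>AE x in \<mu>. 1 - f x \<noteq> 0\<close> have "AE x in \<mu>. False" by eventually_elim auto
    then show ?thesis by simp
  next
    assume ge: "AE x in \<mu>. 1 \<le> f x"
    then have "AE x in \<mu>. 1 + (f x - 1) = f x" by eventually_elim (simp add: add_diff_inverse_ennreal)
    then have "(\<integral>\<^sup>+x. 1 \<partial>\<mu>) + (\<integral>\<^sup>+x. f x - 1 \<partial>\<mu>) = (\<integral>\<^sup>+x. f x \<partial>\<mu>)"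
      by (subst nn_integral_add[symmetric]) (simp, simp, rule nn_integral_cong_AE)
    then have "1 + (\<integral>\<^sup>+x. f x - 1 \<partial>\<mu>) = 1 + 0" using int by (simp add: emeasure_space_1)
    then have "(\<integral>\<^sup>+x. f x - 1 \<partial>\<mu>) = 0" by (subst (asm) ennreal_add_left_cancel) auto
    then have "AE x in \<mu>. f x - 1 = 0" by (subst (asm) nn_integral_0_iff_AE) auto
    then show ?thesis using ge by eventually_elim (auto simp: diff_eq_0_iff_ennreal)
  qed
  then have "density \<mu> f = density \<mu> (\<lambda>_. 1)" by (intro density_cong) auto
  then show ?thesis using d by (simp add: density_1)
qed

text \<open>With infinite mass the derivative cannot stay below any n, so the dichotomy pushes it
  above every n almost everywhere. Sigma-finiteness makes it finite almost everywhere, a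
  contradiction.\<close>

lemma ergodic_no_infinite_invariant:
  assumes "prob_space \<mu>" "preserves T \<mu>" "ergodic T \<mu>"
    and "sigma_finite_measure \<nu>" "preserves T \<nu>" "sets \<nu> = sets \<mu>" "absolutely_continuous \<mu> \<nu>"
  shows "emeasure \<nu> (space \<nu>) < \<infinity>"
proof (rule ccontr)
  assume inf: "\<not> emeasure \<nu> (space \<nu>) < \<infinity>"
  interpret prob_space \<mu> by fact
  define f where "f = RN_deriv \<mu> \<nu>"
  have [measurable]: "f \<in> borel_measurable \<mu>" unfolding f_def by simp
  have d: "density \<mu> f = \<nu>" unfolding f_def by (rule density_RN_deriv) fact+
  have "AE x in \<mu>. f x \<noteq> \<infinity>" unfolding f_def by (rule RN_deriv_finite) fact+
  moreover have "AE x in \<mu>. \<forall>n. ennreal (real n) \<le> f x"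
  proof (subst AE_all_countable, intro allI)
    fix n
    have "\<not> (AE x in \<mu>. f x < ennreal (real n))"
    proof
      assume "AE x in \<mu>. f x < ennreal (real n)"
      then have "(\<integral>\<^sup>+x. f x \<partial>\<mu>) \<le> (\<integral>\<^sup>+x. ennreal (real n) \<partial>\<mu>)"
        by (intro nn_integral_mono_AE) (auto elim: eventually_mono)
      also have "\<dots> < \<infinity>" by (simp add: emeasure_space_1)
      finally have "emeasure \<nu> (space \<mu>) < \<infinity>"
        unfolding d[symmetric] by (simp add: emeasure_density cong: nn_integral_cong)
      then show False using inf sets_eq_imp_space_eq[OF assms(6)] by simp
    qed
    then show "AE x in \<mu>. ennreal (real n) \<le> f x"
      using invariant_density_dichotomy[of \<mu> T f "real n"] assms d by auto
  qed
  ultimately have "AE x in \<mu>. False"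
  proof eventually_elim
    case (elim x)
    then obtain r where r: "f x = ennreal r" "r \<ge> 0" by (cases "f x") auto
    obtain n where "r < real n" using reals_Archimedean2 by blast
    moreover have "ennreal (real n) \<le> ennreal r" using elim r by simp
    ultimately show False using r by (simp add: ennreal_le_iff)
  qed
  then show False by simp
qed

section \<open>Cylinders\<close>

text \<open>Words are read backwards: the head of the list is the last symbol of the itinerary. If
  \<open>den q v = (d, e)\<close>, then \<open>weight q v\<close> is the absolute derivative
  \<open>q ^ n / (d + (e - d) z)\<^sup>2\<close> of the inverse branch onto the cylinder of \<open>v\<close>, so that \<open>d\<close> and \<open>e\<close>
  are the values of the Moebius denominator at the endpoints 0 and 1.\<close>

primrec cyl :: "real \<Rightarrow> bool list \<Rightarrow> real set" where
  "cyl q [] = {0..1}"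
| "cyl q (s # v) = {x \<in> cyl q v. (1/2 < (stilde q ^^ length v) x) = s}"

primrec den :: "real \<Rightarrow> bool list \<Rightarrow> real \<times> real" where
  "den q [] = (1, 1)"
| "den q (s # v) = (if s then snd (den q v) else fst (den q v), q * (fst (den q v) + snd (den q v)))"

definition weight :: "real \<Rightarrow> bool list \<Rightarrow> real \<Rightarrow> real" where
  "weight q v z = q ^ length v / (fst (den q v) + (snd (den q v) - fst (den q v)) * z)\<^sup>2"

lemma den_pos: "q > 0 \<Longrightarrow> fst (den q v) > 0 \<and> snd (den q v) > 0"
  by (induction v) (auto simp: add_pos_pos)

lemma cyl_measurable [measurable]: "cyl q v \<in> sets borel"
  by (induction v) auto

lemma cyl_subset: "cyl q v \<subseteq> {0..1}"
  by (induction v) auto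

lemma weight_measurable [measurable]: "weight q v \<in> borel_measurable borel"
  unfolding weight_def by measurable

text \<open>Chain rule. The denominator of \<open>v\<close> at the inner preimage, times the
  denominator \<open>1 + (2q-1)z\<close> of \<open>psi\<close>, is again affine in z; its values at
  0 and 1 are the components in the recursion of \<open>den\<close>.\<close>

lemma weight_Cons:
  assumes q: "q > 0" and z: "z \<in> {0..1}"
  shows "weight q (s # v) z = weight q v (if s then 1 - psi q z else psi q z) * dpsi q z"
proof -
  define t where "t = 1 + (2 * q - 1) * z"
  have t: "t > 0" unfolding t_def using psi_denom_pos[OF q] z by auto
  obtain d e where de: "den q v = (d, e)" by (cases "den q v")
  have "d + (e - d) * (q * z / t) = (d * t + (e - d) * (q * z)) / t"
    "d + (e - d) * (1 - q * z / t) = (e * t - (e - d) * (q * z)) / t"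
    using t by (simp_all add: field_simps)
  moreover have "d * t + (e - d) * (q * z) = d + (q * (d + e) - d) * z"
    "e * t - (e - d) * (q * z) = e + (q * (d + e) - e) * z"
    by (simp_all add: t_def algebra_simps)
  ultimately have "d + (e - d) * (q * z / t) = (d + (q * (d + e) - d) * z) / t"
    "d + (e - d) * (1 - q * z / t) = (e + (q * (d + e) - e) * z) / t"
    by simp_all
  then show ?thesis
    using t by (simp add: weight_def de psi_def dpsi_def power_divide flip: t_def)
qed

lemma emeasure_cyl_vimage:
  assumes q: "q > 0" and "B \<in> sets borel"
  shows "emeasure lborel {x \<in> cyl q v. (stilde q ^^ length v) x \<in> B}
       = (\<integral>\<^sup>+z. ennreal (weight q v z) * indicator (B \<inter> {0..1}) z \<partial>lborel)"
  using assms(2)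
proof (induction v arbitrary: B)
  case Nil
  have "{x \<in> cyl q []. (stilde q ^^ length []) x \<in> B} = B \<inter> {0..1}" by auto
  then show ?case using Nil by (simp add: weight_def)
next
  case (Cons s v)
  note [measurable] = Cons.prems
  \<comment> \<open>The head of the word is the last symbol, so peeling it off moves one condition
    and one application of the map into the target set.\<close>
  define B' where "B' = {y. (1/2 < y) = s \<and> stilde q y \<in> B}"
  have [measurable]: "B' \<in> sets borel" unfolding B'_def by measurable
  have "{x \<in> cyl q (s # v). (stilde q ^^ length (s # v)) x \<in> B} = {x \<in> cyl q v. (stilde q ^^ length v) x \<in> B'}"
    by (auto simp: B'_def)
  then have "emeasure lborel {x \<in> cyl q (s # v). (stilde q ^^ length (s # v)) x \<in> B}
    = (\<integral>\<^sup>+z. ennreal (weight q v z) * indicator (B' \<inter> {0..1}) z \<partial>lborel)"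
    using Cons.IH[of B'] by simp
  also have "\<dots> = (\<integral>\<^sup>+z. ennreal (weight q v (if s then 1 - psi q z else psi q z) * dpsi q z) * indicator (B \<inter> {0..1}) z \<partial>lborel)"
  proof (cases s)
    case True
    then have "B' \<inter> {0..1} = {x. x \<in> {1/2<..1} \<and> stilde q x \<in> B}" by (auto simp: B'_def)
    then show ?thesis using nn_integral_stilde_right[OF q, of "weight q v" B] True by simp
  next
    case False
    then have "B' \<inter> {0..1} = {x. x \<in> {0..1/2} \<and> stilde q x \<in> B}" by (auto simp: B'_def)
    then show ?thesis using nn_integral_stilde_left[OF q, of "weight q v" B] False by simp
  qed
  also have "\<dots> = (\<integral>\<^sup>+z. ennreal (weight q (s # v) z) * indicator (B \<inter> {0..1}) z \<partial>lborel)"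
    by (intro nn_integral_cong) (auto simp: weight_Cons[OF q] split: split_indicator)
  finally show ?case .
qed

lemma den_convex_pos:
  assumes "q > 0" "z \<in> {0..1}"
  shows "fst (den q v) + (snd (den q v) - fst (den q v)) * z > 0"
proof -
  have "fst (den q v) + (snd (den q v) - fst (den q v)) * z = (1 - z) * fst (den q v) + z * snd (den q v)"
    by (simp add: algebra_simps)
  moreover have "\<dots> > 0"
    using den_pos[OF assms(1), of v] assms(2)
    by (cases "z = 0") (auto intro!: add_nonneg_pos)
  ultimately show ?thesis by simp
qed

lemma emeasure_cyl:
  assumes q: "q > 0"
  shows "emeasure lborel (cyl q v) = ennreal (q ^ length v / (fst (den q v) * snd (den q v)))"
proof -
  obtain d e where de: "den q v = (d, e)" by (cases "den q v")
  have pos: "d > 0" "e > 0" using den_pos[OF q, of v] de by auto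
  \<comment> \<open>An antiderivative of the weight that vanishes at 0. This form does not divide by
    \<open>e - d\<close>, so it covers \<open>d = e\<close>.\<close>
  let ?F = "\<lambda>z. q ^ length v * z / (d * (d + (e - d) * z))"
  have "emeasure lborel (cyl q v) = (\<integral>\<^sup>+z. ennreal (weight q v z) * indicator {0..1} z \<partial>lborel)"
    using emeasure_cyl_vimage[OF q, of UNIV v] by simp
  also have "\<dots> = ennreal (?F 1 - ?F 0)"
  proof (rule nn_integral_FTC_Icc[where F = ?F and f = "weight q v"])
    fix z :: real assume z: "z \<in> {0..1}"
    have p: "d + (e - d) * z > 0" using den_convex_pos[OF q z, of v] de by auto
    have "((\<lambda>z. q ^ length v * z / (d * (d + (e - d) * z))) has_real_derivative
        (q ^ length v * (d * (d + (e - d) * z)) - q ^ length v * z * (d * (e - d))) / (d * (d + (e - d) * z) * (d * (d + (e - d) * z)))) (at z)"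
      using p pos by (auto intro!: derivative_eq_intros)
    moreover have "(q ^ length v * (d * (d + (e - d) * z)) - q ^ length v * z * (d * (e - d))) / (d * (d + (e - d) * z) * (d * (d + (e - d) * z)))
      = weight q v z"
    proof -
      have "q ^ length v * (d * (d + (e - d) * z)) - q ^ length v * z * (d * (e - d)) = q ^ length v * (d * d)"
        by (simp add: algebra_simps)
      then show ?thesis using p pos by (simp add: weight_def de power2_eq_square)
    qed
    ultimately show "(?F has_real_derivative weight q v z) (at z)" by simp
    show "0 \<le> weight q v z" using q by (simp add: weight_def)
  qed auto
  also have "?F 1 - ?F 0 = q ^ length v / (d * e)" by simp
  finally show ?thesis by (simp add: de)
qed

lemma measure_cyl:
  assumes q: "q > 0"
  shows "measure lborel (cyl q v) = q ^ length v / (fst (den q v) * snd (den q v))"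
  using den_pos[OF q, of v] q by (simp add: measure_def emeasure_cyl)

lemma measure_cyl_Cons:
  assumes q: "q > 0"
  shows "measure lborel (cyl q (s # v)) = measure lborel (cyl q v) *
    (if s then fst (den q v) else snd (den q v)) / (fst (den q v) + snd (den q v))"
  using den_pos[OF q, of v] q by (auto simp: measure_cyl simp del: cyl.simps)

lemma emeasure_unit:
  assumes "S \<subseteq> {0..1::real}" "S \<in> sets borel"
  shows "emeasure lborel S = ennreal (measure lborel S)"
proof -
  have "emeasure lborel S \<le> emeasure lborel {0..1::real}" using assms by (intro emeasure_mono) auto
  then show ?thesis by (intro emeasure_eq_ennreal_measure) (auto simp: top_unique)
qed

lemma fmeasurable_unit: "S \<subseteq> {0..1::real} \<Longrightarrow> S \<in> sets borel \<Longrightarrow> S \<in> fmeasurable lborel"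
  by (intro fmeasurableI) (auto simp: emeasure_unit)

text \<open>The Moebius denominator is at most the larger of its endpoint values d and e, and k
  times the square of that is at most \<open>d * e\<close>. Hence the derivative of the inverse
  branch never drops below k times its mean, the length of the cylinder.\<close>

lemma cyl_distortion:
  assumes q: "q > 0" and [measurable]: "B \<in> sets borel"
    and k: "k * snd (den q v) \<le> fst (den q v)" "k * fst (den q v) \<le> snd (den q v)" "k \<ge> 0"
  shows "k * measure lborel (cyl q v) * measure lborel (B \<inter> {0..1})
    \<le> measure lborel {x \<in> cyl q v. (stilde q ^^ length v) x \<in> B}"
proof -
  obtain d e where de: "den q v = (d, e)" by (cases "den q v")
  have pos: "d > 0" "e > 0" using den_pos[OF q, of v] de by auto
  let ?S = "{x \<in> cyl q v. (stilde q ^^ length v) x \<in> B}"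
  have Ssub: "?S \<subseteq> {0..1}" using cyl_subset by auto
  let ?c = "k * measure lborel (cyl q v)"
  have w: "?c \<le> weight q v z" if z: "z \<in> {0..1}" for z
  proof -
    let ?D = "d + (e - d) * z"
    have p: "?D > 0" using den_convex_pos[OF q z, of v] de by simp
    have "?D = (1 - z) * d + z * e" by (simp add: algebra_simps)
    also have "\<dots> \<le> max d e" using z by (intro convex_bound_le) auto
    finally have D: "?D \<le> max d e" .
    have "k * ?D\<^sup>2 \<le> k * (max d e)\<^sup>2" using D p k by (intro mult_left_mono power_mono) auto
    also have "\<dots> \<le> d * e"
    proof (cases "d \<le> e")
      case True
      then show ?thesis using mult_right_mono[OF k(1), of e] pos by (simp add: de power2_eq_square max_def mult_ac)
    next
      case False
      then show ?thesis using mult_left_mono[OF k(2), of d] pos by (simp add: de power2_eq_square max_def mult_ac)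
    qed
    finally have "k * ?D\<^sup>2 \<le> d * e" .
    then have "k / (d * e) \<le> 1 / ?D\<^sup>2" using p pos by (simp add: field_simps)
    then have "q ^ length v * (k / (d * e)) \<le> q ^ length v * (1 / ?D\<^sup>2)" using q by (intro mult_left_mono) auto
    then show ?thesis by (simp add: measure_cyl[OF q] weight_def de mult_ac)
  qed
  have "ennreal (?c * measure lborel (B \<inter> {0..1})) = ennreal ?c * emeasure lborel (B \<inter> {0..1})"
    using k by (simp add: emeasure_unit ennreal_mult)
  also have "\<dots> = (\<integral>\<^sup>+z. ennreal ?c * indicator (B \<inter> {0..1}) z \<partial>lborel)"
    by (rule nn_integral_cmult_indicator[symmetric]) simp
  also have "\<dots> \<le> (\<integral>\<^sup>+z. ennreal (weight q v z) * indicator (B \<inter> {0..1}) z \<partial>lborel)"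
    using w by (intro nn_integral_mono) (auto split: split_indicator intro!: ennreal_leI)
  also have "\<dots> = emeasure lborel ?S" by (rule emeasure_cyl_vimage[OF q, symmetric]) simp
  also have "\<dots> = ennreal (measure lborel ?S)" by (rule emeasure_unit[OF Ssub]) measurable
  finally show ?thesis by (simp add: ennreal_le_iff)
qed

section \<open>Cylinders as intervals of controlled length\<close>

lemma stilde_mono_left:
  assumes "q > 0" "0 \<le> x" "x \<le> y" "y \<le> 1/2" shows "stilde q x \<le> stilde q y"
proof -
  have "(1 - 2 * q) * x + q > 0" "(1 - 2 * q) * y + q > 0"
    using assms by (auto intro!: stilde_denom_pos)
  moreover have "x * ((1 - 2 * q) * y + q) \<le> y * ((1 - 2 * q) * x + q)"
    using mult_left_mono[of x y q] assms by (simp add: algebra_simps)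
  ultimately show ?thesis using assms by (simp add: stilde_left divide_le_eq pos_le_divide_eq frac_le_eq field_simps)
qed

lemma stilde_antimono_right:
  assumes "q > 0" "1/2 \<le> x" "x \<le> y" "y \<le> 1" shows "stilde q y \<le> stilde q x"
proof -
  have "stilde q (1 - y) \<le> stilde q (1 - x)" using assms by (intro stilde_mono_left) auto
  then show ?thesis using assms by (simp add: stilde_right stilde_left)
qed

text \<open>The two claims need a joint induction: a threshold condition on a monotone iterate cuts
  an interval out of an interval, and on the piece a single branch is applied next, which keeps the
  iterate monotone.\<close>

lemma cyl_interval_monotone:
  assumes q: "q > 0"
  shows "(\<forall>x\<in>cyl q v. \<forall>y\<in>cyl q v. {x..y} \<subseteq> cyl q v) \<and>
    (monotone_on (cyl q v) (\<le>) (\<le>) (stilde q ^^ length v) \<or> monotone_on (cyl q v) (\<le>) (\<ge>) (stilde q ^^ length v))"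
proof (induction v)
  case Nil
  show ?case by (auto simp: monotone_on_def)
next
  case (Cons s v)
  let ?f = "stilde q ^^ length v"
  have rng: "?f x \<in> {0..1}" if "x \<in> cyl q v" for x
    using stilde_pow_range[OF q] cyl_subset that by blast
  have betw: "(?f x \<le> ?f z \<and> ?f z \<le> ?f y) \<or> (?f y \<le> ?f z \<and> ?f z \<le> ?f x)"
    if "x \<in> cyl q v" "y \<in> cyl q v" "x \<le> z" "z \<le> y" for x y z
  proof -
    have "{x..y} \<subseteq> cyl q v" using Cons.IH that by blast
    then have "z \<in> cyl q v" using that by auto
    then show ?thesis using Cons.IH that unfolding monotone_on_def by blast
  qed
  have "{x..y} \<subseteq> cyl q (s # v)" if xy: "x \<in> cyl q (s # v)" "y \<in> cyl q (s # v)" for x y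
  proof
    fix z assume z: "z \<in> {x..y}"
    have "{x..y} \<subseteq> cyl q v" using Cons.IH xy by auto
    then have "z \<in> cyl q v" using z by auto
    then show "z \<in> cyl q (s # v)" using betw[of x y z] xy z by auto
  qed
  moreover have st: "if s then stilde q b \<le> stilde q a else stilde q a \<le> stilde q b"
    if "a \<le> b" "a \<in> {0..1}" "b \<in> {0..1}" "(1/2 < a) = s" "(1/2 < b) = s" for a b
    using stilde_mono_left[OF q, of a b] stilde_antimono_right[OF q, of a b] that by auto
  have "monotone_on (cyl q (s # v)) (\<le>) (\<le>) (stilde q ^^ length (s # v)) \<or>
    monotone_on (cyl q (s # v)) (\<le>) (\<ge>) (stilde q ^^ length (s # v))"
    using Cons.IH[THEN conjunct2]
  proof
    assume "monotone_on (cyl q v) (\<le>) (\<le>) ?f"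
    then show ?thesis using st rng unfolding monotone_on_def by (cases s) fastforce+
  next
    assume "monotone_on (cyl q v) (\<le>) (\<ge>) ?f"
    then show ?thesis using st rng unfolding monotone_on_def by (cases s) fastforce+
  qed
  ultimately show ?case by blast
qed

text \<open>The cylinder contains the segment between any two of its points, so small Lebesgue
  measure means small diameter.\<close>

lemma cyl_diam:
  assumes q: "q > 0" and "x \<in> cyl q v" "y \<in> cyl q v"
  shows "dist x y \<le> measure lborel (cyl q v)"
proof -
  have *: "b - a \<le> measure lborel (cyl q v)" if "a \<in> cyl q v" "b \<in> cyl q v" "a \<le> b" for a b
  proof -
    have "{a..b} \<subseteq> cyl q v" using cyl_interval_monotone[OF q, of v] that by blast
    then have "measure lborel {a..b} \<le> measure lborel (cyl q v)"
      by (intro measure_mono_fmeasurable fmeasurable_unit cyl_subset) auto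
    then show ?thesis using that by simp
  qed
  show ?thesis using *[of x y] *[of y x] assms by (cases "x \<le> y") (auto simp: dist_real_def)
qed

lemma cyl_disjoint:
  "length v = length w \<Longrightarrow> v \<noteq> w \<Longrightarrow> cyl q v \<inter> cyl q w = {}"
proof (induction v arbitrary: w)
  case (Cons s v)
  then obtain t w' where w: "w = t # w'" by (cases w) auto
  show ?case
  proof (cases "v = w'")
    case False
    then show ?thesis using Cons w by fastforce
  qed (use Cons w in auto)
qed simp

lemma cyl_cover: "x \<in> {0..1} \<Longrightarrow> \<exists>v. length v = n \<and> x \<in> cyl q v"
proof (induction n)
  case (Suc n)
  then obtain v where "length v = n" "x \<in> cyl q v" by blast
  then show ?case
    by (intro exI[of _ "(1/2 < (stilde q ^^ length v) x) # v"]) auto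
qed auto

(* A weak form of the Lebesgue density theorem along the cylinders. *)
lemma cyl_density:
  assumes q: "q > 0" and Z [measurable]: "Z \<in> sets borel" and Zsub: "Z \<subseteq> {0..1}" and \<delta>: "\<delta> > 0"
    and dens: "\<And>v. \<delta> * measure lborel (cyl q v) \<le> measure lborel (cyl q v - Z)"
    and mesh: "\<And>\<epsilon>. \<epsilon> > 0 \<Longrightarrow> \<exists>n. \<forall>v. length v = n \<longrightarrow> measure lborel (cyl q v) < \<epsilon>"
  shows "emeasure lborel Z = 0"
proof (rule ccontr)
  assume "emeasure lborel Z \<noteq> 0"
  define m where "m = measure lborel Z"
  have Zf: "Z \<in> fmeasurable lborel" by (rule fmeasurable_unit[OF Zsub Z])
  have m: "m > 0" using \<open>emeasure lborel Z \<noteq> 0\<close> emeasure_unit[OF Zsub Z]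
    by (simp add: m_def zero_less_measure_iff)
  \<comment> \<open>With this approximation error the argument yields
    \<open>\<delta> * m < 2 * \<eta>\<close>, which the factor 1/3 contradicts.\<close>
  define \<eta> where "\<eta> = \<delta> * m / 3"
  have \<eta>: "\<eta> > 0" using \<delta> m by (simp add: \<eta>_def)
  obtain U where U: "open U" "Z \<subseteq> U" "emeasure lborel (U - Z) < \<eta>"
    using outer_regular_lborel[OF Z \<eta>] by blast
  obtain K where K: "closed K" "K \<subseteq> Z" "emeasure lebesgue (Z - K) < \<eta>"
  proof -
    have "Z \<in> sets lebesgue" using Z by simp
    from sets_lebesgue_inner_closed[OF this \<eta>] show ?thesis using that by metis
  qed
  have Kb [measurable]: "K \<in> sets borel" "U \<in> sets borel" using K(1) U(1) by auto
  have "bounded K" using K(2) Zsub bounded_closed_interval[of 0 "1::real"] bounded_subset by blast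
  then have "compact K" using K(1) by (simp add: compact_eq_bounded_closed)
  \<comment> \<open>Cylinders shorter than \<open>\<epsilon>\<close> that meet the compact set
    \<open>K\<close> stay inside \<open>U\<close>. Their union \<open>V\<close> covers
    \<open>K\<close>, yet at least the share \<open>\<delta>\<close> of it lies in the small set
    \<open>U - Z\<close>.\<close>
  then obtain \<epsilon> where \<epsilon>: "\<epsilon> > 0" "(\<Union>x\<in>K. ball x \<epsilon>) \<subseteq> U"
    using compact_subset_open_imp_ball_epsilon_subset[of K U] U K by blast
  obtain n where n: "\<And>v. length v = n \<Longrightarrow> measure lborel (cyl q v) < \<epsilon>" using mesh[OF \<epsilon>(1)] by blast
  define I where "I = {v. length v = n \<and> cyl q v \<inter> K \<noteq> {}}"
  have fin: "finite I"
    by (rule finite_subset[OF _ finite_lists_length_eq[of "UNIV :: bool set" n]]) (auto simp: I_def)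
  define V where "V = (\<Union>v\<in>I. cyl q v)"
  have [measurable]: "V \<in> sets borel" using fin unfolding V_def by measurable
  have Vsub: "V \<subseteq> {0..1}" unfolding V_def using cyl_subset by blast
  have VU: "V \<subseteq> U"
  proof
    fix x assume "x \<in> V"
    then obtain v y where v: "length v = n" "x \<in> cyl q v" "y \<in> cyl q v" "y \<in> K" by (auto simp: V_def I_def)
    then have "x \<in> ball y \<epsilon>" using cyl_diam[OF q v(3,2)] n[OF v(1)] by simp
    then show "x \<in> U" using \<epsilon>(2) v(4) by blast
  qed
  have KV: "K \<subseteq> V"
  proof
    fix x assume x: "x \<in> K"
    then obtain v where "length v = n" "x \<in> cyl q v" using cyl_cover[of x n q] K(2) Zsub by blast
    then show "x \<in> V" using x by (auto simp: V_def I_def)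
  qed
  have disj: "disjoint_family_on (\<lambda>v. cyl q v) I"
    using cyl_disjoint unfolding disjoint_family_on_def I_def by blast
  have cf: "cyl q v \<in> fmeasurable lborel" for v by (intro fmeasurable_unit cyl_subset cyl_measurable)
  have mV: "measure lborel V = (\<Sum>v\<in>I. measure lborel (cyl q v))"
    unfolding V_def by (rule measure_finite_Union[OF fin]) (use disj emeasure_unit[OF cyl_subset] in auto)
  have mVZ: "measure lborel (V - Z) = (\<Sum>v\<in>I. measure lborel (cyl q v - Z))"
  proof -
    have e: "V - Z = (\<Union>v\<in>I. cyl q v - Z)" by (auto simp: V_def)
    have "emeasure lborel (cyl q v - Z) \<noteq> \<infinity>" for v
      by (subst emeasure_unit) (use cyl_subset in auto)
    then show ?thesis unfolding e
      by (intro measure_finite_Union[OF fin]) (use disj in \<open>auto simp: disjoint_family_on_def\<close>)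
  qed
  have "\<delta> * measure lborel V \<le> measure lborel (V - Z)"
    unfolding mV mVZ sum_distrib_left by (intro sum_mono dens)
  also have "\<dots> \<le> measure lborel (U - Z)"
    using VU U(3) by (intro measure_mono_fmeasurable fmeasurableI) (auto simp: less_top order_less_trans)
  also have "measure lborel (U - Z) < \<eta>"
  proof -
    have "emeasure lborel (U - Z) \<noteq> \<infinity>" using U(3) by (auto simp: top_unique)
    then have "emeasure lborel (U - Z) = ennreal (measure lborel (U - Z))"
      by (intro emeasure_eq_ennreal_measure) auto
    then show ?thesis using U(3) \<eta> by (simp add: ennreal_less_iff)
  qed
  finally have 1: "\<delta> * measure lborel V < \<eta>" .
  have "emeasure lborel (Z - K) < \<eta>" using K(3) by (simp add: emeasure_completion)
  then have "measure lborel (Z - K) < \<eta>"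
    by (subst (asm) emeasure_unit) (use Zsub \<eta> in \<open>auto simp: ennreal_less_iff\<close>)
  moreover have "measure lborel (Z - K) = m - measure lborel K"
    unfolding m_def using K(2) Zsub by (intro measure_Diff) (auto simp: emeasure_unit[OF Zsub Z])
  moreover have "measure lborel K \<le> measure lborel V"
    using KV Vsub by (intro measure_mono_fmeasurable fmeasurable_unit) auto
  ultimately have 2: "m - \<eta> < measure lborel V" by linarith
  have "\<delta> * (m - \<eta>) < \<eta>" using mult_strict_left_mono[OF 2 \<delta>] 1 by linarith
  moreover have "\<delta> \<le> 1"
  proof -
    have "\<delta> * measure lborel (cyl q []) \<le> measure lborel (cyl q [] - Z)" by (rule dens)
    also have "\<dots> \<le> measure lborel {0..1::real}"
      by (intro measure_mono_fmeasurable fmeasurable_unit) auto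
    finally show ?thesis by simp
  qed
  then have "\<delta> * \<eta> \<le> \<eta>" using \<eta> \<delta> by simp
  ultimately have "\<delta> * m < 2 * \<eta>" by (simp add: algebra_simps)
  then show False using \<delta> m by (simp add: \<eta>_def)
qed

section \<open>The exact case\<close>

lemma sets_leb01: "A \<in> sets leb01 \<longleftrightarrow> A \<in> sets borel \<and> A \<subseteq> {0..1}"
  unfolding leb01_def by (subst sets_restrict_space_iff) auto

lemma space_leb01 [simp]: "space leb01 = {0..1}"
  by (simp add: leb01_def space_restrict_space)

lemma measurable_leb01: "f \<in> borel_measurable borel \<Longrightarrow> f \<in> borel_measurable leb01"
  unfolding leb01_def by (intro measurable_restrict_space1) simp

lemma emeasure_density_leb01:
  assumes [measurable]: "f \<in> borel_measurable borel" and A: "A \<in> sets borel" "A \<subseteq> {0..1}"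
  shows "emeasure (density leb01 f) A = (\<integral>\<^sup>+x. f x * indicator A x \<partial>lborel)"
proof -
  have "emeasure (density leb01 f) A = (\<integral>\<^sup>+x. f x * indicator A x \<partial>leb01)"
    by (rule emeasure_density) (use measurable_leb01[OF assms(1)] A in \<open>simp_all add: sets_leb01\<close>)
  also have "\<dots> = (\<integral>\<^sup>+x. f x * indicator A x * indicator {0..1} x \<partial>lborel)"
    unfolding leb01_def by (rule nn_integral_restrict_space) simp
  also have "\<dots> = (\<integral>\<^sup>+x. f x * indicator A x \<partial>lborel)"
    using A(2) by (intro nn_integral_cong) (auto split: split_indicator)
  finally show ?thesis .
qed

lemma borel_prob01_iff: "borel_prob01 \<mu> \<longleftrightarrow> prob_space \<mu> \<and> sets \<mu> = sets leb01"
proof -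
  have "sets leb01 = sets (restrict_space borel {0..1})"
    unfolding leb01_def by (intro sets_restrict_space_cong) simp
  then show ?thesis by (simp add: borel_prob01_def)
qed

lemma null_sets_leb01: "N \<in> null_sets leb01 \<longleftrightarrow> N \<in> sets leb01 \<and> emeasure lborel N = 0"
proof -
  have "emeasure leb01 N = emeasure lborel N" if "N \<in> sets leb01"
    unfolding leb01_def by (rule emeasure_restrict_space) (use that in \<open>auto simp: sets_leb01\<close>)
  then show ?thesis by (auto simp: null_sets_def)
qed

lemma absolutely_continuous_leb01_density:
  assumes [measurable]: "f \<in> borel_measurable borel" and pos: "\<And>x. x \<in> {0<..1} \<Longrightarrow> f x > (0::real)"
  shows "absolutely_continuous (density leb01 (\<lambda>x. ennreal (f x))) leb01"
  unfolding absolutely_continuous_def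
proof
  fix N assume N: "N \<in> null_sets (density leb01 (\<lambda>x. ennreal (f x)))"
  then have Ns: "N \<in> sets leb01" by (auto simp: null_sets_def)
  then have [measurable]: "N \<in> sets borel" by (simp add: sets_leb01)
  have "emeasure (density leb01 (\<lambda>x. ennreal (f x))) N = (\<integral>\<^sup>+x. ennreal (f x) * indicator N x \<partial>lborel)"
    by (rule emeasure_density_leb01) (use Ns in \<open>auto simp: sets_leb01\<close>)
  then have "AE x in lborel. ennreal (f x) * indicator N x = 0"
    using N by (subst nn_integral_0_iff_AE[symmetric]) (auto simp: null_sets_def)
  moreover have "AE x in lborel. x \<noteq> (0::real)" by (rule AE_lborel_singleton)
  ultimately have "AE x in lborel. x \<notin> N"
  proof eventually_elim
    case (elim x)
    show ?case
    proof
      assume "x \<in> N"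
      then have "f x > 0" "ennreal (f x) = 0" using Ns elim pos[of x] by (auto simp: sets_leb01)
      then show False by (simp add: ennreal_eq_0_iff)
    qed
  qed
  then have "emeasure lborel N = 0"
    by (subst (asm) AE_iff_measurable[where N = N]) auto
  then show "N \<in> null_sets leb01"
    using Ns by (simp add: null_sets_leb01)
qed

lemma stilde_measurable_leb01:
  assumes "q > 0" shows "stilde q \<in> measurable leb01 leb01"
proof -
  have "stilde q \<in> measurable (restrict_space lborel {0..1}) (restrict_space lborel {0..1})"
    using stilde_range[OF assms] by (intro measurable_restrict_space3) auto
  then show ?thesis by (simp add: leb01_def)
qed

text \<open>The transfer equation is asked for on (0,1] only: \<open>hdens 1\<close> has its pole at
  0, takes the value 0 there by the convention on division, and violates the equation at that
  point.\<close>

lemma preserves_density_leb01: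
  fixes f :: "real \<Rightarrow> real"
  assumes q: "q > 0" and f [measurable]: "f \<in> borel_measurable borel" and fn: "\<And>x. f x \<ge> 0"
    and eq: "\<And>z. z \<in> {0<..1} \<Longrightarrow> (f (psi q z) + f (1 - psi q z)) * dpsi q z = f z"
  shows "preserves (stilde q) (density leb01 (\<lambda>x. ennreal (f x)))"
  unfolding preserves_def
proof (intro conjI ballI)
  let ?M = "density leb01 (\<lambda>x. ennreal (f x))"
  show "stilde q \<in> measurable ?M ?M" using stilde_measurable_leb01[OF q] by simp
  fix A assume "A \<in> sets ?M"
  then have A [measurable]: "A \<in> sets borel" and Asub: "A \<subseteq> {0..1}" by (auto simp: sets_leb01)
  have e: "stilde q -` A \<inter> space ?M = {x. x \<in> {0..1} \<and> stilde q x \<in> A}" by auto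
  have "emeasure ?M (stilde q -` A \<inter> space ?M) = (\<integral>\<^sup>+x. ennreal (f x) * indicator {x. x \<in> {0..1} \<and> stilde q x \<in> A} x \<partial>lborel)"
    unfolding e by (rule emeasure_density_leb01) auto
  also have "\<dots> = (\<integral>\<^sup>+z. ennreal ((f (psi q z) + f (1 - psi q z)) * dpsi q z) * indicator (A \<inter> {0..1}) z \<partial>lborel)"
    by (intro nn_integral_stilde[OF q]) (auto simp: fn)
  also have "\<dots> = (\<integral>\<^sup>+z. ennreal (f z) * indicator A z \<partial>lborel)"
  proof (intro nn_integral_cong_AE)
    have "AE z in lborel. z \<noteq> (0::real)" by (rule AE_lborel_singleton)
    then show "AE z in lborel. ennreal ((f (psi q z) + f (1 - psi q z)) * dpsi q z) * indicator (A \<inter> {0..1}) z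
      = ennreal (f z) * indicator A z"
      by eventually_elim (use eq Asub in \<open>auto split: split_indicator\<close>)
  qed
  also have "\<dots> = emeasure ?M A" by (rule emeasure_density_leb01[symmetric]) (auto simp: Asub)
  finally show "emeasure ?M (stilde q -` A \<inter> space ?M) = emeasure ?M A" .
qed

text \<open>The absolute value only serves to make the density nonnegative outside the unit interval.\<close>

definition hdens :: "real \<Rightarrow> real \<Rightarrow> real" where
  "hdens q x = \<bar>1 / ((1 - q) + (2 * q - 1) * x)\<bar>"

lemma hdens_measurable [measurable]: "hdens q \<in> borel_measurable borel"
  unfolding hdens_def by measurable

text \<open>With \<open>D\<close> the denominator of the density and \<open>s\<close> that of
  \<open>psi\<close> at z, the density has denominators \<open>D / s\<close> and
  \<open>q / s\<close> at the two preimages. The equation comes down to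
  \<open>q + D = s\<close>.\<close>

lemma hdens_transfer:
  assumes q: "0 < q" "q \<le> 1" and z: "z \<in> {0<..1}"
  shows "(hdens q (psi q z) + hdens q (1 - psi q z)) * dpsi q z = hdens q z"
proof -
  define s where "s = 1 + (2 * q - 1) * z"
  define D where "D = (1 - q) + (2 * q - 1) * z"
  have s: "s > 0" unfolding s_def using psi_denom_pos[of q z] q z by auto
  have "D = (1 - q) * (1 - z) + q * z" by (simp add: D_def algebra_simps)
  moreover have "q * z > 0" "(1 - q) * (1 - z) \<ge> 0" using q z by auto
  ultimately have D: "D > 0" by linarith
  have p: "psi q z = q * z / s" by (simp add: psi_def s_def)
  have "(1 - q) + (2 * q - 1) * (q * z / s) = ((1 - q) * s + (2 * q - 1) * (q * z)) / s"
    using s by (simp add: field_simps)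
  also have "(1 - q) * s + (2 * q - 1) * (q * z) = D" by (simp add: s_def D_def algebra_simps)
  finally have 1: "(1 - q) + (2 * q - 1) * psi q z = D / s" by (simp add: p)
  have "(1 - q) + (2 * q - 1) * (1 - q * z / s) = (q * s - (2 * q - 1) * (q * z)) / s"
    using s by (simp add: field_simps)
  also have "q * s - (2 * q - 1) * (q * z) = q" by (simp add: s_def algebra_simps)
  finally have 2: "(1 - q) + (2 * q - 1) * (1 - psi q z) = q / s" by (simp add: p)
  have "hdens q (psi q z) = s / D" "hdens q (1 - psi q z) = s / q" "hdens q z = 1 / D"
    unfolding hdens_def 1 2 using s D q by (simp_all add: D_def)
  moreover have "(s / D + s / q) * (q / s\<^sup>2) = (q + D) / (D * s)"
    using s D q by (simp add: field_simps power2_eq_square)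
  moreover have "q + D = s" by (simp add: s_def D_def)
  ultimately show ?thesis using s D by (simp add: dpsi_def s_def)
qed

text \<open>The denominator is the convex combination of \<open>1 - q\<close> and \<open>q\<close>
  with weights \<open>1 - x\<close> and \<open>x\<close>.\<close>

lemma hdens_bounds:
  assumes q: "0 < q" "q < 1" and x: "x \<in> {0..1}"
  shows "1 \<le> hdens q x" "hdens q x \<le> 1 / min q (1 - q)"
proof -
  let ?D = "(1 - q) + (2 * q - 1) * x"
  have e: "?D = (1 - x) * (1 - q) + x * q" by (simp add: algebra_simps)
  have "?D \<le> max q (1 - q)" unfolding e using x by (intro convex_bound_le) auto
  moreover have "(1 - x) * min q (1 - q) \<le> (1 - x) * (1 - q)" "x * min q (1 - q) \<le> x * q"
    using x by (auto intro!: mult_left_mono)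
  then have "min q (1 - q) \<le> ?D" unfolding e by (simp add: left_diff_distrib)
  ultimately have D: "?D \<le> 1" "min q (1 - q) \<le> ?D" using q by auto
  moreover have "min q (1 - q) > 0" using q by auto
  ultimately show "1 \<le> hdens q x" "hdens q x \<le> 1 / min q (1 - q)"
    unfolding hdens_def by (auto intro!: divide_left_mono mult_pos_pos simp: le_divide_eq)
qed

text \<open>The ratio r = e/d starts at 1 and is sent to q(1+r) or q(1+1/r). Both maps preserve the
  interval between 1 and q/(1-q), the fixed point of the first. The case split decides which end is
  the larger one.\<close>

lemma den_ratio_less_one:
  assumes q: "0 < q" "q < 1"
  obtains k where "0 < k" "\<And>v. k * snd (den q v) \<le> fst (den q v)" "\<And>v. k * fst (den q v) \<le> snd (den q v)"
proof (cases "q \<ge> 1/2")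
  case True
  have inv: "fst (den q v) \<le> snd (den q v) \<and> (1 - q) * snd (den q v) \<le> q * fst (den q v)" for v
  proof (induction v)
    case (Cons s v)
    obtain d e where de: "den q v = (d, e)" by (cases "den q v")
    have pos: "d > 0" "e > 0" using den_pos[OF q(1), of v] de by auto
    have IH: "d \<le> e" "(1 - q) * e \<le> q * d" using Cons de by auto
    have "(1 - q) * d \<le> q * e" using IH pos q True by (intro mult_mono) auto
    then have "d \<le> q * (d + e)" "(1 - q) * (d + e) \<le> e" by (simp_all add: algebra_simps)
    moreover have "e \<le> q * (d + e)" "(1 - q) * (d + e) \<le> d" using IH by (simp_all add: algebra_simps)
    moreover have "(1 - q) * (q * (d + e)) \<le> q * e" "(1 - q) * (q * (d + e)) \<le> q * d"
      using calculation(2,4) q mult_left_mono[of "(1 - q) * (d + e)" _ q] by (auto simp: mult_ac)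
    ultimately show ?case by (simp add: de)
  qed (use True in auto)
  show ?thesis
  proof (rule that[of "(1 - q) / q"])
    fix v
    show "(1 - q) / q * snd (den q v) \<le> fst (den q v)" using inv[of v] q by (simp add: field_simps)
    have "(1 - q) * fst (den q v) \<le> q * snd (den q v)" using inv[of v] q True den_pos[OF q(1), of v] by (intro mult_mono) auto
    then show "(1 - q) / q * fst (den q v) \<le> snd (den q v)" using q by (simp add: field_simps)
  qed (use q in auto)
next
  case False
  have inv: "snd (den q v) \<le> fst (den q v) \<and> q * fst (den q v) \<le> (1 - q) * snd (den q v)" for v
  proof (induction v)
    case (Cons s v)
    obtain d e where de: "den q v = (d, e)" by (cases "den q v")
    have pos: "d > 0" "e > 0" using den_pos[OF q(1), of v] de by auto
    have IH: "e \<le> d" "q * d \<le> (1 - q) * e" using Cons de by auto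
    have "q * e \<le> (1 - q) * d" using IH pos q False by (intro mult_mono) auto
    then have "q * (d + e) \<le> d" "e \<le> (1 - q) * (d + e)" by (simp_all add: algebra_simps)
    moreover have "q * (d + e) \<le> e" "d \<le> (1 - q) * (d + e)" using IH by (simp_all add: algebra_simps)
    moreover have "q * e \<le> (1 - q) * (q * (d + e))" "q * d \<le> (1 - q) * (q * (d + e))"
      using calculation(2,4) q mult_left_mono[of _ "(1 - q) * (d + e)" q] by (auto simp: mult_ac)
    ultimately show ?case by (simp add: de)
  qed (use False in auto)
  show ?thesis
  proof (rule that[of "q / (1 - q)"])
    fix v
    show "q / (1 - q) * fst (den q v) \<le> snd (den q v)" using inv[of v] q by (simp add: field_simps)
    have "q * snd (den q v) \<le> (1 - q) * fst (den q v)" using inv[of v] q False den_pos[OF q(1), of v] by (intro mult_mono) auto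
    then show "q / (1 - q) * snd (den q v) \<le> fst (den q v)" using q by (simp add: field_simps)
  qed (use q in auto)
qed

text \<open>With bounded ratio, no child of a split cylinder takes more than the share
  \<open>1 / (1 + k)\<close>, so lengths decay exponentially.\<close>

lemma mesh_less_one:
  assumes q: "0 < q" "q < 1" and \<epsilon>: "\<epsilon> > 0"
  shows "\<exists>n. \<forall>v. length v = n \<longrightarrow> measure lborel (cyl q v) < \<epsilon>"
proof -
  obtain k where k: "0 < k" "\<And>v. k * snd (den q v) \<le> fst (den q v)" "\<And>v. k * fst (den q v) \<le> snd (den q v)"
    using den_ratio_less_one[OF q] by blast
  have bd: "measure lborel (cyl q v) \<le> (1 / (1 + k)) ^ length v" for v
  proof (induction v)
    case (Cons s v)
    have pos: "fst (den q v) > 0" "snd (den q v) > 0" using den_pos[OF q(1), of v] by auto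
    have "(if s then fst (den q v) else snd (den q v)) / (fst (den q v) + snd (den q v)) \<le> 1 / (1 + k)"
      using k(1) k(2,3)[of v] pos by (auto simp: field_simps)
    then have "measure lborel (cyl q v) * ((if s then fst (den q v) else snd (den q v)) / (fst (den q v) + snd (den q v)))
      \<le> (1 / (1 + k)) ^ length v * (1 / (1 + k))"
      using pos k(1) by (intro mult_mono[OF Cons]) auto
    then show ?case unfolding measure_cyl_Cons[OF q(1)] by (simp add: mult.commute)
  qed simp
  have "(\<lambda>n. (1 / (1 + k)) ^ n) \<longlonglongrightarrow> 0" using k(1) by (intro LIMSEQ_power_zero) simp
  then have "eventually (\<lambda>n. (1 / (1 + k)) ^ n < \<epsilon>) sequentially" using \<epsilon> by (rule order_tendstoD)
  then obtain n where "(1 / (1 + k)) ^ n < \<epsilon>" by (auto simp: eventually_sequentially)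
  then show ?thesis using bd by (intro exI[of _ n]) (auto intro: le_less_trans)
qed

section \<open>Tail sets and exactness\<close>

lemma preserves_funpow:
  assumes "preserves T \<mu>" "B \<in> sets \<mu>"
  shows "(T ^^ k) -` B \<inter> space \<mu> \<in> sets \<mu> \<and> emeasure \<mu> ((T ^^ k) -` B \<inter> space \<mu>) = emeasure \<mu> B"
  using assms(2)
proof (induction k arbitrary: B)
  case 0
  then show ?case using sets.sets_into_space[OF 0] by (auto simp: Int_absorb2)
next
  case (Suc k)
  have "T \<in> measurable \<mu> \<mu>" using assms(1) by (simp add: preserves_def)
  then have e: "(T ^^ Suc k) -` B \<inter> space \<mu> = (T ^^ k) -` (T -` B \<inter> space \<mu>) \<inter> space \<mu>"
    using measurable_space[OF funpow_measurable, of T \<mu>] by auto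
  show ?case unfolding e
    using Suc.IH[OF preserves_vimage(1)[OF assms(1) Suc.prems]] preserves_vimage(2)[OF assms(1) Suc.prems] by simp
qed

lemma exact_imp_ergodic:
  assumes "exact T \<mu>" and T: "T \<in> measurable \<mu> \<mu>" shows "ergodic T \<mu>"
  unfolding ergodic_def
proof (intro ballI impI)
  fix A assume A: "A \<in> sets \<mu>" "T -` A \<inter> space \<mu> = A"
  have "(T ^^ k) -` A \<inter> space \<mu> = A" for k
  proof (induction k)
    case 0
    then show ?case using A by auto
  next
    case (Suc k)
    have e: "(T ^^ Suc k) -` A \<inter> space \<mu> = (T ^^ k) -` (T -` A \<inter> space \<mu>) \<inter> space \<mu>"
      using measurable_space[OF funpow_measurable[OF T]] by auto
    show ?case unfolding e A(2) by (rule Suc)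
  qed
  then have "A \<in> (\<Inter>k. {(T ^^ k) -` B \<inter> space \<mu> | B. B \<in> sets \<mu>})" using A(1) by blast
  then show "emeasure \<mu> A = 0 \<or> emeasure \<mu> A = 1" using assms(1) unfolding exact_def by blast
qed

text \<open>For every n a tail set \<open>A\<close> is the n-th preimage of some \<open>B\<close>,
  and invariance gives \<open>B\<close> the mass of \<open>A\<close>. So the Lebesgue measure of
  \<open>B\<close> has a lower bound independent of n, distortion makes \<open>A\<close> fill a
  fixed share of every cylinder, and \<open>cyl_density\<close> shows the complement to be
  null.\<close>

lemma stilde_exact:
  assumes q: "0 < q" "q < 1"
    and \<mu>: "prob_space \<mu>" "sets \<mu> = sets leb01" "preserves (stilde q) \<mu>" "absolutely_continuous leb01 \<mu>"
    and bd: "\<And>A. A \<in> sets leb01 \<Longrightarrow> emeasure \<mu> A \<le> ennreal H * emeasure lborel A" and H: "H > 0"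
  shows "exact (stilde q) \<mu>"
  unfolding exact_def
proof
  interpret prob_space \<mu> by fact
  have sp: "space \<mu> = {0..1}" using sets_eq_imp_space_eq[OF \<mu>(2)] by simp
  fix A assume tail: "A \<in> (\<Inter>k. {(stilde q ^^ k) -` B \<inter> space \<mu> | B. B \<in> sets \<mu>})"
  have ex: "\<exists>B\<in>sets \<mu>. A = (stilde q ^^ k) -` B \<inter> {0..1}" for k
  proof -
    have "A \<in> {(stilde q ^^ k) -` B \<inter> space \<mu> | B. B \<in> sets \<mu>}" using tail by blast
    then show ?thesis unfolding sp by blast
  qed
  from ex[of 0] have Asets: "A \<in> sets \<mu>" by (auto simp: sets_leb01 \<mu>(2))
  then have A [measurable]: "A \<in> sets borel" and Asub: "A \<subseteq> {0..1}" by (auto simp: sets_leb01 \<mu>(2))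
  obtain k where k: "0 < k" "\<And>v. k * snd (den q v) \<le> fst (den q v)" "\<And>v. k * fst (den q v) \<le> snd (den q v)"
    using den_ratio_less_one[OF q] by blast
  show "emeasure \<mu> A = 0 \<or> emeasure \<mu> A = 1"
  proof (cases "emeasure \<mu> A = 0")
    case False
    define m where "m = measure \<mu> A"
    have m: "m > 0" using False by (simp add: m_def emeasure_eq_measure zero_less_measure_iff)
    have "emeasure lborel ({0..1} - A) = 0"
    \<comment> \<open>\<open>m / H\<close> bounds the Lebesgue measure of each \<open>B\<close> from
      below; \<open>k\<close> is the distortion constant.\<close>
    proof (rule cyl_density[OF q(1), of _ "k * (m / H)"])
      fix v :: "bool list"
      obtain B where B: "B \<in> sets \<mu>" "A = (stilde q ^^ length v) -` B \<inter> {0..1}" using ex by blast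
      have Bb [measurable]: "B \<in> sets borel" and Bsub: "B \<subseteq> {0..1}" using B(1) by (auto simp: sets_leb01 \<mu>(2))
      have "emeasure \<mu> B = emeasure \<mu> A"
        using preserves_funpow[OF \<mu>(3) B(1), of "length v"] B(2) sp by simp
      then have "ennreal m \<le> ennreal H * emeasure lborel B"
        using bd[of B] B(1) \<mu>(2) by (simp add: m_def emeasure_eq_measure)
      also have "\<dots> = ennreal (H * measure lborel B)"
        using H by (simp add: emeasure_unit[OF Bsub] ennreal_mult)
      finally have "m / H \<le> measure lborel B" using H by (simp add: ennreal_le_iff field_simps)
      then have "k * measure lborel (cyl q v) * (m / H) \<le> k * measure lborel (cyl q v) * measure lborel (B \<inter> {0..1})"
        using k(1) Bsub by (intro mult_left_mono) (auto simp: Int_absorb2)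
      also have "\<dots> \<le> measure lborel {x \<in> cyl q v. (stilde q ^^ length v) x \<in> B}"
        using k by (intro cyl_distortion[OF q(1)]) auto
      also have "{x \<in> cyl q v. (stilde q ^^ length v) x \<in> B} = cyl q v - ({0..1} - A)"
        using cyl_subset[of q v] B(2) by auto
      finally show "k * (m / H) * measure lborel (cyl q v) \<le> measure lborel (cyl q v - ({0..1} - A))"
        by (simp add: mult_ac)
    qed (use k m H mesh_less_one[OF q] in auto)
    then have "{0..1} - A \<in> null_sets leb01"
      by (auto simp: null_sets_leb01 sets_leb01)
    then have "emeasure \<mu> (space \<mu> - A) = 0" using \<mu>(4) sp by (auto simp: absolutely_continuous_def)
    then have "prob (space \<mu> - A) = 0" by (simp add: measure_def)
    then show ?thesis using prob_compl[OF Asets] by (simp add: emeasure_eq_measure)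
  qed simp
qed

lemma stilde_exact_unique:
  assumes q: "0 < q" "q < 1"
  shows "\<exists>\<mu>. borel_prob01 \<mu> \<and> preserves (stilde q) \<mu> \<and> absolutely_continuous leb01 \<mu> \<and>
             exact (stilde q) \<mu> \<and>
             (\<forall>\<nu>. borel_prob01 \<nu> \<and> preserves (stilde q) \<nu> \<and> absolutely_continuous leb01 \<nu>
                    \<longrightarrow> \<nu> = \<mu>)"
proof -
  define b where "b = 1 / min q (1 - q)"
  have b: "b > 0" using q by (auto simp: b_def)
  define I where "I = (\<integral>\<^sup>+x. ennreal (hdens q x) * indicator {0..1} x \<partial>lborel)"
  have "(\<integral>\<^sup>+x. ennreal 1 * indicator {0..1::real} x \<partial>lborel) \<le> I"
    unfolding I_def using hdens_bounds(1)[OF q] by (intro nn_integral_mono) (auto split: split_indicator)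
  then have I1: "1 \<le> I" by simp
  have "I \<le> (\<integral>\<^sup>+x. ennreal b * indicator {0..1::real} x \<partial>lborel)"
    unfolding I_def using hdens_bounds(2)[OF q]
    by (intro nn_integral_mono) (auto split: split_indicator simp: b_def intro!: ennreal_leI)
  also have "\<dots> = ennreal b * emeasure lborel {0..1::real}" by (rule nn_integral_cmult_indicator) simp
  finally have "I \<le> ennreal b" by simp
  then obtain C where C: "I = ennreal C" "C \<ge> 0" by (cases I) (auto simp: top_unique)
  then have C1: "C \<ge> 1" using I1 by (simp add: ennreal_1[symmetric] del: ennreal_1)
  define f where "f x = hdens q x / C" for x
  have [measurable]: "f \<in> borel_measurable borel" unfolding f_def by measurable
  have f0: "f x \<ge> 0" for x using C1 by (simp add: f_def hdens_def)
  have fpos: "f x > 0" if "x \<in> {0..1}" for x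
    using hdens_bounds(1)[OF q that] C1 by (simp add: f_def)
  define \<mu> where "\<mu> = density leb01 (\<lambda>x. ennreal (f x))"
  have s: "sets \<mu> = sets leb01" by (simp add: \<mu>_def)
  have sp: "space \<mu> = {0..1}" by (simp add: \<mu>_def)
  have em: "emeasure \<mu> A = (\<integral>\<^sup>+x. ennreal (f x) * indicator A x \<partial>lborel)" if "A \<in> sets leb01" for A
    unfolding \<mu>_def by (rule emeasure_density_leb01) (use that in \<open>auto simp: sets_leb01\<close>)
  have p: "prob_space \<mu>"
  proof
    have "emeasure \<mu> (space \<mu>) = (\<integral>\<^sup>+x. ennreal (1 / C) * (ennreal (hdens q x) * indicator {0..1} x) \<partial>lborel)"
    proof -
      have "ennreal (f x) = ennreal (1 / C) * ennreal (hdens q x)" for x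
        using C1 by (simp add: f_def hdens_def flip: ennreal_mult)
      then show ?thesis unfolding sp by (subst em) (auto simp: sets_leb01 mult.assoc)
    qed
    also have "\<dots> = ennreal (1 / C) * I" unfolding I_def by (rule nn_integral_cmult) simp
    also have "\<dots> = 1" using C1 by (simp add: C(1) flip: ennreal_mult)
    finally show "emeasure \<mu> (space \<mu>) = 1" .
  qed
  have pr: "preserves (stilde q) \<mu>" unfolding \<mu>_def
  proof (rule preserves_density_leb01[OF q(1) _ f0])
    fix z :: real assume z: "z \<in> {0<..1}"
    have "(f (psi q z) + f (1 - psi q z)) * dpsi q z = (hdens q (psi q z) + hdens q (1 - psi q z)) * dpsi q z / C"
      by (simp add: f_def add_divide_distrib distrib_right)
    then show "(f (psi q z) + f (1 - psi q z)) * dpsi q z = f z"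
      using hdens_transfer[OF q(1) less_imp_le[OF q(2)] z] by (simp add: f_def)
  qed simp
  have ac: "absolutely_continuous leb01 \<mu>" unfolding \<mu>_def by (intro absolutely_continuousI_density measurable_leb01) simp
  have bdd: "emeasure \<mu> A \<le> ennreal b * emeasure lborel A" if "A \<in> sets leb01" for A
  proof -
    have "f x \<le> b" if "x \<in> {0..1}" for x
    proof -
      have "f x \<le> hdens q x / 1" unfolding f_def using C1 by (intro divide_left_mono) (auto simp: hdens_def)
      then show ?thesis using hdens_bounds(2)[OF q that] by (simp add: b_def)
    qed
    then have "emeasure \<mu> A \<le> (\<integral>\<^sup>+x. ennreal b * indicator A x \<partial>lborel)"
      unfolding em[OF that] using that
      by (intro nn_integral_mono) (auto split: split_indicator simp: sets_leb01 intro!: ennreal_leI)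
    also have "\<dots> = ennreal b * emeasure lborel A"
      by (rule nn_integral_cmult_indicator) (use that in \<open>simp add: sets_leb01\<close>)
    finally show ?thesis .
  qed
  have ex: "exact (stilde q) \<mu>" by (rule stilde_exact[OF q p s pr ac bdd b])
  have erg: "ergodic (stilde q) \<mu>"
    using pr by (intro exact_imp_ergodic[OF ex]) (simp add: preserves_def)
  \<comment> \<open>Through this, a competitor absolutely continuous with respect to Lebesgue
    measure is also absolutely continuous with respect to \<open>\<mu>\<close>, as
    \<open>ergodic_unique\<close> requires.\<close>
  have ac': "absolutely_continuous \<mu> leb01"
    unfolding \<mu>_def using fpos by (intro absolutely_continuous_leb01_density) auto
  have "\<nu> = \<mu>" if "borel_prob01 \<nu>" "preserves (stilde q) \<nu>" "absolutely_continuous leb01 \<nu>" for \<nu>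
    using that ac' by (intro ergodic_unique[OF p pr erg])
      (auto simp: borel_prob01_iff s absolutely_continuous_def)
  moreover have "borel_prob01 \<mu>" using p s by (simp add: borel_prob01_iff)
  ultimately show ?thesis using pr ac ex by blast
qed

section \<open>The Farey map\<close>

lemma hdens_one: "x \<in> {0..1} \<Longrightarrow> hdens 1 x = 1 / x"
  by (simp add: hdens_def)

lemma nn_integral_inverse_infinite: "(\<integral>\<^sup>+x. ennreal (1 / x) * indicator {0..1} x \<partial>lborel) = \<infinity>"
proof (rule ccontr)
  assume fin: "(\<integral>\<^sup>+x. ennreal (1 / x) * indicator {0..1} x \<partial>lborel) \<noteq> \<infinity>"
  then obtain C where C: "(\<integral>\<^sup>+x. ennreal (1 / x) * indicator {0..1} x \<partial>lborel) = ennreal C" "C \<ge> 0"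
    by (cases "\<integral>\<^sup>+x. ennreal (1 / x) * indicator {0..1} x \<partial>lborel") auto
  \<comment> \<open>The integral over \<open>{a..1}\<close> is then \<open>C + 1\<close>.\<close>
  define a where "a = exp (- (C + 1))"
  have a: "0 < a" "a \<le> 1" using C by (auto simp: a_def)
  have "ennreal (ln 1 - ln a) = (\<integral>\<^sup>+x. ennreal (1 / x) * indicator {a..1} x \<partial>lborel)"
    using a by (intro nn_integral_FTC_Icc[symmetric]) (auto intro!: derivative_eq_intros)
  also have "\<dots> \<le> (\<integral>\<^sup>+x. ennreal (1 / x) * indicator {0..1} x \<partial>lborel)"
    using a by (intro nn_integral_mono) (auto split: split_indicator)
  finally have "ennreal (C + 1) \<le> ennreal C" by (simp add: C a_def)
  then show False using C by (simp add: ennreal_le_iff)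
qed

lemma farey_no_invariant_prob:
  assumes \<mu>: "borel_prob01 \<mu>" "absolutely_continuous \<mu> leb01" "preserves (stilde 1) \<mu>" "ergodic (stilde 1) \<mu>"
  shows False
proof -
  define \<nu> where "\<nu> = density leb01 (\<lambda>x. ennreal (hdens 1 x))"
  have s: "sets \<nu> = sets \<mu>" "sets \<nu> = sets leb01"
    using \<mu>(1) by (auto simp: \<nu>_def borel_prob01_iff)
  have p: "prob_space \<mu>" using \<mu>(1) by (simp add: borel_prob01_iff)
  have pr: "preserves (stilde 1) \<nu>" unfolding \<nu>_def
    by (rule preserves_density_leb01) (auto simp: hdens_transfer, simp add: hdens_def)
  have m: "(\<lambda>x. ennreal (hdens 1 x)) \<in> borel_measurable leb01" by (rule measurable_leb01) simp
  interpret L: sigma_finite_measure leb01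
    unfolding leb01_def by (rule sigma_finite_measure_restrict_space[OF sigma_finite_lborel]) simp
  \<comment> \<open>A real-valued density keeps the measure sigma-finite, although its total mass is
    infinite.\<close>
  have sf: "sigma_finite_measure \<nu>" unfolding \<nu>_def
    by (subst L.sigma_finite_iff_density_finite[OF m]) auto
  have "absolutely_continuous leb01 \<nu>" unfolding \<nu>_def by (intro absolutely_continuousI_density m)
  then have "absolutely_continuous \<mu> \<nu>" using \<mu>(2) by (auto simp: absolutely_continuous_def)
  then have "emeasure \<nu> (space \<nu>) < \<infinity>"
    by (rule ergodic_no_infinite_invariant[OF p \<mu>(3,4) sf pr s(1)])
  moreover have "emeasure \<nu> (space \<nu>) = (\<integral>\<^sup>+x. ennreal (1 / x) * indicator {0..1} x \<partial>lborel)"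
    unfolding \<nu>_def by (simp, subst emeasure_density_leb01)
      (auto intro!: nn_integral_cong simp: hdens_one split: split_indicator)
  ultimately show False by (simp add: nn_integral_inverse_infinite)
qed

text \<open>For \<open>q = 1\<close> the recursion forms mediants: \<open>den\<close> holds the
  integer denominators at the ends of a Farey interval. Each step adds at least 1 to their
  sum.\<close>

lemma farey_den:
  "1 \<le> fst (den 1 v) \<and> fst (den 1 v) \<le> snd (den 1 v) \<and> real (length v) + 2 \<le> fst (den 1 v) + snd (den 1 v)"
  by (induction v) auto

lemma farey_mesh:
  assumes "\<epsilon> > 0"
  shows "\<exists>n. \<forall>v. length v = n \<longrightarrow> measure lborel (cyl 1 v) < \<epsilon>"
proof -
  obtain n where n: "n > 0" "1 / real n < \<epsilon>" using assms nat_approx_posE by blast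
  have "measure lborel (cyl 1 v) < \<epsilon>" if "length v = n" for v
  proof -
    obtain d e where de: "den 1 v = (d, e)" by (cases "den 1 v")
    have b: "1 \<le> d" "1 \<le> e" "real n + 2 \<le> d + e" using farey_den[of v] de that by auto
    \<comment> \<open>For entries at least 1 the product is at least the sum minus 1.\<close>
    have "0 \<le> (d - 1) * (e - 1)" using b by simp
    then have "real n \<le> d * e" using b(3) by (simp add: algebra_simps)
    then have "1 / (d * e) \<le> 1 / real n" using n by (intro divide_left_mono) auto
    then show ?thesis using n by (simp add: measure_cyl de)
  qed
  then show ?thesis by blast
qed

(* Words ending in the second branch have bounded distortion; the parabolic first branch
   is handled by splitting a cylinder n times along the fixed point. *)
lemma farey_visits:
  assumes W [measurable]: "W \<in> sets borel" and Wpos: "emeasure lborel (W \<inter> {0..1}) > 0"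
  shows "AE x in lborel. x \<in> {0..1} \<longrightarrow> (\<exists>k. (stilde 1 ^^ k) x \<in> W)"
proof -
  define N where "N = {x \<in> {0..1}. \<forall>k. (stilde 1 ^^ k) x \<notin> W}"
  have [measurable]: "N \<in> sets borel" unfolding N_def by measurable
  have Nsub: "N \<subseteq> {0..1}" by (auto simp: N_def)
  \<comment> \<open>The factor 1/2 is the distortion constant of words whose last symbol is
    \<open>True\<close>: their pair is \<open>(e, d + e)\<close> with
    \<open>d \<le> e\<close>.\<close>
  define \<delta> where "\<delta> = measure lborel ({0..1} - N) / 2"
  have "emeasure lborel (W \<inter> {0..1}) \<le> emeasure lborel ({0..1} - N)"
    by (intro emeasure_mono) (auto simp: N_def dest: spec[of _ 0])
  then have "emeasure lborel ({0..1} - N) > 0" using Wpos by order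
  then have \<delta>: "\<delta> > 0" by (subst (asm) emeasure_unit) (auto simp: \<delta>_def)
  have fwd: "(stilde 1 ^^ n) x \<in> N" if "x \<in> N" for n x
  proof -
    have "(stilde 1 ^^ k) ((stilde 1 ^^ n) x) \<notin> W" for k
      using that by (auto simp: N_def simp flip: funpow_add[unfolded fun_eq_iff o_def, rule_format])
    then show ?thesis using that stilde_pow_range[of 1 x n] by (auto simp: N_def)
  qed
  have one: "\<delta> * measure lborel (cyl 1 (True # v)) \<le> measure lborel (cyl 1 (True # v) - N)" for v
  proof -
    obtain d e where de: "den 1 v = (d, e)" by (cases "den 1 v")
    have b: "1 \<le> d" "d \<le> e" using farey_den[of v] de by auto
    let ?w = "True # v"
    have "1/2 * measure lborel (cyl 1 ?w) * measure lborel (({0..1} - N) \<inter> {0..1})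
      \<le> measure lborel {x \<in> cyl 1 ?w. (stilde 1 ^^ length ?w) x \<in> {0..1} - N}"
      using b by (intro cyl_distortion) (auto simp: de)
    also have "\<dots> \<le> measure lborel (cyl 1 ?w - N)"
    proof (intro measure_mono_fmeasurable fmeasurable_unit)
      show "{x \<in> cyl 1 ?w. (stilde 1 ^^ length ?w) x \<in> {0..1} - N} \<subseteq> cyl 1 ?w - N" using fwd by blast
      show "cyl 1 ?w - N \<subseteq> {0..1}" using cyl_subset[of 1 ?w] by blast
    qed measurable
    also have "({0..1} - N) \<inter> {0..1} = {0..1} - N" by blast
    finally show ?thesis by (simp add: \<delta>_def mult_ac del: cyl.simps)
  qed
  have split: "measure lborel (cyl 1 v - N) = measure lborel (cyl 1 (False # v) - N) + measure lborel (cyl 1 (True # v) - N)" for v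
  proof -
    have "cyl 1 v - N = (cyl 1 (False # v) - N) \<union> (cyl 1 (True # v) - N)" by auto
    moreover have "measure lborel ((cyl 1 (False # v) - N) \<union> (cyl 1 (True # v) - N))
      = measure lborel (cyl 1 (False # v) - N) + measure lborel (cyl 1 (True # v) - N)"
    proof (rule measure_Union)
      have "emeasure lborel (cyl 1 w - N) \<noteq> \<infinity>" for w
        by (subst emeasure_unit) (use cyl_subset[of 1 w] in auto)
      then show "emeasure lborel (cyl 1 (False # v) - N) \<noteq> \<infinity>" "emeasure lborel (cyl 1 (True # v) - N) \<noteq> \<infinity>"
        by blast+
      show "(cyl 1 (False # v) - N) \<inter> (cyl 1 (True # v) - N) = {}" by auto
    qed (simp_all del: cyl.simps add: sets.Diff)
    ultimately show ?thesis by simp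
  qed
  \<comment> \<open>After n symbols \<open>False\<close> the pair (d, e) has become (d, e + n d),
    and the piece not yet cut off has the share e/(e + n d) of the cylinder. The \<open>True\<close>
    pieces cut off on the way make up the share n d/(e + n d), and the complement of
    \<open>N\<close> fills at least the fraction \<open>\<delta>\<close> of each.\<close>
  have bound: "\<delta> * (real n * fst (den 1 v) / (snd (den 1 v) + real n * fst (den 1 v))) * measure lborel (cyl 1 v)
    \<le> measure lborel (cyl 1 v - N)" for n v
  proof (induction n arbitrary: v)
    case (Suc n)
    obtain d e where de: "den 1 v = (d, e)" by (cases "den 1 v")
    have b: "1 \<le> d" "d \<le> e" using farey_den[of v] de by auto
    let ?l = "measure lborel (cyl 1 v)"
    have pos: "e + (real n + 1) * d > 0" "d + e > 0" using b by (auto intro!: add_pos_nonneg)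
    have 0: "measure lborel (cyl 1 (False # v)) = ?l * (e / (d + e))" "measure lborel (cyl 1 (True # v)) = ?l * (d / (d + e))"
      using measure_cyl_Cons[of 1 False v] measure_cyl_Cons[of 1 True v] by (simp_all add: de del: cyl.simps)
    have "\<delta> * (real n * d / (d + e + real n * d)) * (?l * (e / (d + e))) \<le> measure lborel (cyl 1 (False # v) - N)"
      using Suc[of "False # v"] by (simp only: 0) (simp add: de)
    moreover have "\<delta> * (?l * (d / (d + e))) \<le> measure lborel (cyl 1 (True # v) - N)"
      using one[of v] by (simp only: 0)
    moreover have "\<delta> * (real (Suc n) * d / (e + real (Suc n) * d)) * ?l
      = \<delta> * (real n * d / (d + e + real n * d)) * (?l * (e / (d + e))) + \<delta> * (?l * (d / (d + e)))"
    proof -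
      define P where "P = e + (real n + 1) * d"
      have P: "P > 0" "d + e + real n * d = P" "e + real (Suc n) * d = P"
        using pos by (auto simp: P_def algebra_simps)
      have "real n * d / P * (e / (d + e)) + d / (d + e) = (real n * d * e + d * P) / (P * (d + e))"
        using P(1) by (simp add: add_divide_distrib)
      also have "real n * d * e + d * P = real (Suc n) * d * (d + e)" by (simp add: P_def algebra_simps)
      also have "\<dots> / (P * (d + e)) = real (Suc n) * d / P" using P(1) pos by simp
      finally have "real (Suc n) * d / P = real n * d / P * (e / (d + e)) + d / (d + e)" by simp
      then have "\<delta> * (real (Suc n) * d / P) * ?l = \<delta> * (real n * d / P * (e / (d + e)) + d / (d + e)) * ?l"
        by (rule arg_cong)
      then show ?thesis unfolding P(2,3) by (simp add: algebra_simps)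
    qed
    ultimately show ?case unfolding split[of v] by (simp only: de fst_conv snd_conv)
  qed simp
  have "emeasure lborel N = 0"
  proof (rule cyl_density[of 1 N "\<delta> / 2"])
    fix v :: "bool list"
    obtain d e where de: "den 1 v = (d, e)" by (cases "den 1 v")
    have b: "1 \<le> d" "d \<le> e" using farey_den[of v] de by auto
    \<comment> \<open>As \<open>1 \<le> d\<close>, this many splits put at least half of the
      cylinder into \<open>True\<close> pieces.\<close>
    obtain n where n: "e \<le> real n" using real_arch_simple by blast
    have "real n \<le> real n * d" using mult_left_mono[OF b(1), of "real n"] by simp
    then have "e \<le> real n * d" using n by linarith
    moreover have "e + real n * d > 0" using b calculation by linarith
    ultimately have "1/2 \<le> real n * d / (e + real n * d)" by (simp add: field_simps)
    then have "\<delta> * (1/2) * measure lborel (cyl 1 v) \<le> \<delta> * (real n * d / (e + real n * d)) * measure lborel (cyl 1 v)"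
      using \<delta> by (intro mult_right_mono mult_left_mono) auto
    also have "\<dots> \<le> measure lborel (cyl 1 v - N)" using bound[of n v] by (simp add: de)
    finally show "\<delta> / 2 * measure lborel (cyl 1 v) \<le> measure lborel (cyl 1 v - N)" by simp
  qed (use Nsub \<delta> farey_mesh in auto)
  then have "AE x in lborel. x \<notin> N" by (intro AE_not_in) (auto simp: null_sets_def)
  then show ?thesis by eventually_elim (auto simp: N_def)
qed

section \<open>The free algebra as an algebra of functions\<close>

lemma carrier_Free2 [simp]: "carrier Free2 = free2_carrier"
  by (simp add: Free2_def)

lemma Free2_closed:
  "f \<in> free2_carrier \<Longrightarrow> g \<in> free2_carrier \<Longrightarrow> f \<otimes>\<^bsub>Free2\<^esub> g \<in> free2_carrier"
  "f \<in> free2_carrier \<Longrightarrow> g \<in> free2_carrier \<Longrightarrow> f \<leadsto>\<^bsub>Free2\<^esub> g \<in> free2_carrier"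
  "\<one>\<^bsub>Free2\<^esub> \<in> free2_carrier"
  unfolding Free2_def by (simp_all add: free2_carrier.intros(3-5))

lemma Free2_eval [simp]:
  assumes "p \<in> Q"
  shows "(f \<otimes>\<^bsub>Free2\<^esub> g) p = f p * g p" "(f \<leadsto>\<^bsub>Free2\<^esub> g) p = min 1 (g p / f p)" "\<one>\<^bsub>Free2\<^esub> p = 1"
    "x0 p = fst p" "x1 p = snd p"
  using assms by (simp_all add: Free2_def M_alg_def x0_def x1_def)

lemma Free2_pow_eval [simp]: "p \<in> Q \<Longrightarrow> (f [^]\<^bsub>Free2\<^esub> (k::nat)) p = f p ^ k"
  by (induction k) (simp_all add: nat_pow_def mult.commute)

lemma free2_induct [consumes 1, case_names x0 x1 one mult imp]:
  assumes "t \<in> free2_carrier" "P x0" "P x1" "P \<one>\<^bsub>Free2\<^esub>"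
    and "\<And>f g. f \<in> free2_carrier \<Longrightarrow> g \<in> free2_carrier \<Longrightarrow> P f \<Longrightarrow> P g \<Longrightarrow> P (f \<otimes>\<^bsub>Free2\<^esub> g)"
    and "\<And>f g. f \<in> free2_carrier \<Longrightarrow> g \<in> free2_carrier \<Longrightarrow> P f \<Longrightarrow> P g \<Longrightarrow> P (f \<leadsto>\<^bsub>Free2\<^esub> g)"
  shows "P t"
  using assms(1)
proof (induction rule: free2_carrier.induct)
  case 3
  have "\<one>\<^bsub>Free2\<^esub> = (\<lambda>p\<in>Q. \<one>\<^bsub>M_alg\<^esub>)" by (simp add: Free2_def)
  then show ?case using assms(4) by (simp only:)
next
  case (4 f g)
  have "f \<otimes>\<^bsub>Free2\<^esub> g = (\<lambda>p\<in>Q. f p \<otimes>\<^bsub>M_alg\<^esub> g p)" by (simp add: Free2_def)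
  then show ?case using assms(5)[OF 4] by (simp only:)
next
  case (5 f g)
  have "f \<leadsto>\<^bsub>Free2\<^esub> g = (\<lambda>p\<in>Q. f p \<leadsto>\<^bsub>M_alg\<^esub> g p)" by (simp add: Free2_def)
  then show ?case using assms(6)[OF 5] by (simp only:)
qed (use assms in auto)

lemma free2_range: "t \<in> free2_carrier \<Longrightarrow> p \<in> Q \<Longrightarrow> 0 < t p \<and> t p \<le> 1"
proof (induction rule: free2_induct)
  case (mult f g)
  then show ?case by (simp add: mult_le_one)
qed (auto simp: Q_def)

lemma free2_extensional: "t \<in> free2_carrier \<Longrightarrow> t \<in> extensional Q"
  by (induction rule: free2_carrier.induct) (simp_all only: x0_def x1_def restrict_extensional)

lemma free2_neq_oneE:
  assumes "t \<in> free2_carrier" "t \<noteq> \<one>\<^bsub>Free2\<^esub>"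
  obtains p where "p \<in> Q" "t p < 1"
proof -
  have "\<exists>p\<in>Q. t p \<noteq> 1"
  proof (rule ccontr)
    assume "\<not> (\<exists>p\<in>Q. t p \<noteq> 1)"
    then have "t = \<one>\<^bsub>Free2\<^esub>"
      using free2_extensional[OF assms(1)] free2_extensional[OF Free2_closed(3)]
      by (intro extensionalityI[of _ Q]) auto
    then show False using assms by simp
  qed
  then show ?thesis using that free2_range[OF assms(1)] by force
qed

text \<open>In logarithmic coordinates product and implication become addition and truncated
  subtraction, so elements of the free algebra become piecewise linear, positively homogeneous
  functions. The Lipschitz bound and the behaviour on rays are read off from these two
  rules.\<close>

lemma ln_Free2:
  assumes "f \<in> free2_carrier" "g \<in> free2_carrier" "p \<in> Q"
  shows "ln ((f \<otimes>\<^bsub>Free2\<^esub> g) p) = ln (f p) + ln (g p)"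
    "ln ((f \<leadsto>\<^bsub>Free2\<^esub> g) p) = min 0 (ln (g p) - ln (f p))"
proof -
  have pos: "f p > 0" "g p > 0" using free2_range assms by auto
  then show "ln ((f \<otimes>\<^bsub>Free2\<^esub> g) p) = ln (f p) + ln (g p)"
    using assms(3) by (simp add: ln_mult)
  have "ln (min 1 (g p / f p)) = min 0 (ln (g p / f p))" using pos by (auto simp: min_def)
  then show "ln ((f \<leadsto>\<^bsub>Free2\<^esub> g) p) = min 0 (ln (g p) - ln (f p))"
    using pos assms(3) by (simp add: ln_div)
qed

text \<open>Both operations add the Lipschitz constants, since truncation at 0 is
  nonexpansive.\<close>

lemma free2_ln_lipschitz:
  assumes "t \<in> free2_carrier"
  shows "\<exists>C\<ge>0. \<forall>p\<in>Q. \<forall>p'\<in>Q. \<bar>ln (t p) - ln (t p')\<bar> \<le>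
    C * (\<bar>ln (fst p) - ln (fst p')\<bar> + \<bar>ln (snd p) - ln (snd p')\<bar>)"
  using assms
proof (induction rule: free2_induct)
  case x0
  show ?case by (intro exI[of _ 1]) auto
next
  case x1
  show ?case by (intro exI[of _ 1]) auto
next
  case one
  show ?case by (intro exI[of _ 0]) auto
next
  case (mult f g)
  then obtain C D where CD: "C \<ge> 0" "D \<ge> 0"
    "\<And>p p'. p \<in> Q \<Longrightarrow> p' \<in> Q \<Longrightarrow> \<bar>ln (f p) - ln (f p')\<bar> \<le> C * (\<bar>ln (fst p) - ln (fst p')\<bar> + \<bar>ln (snd p) - ln (snd p')\<bar>)"
    "\<And>p p'. p \<in> Q \<Longrightarrow> p' \<in> Q \<Longrightarrow> \<bar>ln (g p) - ln (g p')\<bar> \<le> D * (\<bar>ln (fst p) - ln (fst p')\<bar> + \<bar>ln (snd p) - ln (snd p')\<bar>)"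
    by metis
  show ?case
  proof (intro exI[of _ "C + D"] conjI ballI)
    fix p p' assume p: "p \<in> Q" "p' \<in> Q"
    show "\<bar>ln ((f \<otimes>\<^bsub>Free2\<^esub> g) p) - ln ((f \<otimes>\<^bsub>Free2\<^esub> g) p')\<bar> \<le> (C + D) * (\<bar>ln (fst p) - ln (fst p')\<bar> + \<bar>ln (snd p) - ln (snd p')\<bar>)"
      using CD(3,4)[OF p] unfolding ln_Free2(1)[OF mult(1,2) p(1)] ln_Free2(1)[OF mult(1,2) p(2)] distrib_right
      by linarith
  qed (use CD in auto)
next
  case (imp f g)
  then obtain C D where CD: "C \<ge> 0" "D \<ge> 0"
    "\<And>p p'. p \<in> Q \<Longrightarrow> p' \<in> Q \<Longrightarrow> \<bar>ln (f p) - ln (f p')\<bar> \<le> C * (\<bar>ln (fst p) - ln (fst p')\<bar> + \<bar>ln (snd p) - ln (snd p')\<bar>)"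
    "\<And>p p'. p \<in> Q \<Longrightarrow> p' \<in> Q \<Longrightarrow> \<bar>ln (g p) - ln (g p')\<bar> \<le> D * (\<bar>ln (fst p) - ln (fst p')\<bar> + \<bar>ln (snd p) - ln (snd p')\<bar>)"
    by metis
  show ?case
  proof (intro exI[of _ "C + D"] conjI ballI)
    fix p p' assume p: "p \<in> Q" "p' \<in> Q"
    have "\<bar>min 0 (ln (g p) - ln (f p)) - min 0 (ln (g p') - ln (f p'))\<bar> \<le> \<bar>ln (f p) - ln (f p')\<bar> + \<bar>ln (g p) - ln (g p')\<bar>"
      by linarith
    then show "\<bar>ln ((f \<leadsto>\<^bsub>Free2\<^esub> g) p) - ln ((f \<leadsto>\<^bsub>Free2\<^esub> g) p')\<bar> \<le> (C + D) * (\<bar>ln (fst p) - ln (fst p')\<bar> + \<bar>ln (snd p) - ln (snd p')\<bar>)"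
      using CD(3,4)[OF p] unfolding ln_Free2(2)[OF imp(1,2) p(1)] ln_Free2(2)[OF imp(1,2) p(2)] distrib_right
      by linarith
  qed (use CD in auto)
qed

lemma abs_ln_diff_le:
  assumes "0 < c" "c \<le> x" "c \<le> (y::real)"
  shows "\<bar>ln x - ln y\<bar> \<le> \<bar>x - y\<bar> / c"
proof -
  have *: "ln v - ln u \<le> (v - u) / c" if "c \<le> u" "u \<le> v" for u v
  proof -
    have "ln v - ln u = ln (v / u)" using assms that by (simp add: ln_div)
    also have "\<dots> \<le> v / u - 1" using assms that by (intro ln_le_minus_one) auto
    also have "\<dots> = (v - u) / u" using assms that by (simp add: diff_divide_distrib)
    also have "\<dots> \<le> (v - u) / c" using assms that by (intro divide_left_mono) auto
    finally show ?thesis .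
  qed
  show ?thesis
  proof (cases "x \<le> y")
    case True
    then have "ln x \<le> ln y" using assms by simp
    then show ?thesis using *[of x y] assms True by simp
  next
    case False
    then have "ln y \<le> ln x" using assms by simp
    then show ?thesis using *[of y x] assms False by simp
  qed
qed

lemma abs_diff_le_abs_ln_diff:
  assumes "0 < x" "x \<le> 1" "0 < y" "y \<le> (1::real)"
  shows "\<bar>x - y\<bar> \<le> \<bar>ln x - ln y\<bar>"
proof -
  have *: "v - u \<le> ln v - ln u" if "0 < u" "u \<le> v" "v \<le> 1" for u v :: real
  proof -
    have "ln (u / v) \<le> u / v - 1" using that by (intro ln_le_minus_one) auto
    then have "1 - u / v \<le> ln v - ln u" using that by (simp add: ln_div)
    moreover have "v - u \<le> (v - u) / v" using that by (simp add: le_divide_eq mult_left_le)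
    ultimately show ?thesis using that by (simp add: diff_divide_distrib)
  qed
  show ?thesis using *[of x y] *[of y x] assms by (cases "x \<le> y") auto
qed

text \<open>Only a local bound is available, because \<open>ln\<close> is not Lipschitz near 0. It
  is the form needed to show that automorphisms preserve null sets.\<close>

lemma free2_lipschitz_at:
  assumes t: "t \<in> free2_carrier" and p: "p \<in> Q"
  shows "\<exists>T B. open T \<and> p \<in> T \<and> (\<forall>p'\<in>Q \<inter> T. \<bar>t p' - t p\<bar> \<le> B * norm (p' - p))"
proof -
  obtain C where C: "C \<ge> 0" "\<And>p p'. p \<in> Q \<Longrightarrow> p' \<in> Q \<Longrightarrow> \<bar>ln (t p) - ln (t p')\<bar> \<le>
    C * (\<bar>ln (fst p) - ln (fst p')\<bar> + \<bar>ln (snd p) - ln (snd p')\<bar>)"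
    using free2_ln_lipschitz[OF t] by blast
  \<comment> \<open>Half the smaller coordinate: on the box \<open>?T\<close> around p,
    \<open>ln\<close> has Lipschitz constant \<open>1 / c\<close> in each coordinate.\<close>
  define c where "c = min (fst p) (snd p) / 2"
  have c: "c > 0" "c < fst p" "c < snd p" using p by (auto simp: c_def Q_def min_def)
  let ?T = "{c<..} \<times> {c<..}"
  have "\<bar>t p' - t p\<bar> \<le> (2 * C / c) * norm (p' - p)" if p': "p' \<in> Q \<inter> ?T" for p'
  proof -
    have "\<bar>fst p' - fst p\<bar> \<le> norm (p' - p)" "\<bar>snd p' - snd p\<bar> \<le> norm (p' - p)"
      using norm_fst_le[of "fst p' - fst p" "snd p' - snd p"] norm_snd_le[of "snd p' - snd p" "fst p' - fst p"]
      by (simp_all add: minus_prod_def)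
    then have "\<bar>fst p' - fst p\<bar> / c \<le> norm (p' - p) / c" "\<bar>snd p' - snd p\<bar> / c \<le> norm (p' - p) / c"
      using c by (auto intro: divide_right_mono)
    moreover have "\<bar>ln (fst p') - ln (fst p)\<bar> \<le> \<bar>fst p' - fst p\<bar> / c" "\<bar>ln (snd p') - ln (snd p)\<bar> \<le> \<bar>snd p' - snd p\<bar> / c"
      using c p' by (auto intro!: abs_ln_diff_le simp: mem_Times_iff)
    ultimately have "\<bar>ln (fst p') - ln (fst p)\<bar> + \<bar>ln (snd p') - ln (snd p)\<bar> \<le> 2 * (norm (p' - p) / c)"
      by linarith
    then have "C * (\<bar>ln (fst p') - ln (fst p)\<bar> + \<bar>ln (snd p') - ln (snd p)\<bar>) \<le> C * (2 * (norm (p' - p) / c))"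
      using C(1) by (rule mult_left_mono)
    moreover have "\<bar>t p' - t p\<bar> \<le> \<bar>ln (t p') - ln (t p)\<bar>"
      using free2_range[OF t] p p' by (intro abs_diff_le_abs_ln_diff) auto
    moreover have "\<bar>ln (t p') - ln (t p)\<bar> \<le> C * (\<bar>ln (fst p') - ln (fst p)\<bar> + \<bar>ln (snd p') - ln (snd p)\<bar>)"
      using C(2) p p' by blast
    moreover have "(2 * C / c) * norm (p' - p) = C * (2 * (norm (p' - p) / c))" by simp
    ultimately show ?thesis by linarith
  qed
  moreover have "open ?T" by (intro open_Times) auto
  moreover have "p \<in> ?T" using c by (simp add: mem_Times_iff)
  ultimately show ?thesis by blast
qed

lemma free2_continuous:
  assumes t: "t \<in> free2_carrier" shows "continuous_on Q t"
  unfolding continuous_on_def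
proof
  fix p assume p: "p \<in> Q"
  obtain T B where T: "open T" "p \<in> T" "\<And>p'. p' \<in> Q \<inter> T \<Longrightarrow> \<bar>t p' - t p\<bar> \<le> B * norm (p' - p)"
    using free2_lipschitz_at[OF t p] by blast
  have "((\<lambda>p'. t p' - t p) \<longlongrightarrow> 0) (at p within Q)"
  proof (rule Lim_null_comparison)
    have "eventually (\<lambda>p'. p' \<in> T) (at p within Q)" using T(1,2) by (auto simp: eventually_at_topological)
    moreover have "eventually (\<lambda>p'. p' \<in> Q) (at p within Q)" by (simp add: eventually_at_filter)
    ultimately show "eventually (\<lambda>p'. norm (t p' - t p) \<le> B * norm (p' - p)) (at p within Q)"
      by eventually_elim (use T(3) in auto)
    have "((\<lambda>p'. B * norm (p' - p)) \<longlongrightarrow> B * norm (p - p)) (at p within Q)"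
      by (intro tendsto_intros)
    then show "((\<lambda>p'. B * norm (p' - p)) \<longlongrightarrow> 0) (at p within Q)" by simp
  qed
  then show "(t \<longlongrightarrow> t p) (at p within Q)" by (simp add: LIM_zero_iff)
qed

text \<open>In logarithmic coordinates this is the point \<open>S * (-1 + x, -x)\<close>: x is the
  simplex coordinate on which \<open>stilde\<close> acts and S the radial scale.\<close>

definition ray :: "real \<Rightarrow> real \<Rightarrow> real \<times> real" where
  "ray S x = (exp (- S * (1 - x)), exp (- S * x))"

lemma ray_in_Q: "S > 0 \<Longrightarrow> x \<in> {0..1} \<Longrightarrow> ray S x \<in> Q"
  by (auto simp: ray_def Q_def)

lemma ln_free2_ray:
  assumes "t \<in> free2_carrier" "S > 0" "x \<in> {0..1}"
  shows "ln (t (ray S x)) = S * ln (t (ray 1 x))"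
  using assms(1)
proof (induction rule: free2_induct)
  case (mult f g)
  then show ?case using assms(2,3) by (simp only: ln_Free2 ray_in_Q zero_less_one distrib_left)
next
  case (imp f g)
  have "min 0 (S * a - S * b) = S * min 0 (a - b)" for a b
    using assms(2) by (simp add: min_mult_distrib_left right_diff_distrib)
  then show ?case using imp assms(2,3) by (simp only: ln_Free2 ray_in_Q zero_less_one)
qed (use assms(2,3) in \<open>auto simp: ray_in_Q\<close>, auto simp: ray_def algebra_simps)

lemma free2_ray_eq_one:
  assumes "t \<in> free2_carrier" "S > 0" "x \<in> {0..1}"
  shows "t (ray S x) = 1 \<longleftrightarrow> t (ray 1 x) = 1"
proof -
  have "0 < t (ray S x)" "0 < t (ray 1 x)" using assms free2_range ray_in_Q by auto
  then show ?thesis using ln_free2_ray[OF assms] assms(2) ln_eq_zero_iff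
    by (metis mult_eq_0_iff order_less_irrefl)
qed

lemma rayE:
  assumes "p \<in> Q" "p \<noteq> (1, 1)"
  obtains S x where "S > 0" "x \<in> {0..1}" "p = ray S x"
proof -
  define u v where "u = - ln (fst p)" and "v = - ln (snd p)"
  have uv: "u \<ge> 0" "v \<ge> 0" using assms by (auto simp: u_def v_def Q_def)
  have e: "fst p = exp (- u)" "snd p = exp (- v)" using assms by (auto simp: u_def v_def Q_def)
  have "u + v \<noteq> 0"
  proof
    assume "u + v = 0"
    then have "u = 0" "v = 0" using uv by auto
    then show False using e assms(2) by (cases p) auto
  qed
  then have S: "u + v > 0" using uv by linarith
  show ?thesis
  proof (rule that[of "u + v" "v / (u + v)"])
    have "(u + v) * (1 - v / (u + v)) = u" "(u + v) * (v / (u + v)) = v"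
      using S by (simp_all add: right_diff_distrib)
    then show "p = ray (u + v) (v / (u + v))" using e unfolding ray_def
      by (metis mult_minus_left prod.collapse)
  qed (use S uv in auto)
qed

section \<open>Endomorphisms as maps of the square\<close>

lemma hoop_homD:
  assumes "h \<in> hoop_hom A B"
  shows "x \<in> carrier A \<Longrightarrow> h x \<in> carrier B"
    "x \<in> carrier A \<Longrightarrow> y \<in> carrier A \<Longrightarrow> h (x \<otimes>\<^bsub>A\<^esub> y) = h x \<otimes>\<^bsub>B\<^esub> h y"
    "x \<in> carrier A \<Longrightarrow> y \<in> carrier A \<Longrightarrow> h (x \<leadsto>\<^bsub>A\<^esub> y) = h x \<leadsto>\<^bsub>B\<^esub> h y"
    "h \<one>\<^bsub>A\<^esub> = \<one>\<^bsub>B\<^esub>"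
  using assms by (auto simp: hoop_hom_def hom_def Pi_def)

lemma hoop_homI:
  assumes "\<And>x. x \<in> carrier A \<Longrightarrow> h x \<in> carrier B"
    "\<And>x y. x \<in> carrier A \<Longrightarrow> y \<in> carrier A \<Longrightarrow> h (x \<otimes>\<^bsub>A\<^esub> y) = h x \<otimes>\<^bsub>B\<^esub> h y"
    "\<And>x y. x \<in> carrier A \<Longrightarrow> y \<in> carrier A \<Longrightarrow> h (x \<leadsto>\<^bsub>A\<^esub> y) = h x \<leadsto>\<^bsub>B\<^esub> h y"
    "h \<one>\<^bsub>A\<^esub> = \<one>\<^bsub>B\<^esub>"
  shows "h \<in> hoop_hom A B"
  using assms by (auto simp: hoop_hom_def hom_def Pi_def)

lemma endomorphism_closed:
  "endomorphism s \<Longrightarrow> t \<in> free2_carrier \<Longrightarrow> s t \<in> free2_carrier"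
  "endomorphism s \<Longrightarrow> t \<in> free2_carrier \<Longrightarrow> (s ^^ k) t \<in> free2_carrier"
proof -
  show closed: "endomorphism s \<Longrightarrow> t \<in> free2_carrier \<Longrightarrow> s t \<in> free2_carrier" for t
    using hoop_homD(1)[of s Free2 Free2 t] by (simp add: endomorphism_def)
  show "endomorphism s \<Longrightarrow> t \<in> free2_carrier \<Longrightarrow> (s ^^ k) t \<in> free2_carrier"
    by (induction k) (auto intro: closed)
qed

lemma sbar_in_Q:
  assumes "endomorphism s" "p \<in> Q" shows "sbar s p \<in> Q"
  using free2_range[OF endomorphism_closed(1)[OF assms(1) free2_carrier.intros(1)] assms(2)]
    free2_range[OF endomorphism_closed(1)[OF assms(1) free2_carrier.intros(2)] assms(2)]
  by (auto simp: sbar_def Q_def)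

text \<open>Both sides respect the operations and agree on the generators, so an endomorphism is
  composition with \<open>sbar s\<close>.\<close>

lemma endomorphism_eval:
  assumes s: "endomorphism s" and p: "p \<in> Q" and "t \<in> free2_carrier"
  shows "s t p = t (sbar s p)"
  using assms(3)
proof (induction rule: free2_induct)
  case x0
  then show ?case using sbar_in_Q[OF s p] by (simp add: sbar_def)
next
  case x1
  then show ?case using sbar_in_Q[OF s p] by (simp add: sbar_def)
next
  case one
  then show ?case using hoop_homD(4)[OF s[unfolded endomorphism_def]] sbar_in_Q[OF s p] p by simp
next
  case (mult f g)
  then show ?case using hoop_homD(2)[OF s[unfolded endomorphism_def], of f g] sbar_in_Q[OF s p] p by simp
next
  case (imp f g)
  then show ?case using hoop_homD(3)[OF s[unfolded endomorphism_def], of f g] sbar_in_Q[OF s p] p by simp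
qed

lemma endomorphism_funpow_eval:
  assumes s: "endomorphism s" and t: "t \<in> free2_carrier" and "p \<in> Q"
  shows "(sbar s ^^ k) p \<in> Q" "(s ^^ k) t p = t ((sbar s ^^ k) p)"
proof -
  have "(sbar s ^^ k) p \<in> Q \<and> (s ^^ k) t p = t ((sbar s ^^ k) p)"
    using \<open>p \<in> Q\<close>
  proof (induction k arbitrary: p)
    case (Suc k)
    have "(s ^^ Suc k) t p = (s ^^ k) t (sbar s p)"
      using endomorphism_eval[OF s Suc.prems endomorphism_closed(2)[OF s t, of k]] by simp
    then show ?case using Suc.IH[OF sbar_in_Q[OF s Suc.prems]] by (simp add: funpow_swap1)
  qed simp
  then show "(sbar s ^^ k) p \<in> Q" "(s ^^ k) t p = t ((sbar s ^^ k) p)" by auto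
qed

section \<open>Prime filters\<close>

lemma filter_subset: "is_filter F \<Longrightarrow> F \<subseteq> free2_carrier"
  by (auto simp: is_filter_def)

lemma filter_one: "is_filter F \<Longrightarrow> \<one>\<^bsub>Free2\<^esub> \<in> F"
  by (auto simp: is_filter_def Free2_closed dest: hoop_homD(4))

lemma filter_mp:
  assumes "is_filter F" "t \<in> F" "t \<leadsto>\<^bsub>Free2\<^esub> u \<in> F" "u \<in> free2_carrier"
  shows "u \<in> F"
proof -
  obtain B :: "(real \<times> real \<Rightarrow> real) set hoop" and h where B: "in_variety B" "h \<in> hoop_hom Free2 B"
    and F: "F = {t \<in> free2_carrier. h t = \<one>\<^bsub>B\<^esub>}"
    using assms(1) by (auto simp: is_filter_def)
  \<comment> \<open>The law \<open>1 -> v = v\<close> passes from M to the whole variety; for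
    \<open>h t = 1\<close> it identifies the image of \<open>t -> u\<close> with
    \<open>h u\<close>.\<close>
  have "satisfies_eq M_alg (Imp One (Var 0)) (Var 0)"
    by (auto simp: satisfies_eq_def M_alg_def image_subset_iff min_def intro: antisym)
  then have "satisfies_eq B (Imp One (Var 0)) (Var 0)" using B(1) by (simp add: in_variety_def)
  moreover have "h u \<in> carrier B" using hoop_homD(1)[OF B(2)] assms(4) by simp
  ultimately have "\<one>\<^bsub>B\<^esub> \<leadsto>\<^bsub>B\<^esub> h u = h u"
    unfolding satisfies_eq_def by (auto dest: spec[of _ "\<lambda>_. h u"])
  moreover have "h (t \<leadsto>\<^bsub>Free2\<^esub> u) = h t \<leadsto>\<^bsub>B\<^esub> h u"
    using hoop_homD(3)[OF B(2)] assms(2,4) F by simp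
  ultimately show ?thesis using assms F by simp
qed

lemma Free2_imp_eq_one:
  assumes "t \<in> free2_carrier" "u \<in> free2_carrier" "\<And>p. p \<in> Q \<Longrightarrow> t p \<le> u p"
  shows "t \<leadsto>\<^bsub>Free2\<^esub> u = \<one>\<^bsub>Free2\<^esub>"
proof (rule extensionalityI[of _ Q])
  fix p assume p: "p \<in> Q"
  then show "(t \<leadsto>\<^bsub>Free2\<^esub> u) p = \<one>\<^bsub>Free2\<^esub> p"
    using assms(3)[OF p] free2_range[OF assms(1) p] by (simp add: min_def)
qed (use assms in \<open>auto intro!: free2_extensional Free2_closed\<close>)

lemma filter_mono:
  assumes "is_filter F" "t \<in> F" "u \<in> free2_carrier" "\<And>p. p \<in> Q \<Longrightarrow> t p \<le> u p"
  shows "u \<in> F"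
  using filter_mp[OF assms(1,2) _ assms(3)] filter_one[OF assms(1)] filter_subset[OF assms(1)]
    Free2_imp_eq_one[OF _ assms(3,4)] assms(2) by auto

text \<open>The term that evaluates to the pointwise maximum. It is introduced to describe
  intersections of the sets \<open>O_open t\<close>.\<close>

definition join2 :: "(real \<times> real \<Rightarrow> real) \<Rightarrow> (real \<times> real \<Rightarrow> real) \<Rightarrow> real \<times> real \<Rightarrow> real" where
  "join2 t u = (t \<leadsto>\<^bsub>Free2\<^esub> u) \<leadsto>\<^bsub>Free2\<^esub> u"

lemma join2_closed: "t \<in> free2_carrier \<Longrightarrow> u \<in> free2_carrier \<Longrightarrow> join2 t u \<in> free2_carrier"
  by (simp add: join2_def Free2_closed)

lemma join2_eval:
  assumes "t \<in> free2_carrier" "u \<in> free2_carrier" "p \<in> Q"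
  shows "join2 t u p = max (t p) (u p)"
  using free2_range[OF assms(1,3)] free2_range[OF assms(2,3)] assms(3)
  by (auto simp: join2_def min_def max_def field_simps)

text \<open>The join equals both \<open>(t -> u) -> u\<close> and \<open>(u -> t) -> t\<close>.
  Primeness puts one of the inner implications into \<open>F\<close>, and modus ponens
  finishes.\<close>

lemma prime_filter_join:
  assumes F: "prime_filter F" and t: "t \<in> free2_carrier" and u: "u \<in> free2_carrier" and j: "join2 t u \<in> F"
  shows "t \<in> F \<or> u \<in> F"
proof -
  have f: "is_filter F" using F by (simp add: prime_filter_def)
  have "join2 t u = join2 u t"
    by (rule extensionalityI[of _ Q]) (auto simp: join2_eval t u max.commute intro!: free2_extensional join2_closed)
  then have "(u \<leadsto>\<^bsub>Free2\<^esub> t) \<leadsto>\<^bsub>Free2\<^esub> t \<in> F" "(t \<leadsto>\<^bsub>Free2\<^esub> u) \<leadsto>\<^bsub>Free2\<^esub> u \<in> F"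
    using j by (auto simp: join2_def)
  moreover have "t \<leadsto>\<^bsub>Free2\<^esub> u \<in> F \<or> u \<leadsto>\<^bsub>Free2\<^esub> t \<in> F" using F t u by (auto simp: prime_filter_def)
  ultimately show ?thesis using filter_mp[OF f] t u by blast
qed

text \<open>Properness is not claimed, as the preimage of a proper filter can be the whole algebra.
  \<open>dense_orbit_X_topI\<close> recovers it from an element that lies outside the
  iterate.\<close>

lemma prime_filter_dual_map:
  assumes s: "endomorphism s" and F: "prime_filter F"
  shows "prime_filter (dual_map s F)"
proof -
  note h = hoop_homD[OF s[unfolded endomorphism_def]]
  have "is_filter F" using F by (simp add: prime_filter_def)
  then obtain B :: "(real \<times> real \<Rightarrow> real) set hoop" and g where B: "in_variety B" "g \<in> hoop_hom Free2 B"
    and Fg: "F = {t \<in> carrier Free2. g t = \<one>\<^bsub>B\<^esub>}"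
    by (auto simp: is_filter_def)
  have "g \<circ> s \<in> hoop_hom Free2 B"
    by (rule hoop_homI) (simp_all add: h[simplified] hoop_homD[OF B(2), simplified])
  moreover have "dual_map s F = {t \<in> carrier Free2. (g \<circ> s) t = \<one>\<^bsub>B\<^esub>}"
    using h(1) by (auto simp: dual_map_def Fg)
  ultimately have "is_filter (dual_map s F)" unfolding is_filter_def using B(1) by blast
  then show ?thesis
    using F h(1,3) unfolding prime_filter_def by (auto simp: dual_map_def Free2_closed)
qed

lemma dual_map_funpow:
  assumes s: "endomorphism s" and "F \<subseteq> free2_carrier"
  shows "(dual_map s ^^ k) F = {t \<in> free2_carrier. (s ^^ k) t \<in> F}"
proof (induction k)
  case (Suc k)
  have "(dual_map s ^^ Suc k) F = dual_map s {t \<in> free2_carrier. (s ^^ k) t \<in> F}" by (simp add: Suc)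
  also have "\<dots> = {t \<in> free2_carrier. (s ^^ Suc k) t \<in> F}"
    using endomorphism_closed(1)[OF s] by (auto simp: dual_map_def funpow_swap1)
  finally show ?case .
qed (use assms(2) in auto)

text \<open>\<^const>\<open>is_filter\<close> only admits codomains whose elements are sets of functions, so the
  algebra \<^const>\<open>M_alg\<close> is copied to singletons of constant functions.\<close>

definition real_code :: "real \<Rightarrow> (real \<times> real \<Rightarrow> real) set" where
  "real_code r = {\<lambda>_. r}"

definition real_decode :: "(real \<times> real \<Rightarrow> real) set \<Rightarrow> real" where
  "real_decode A = the_elem A (1, 1)"

lemma real_decode_code [simp]: "real_decode (real_code r) = r"
  by (simp add: real_code_def real_decode_def)

definition M_copy :: "(real \<times> real \<Rightarrow> real) set hoop" where
  "M_copy = \<lparr>carrier = real_code ` {0<..1},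
     monoid.mult = (\<lambda>A B. real_code (real_decode A * real_decode B)), one = real_code 1,
     imp = (\<lambda>A B. real_code (min 1 (real_decode B / real_decode A)))\<rparr>"

lemma hval_M_copy:
  assumes "\<And>n. e n = real_code (e' n)"
  shows "hval M_copy e s = real_code (hval M_alg e' s)"
  by (induction s) (simp_all add: assms M_copy_def M_alg_def)

lemma in_variety_M_copy: "in_variety M_copy"
  unfolding in_variety_def
proof (intro conjI allI impI)
  show "closed_alg M_copy"
    by (auto simp: closed_alg_def M_copy_def mult_le_one intro!: imageI)
  fix s t assume st: "satisfies_eq M_alg s t"
  show "satisfies_eq M_copy s t"
    unfolding satisfies_eq_def
  proof (intro allI impI)
    fix e :: "nat \<Rightarrow> _" assume e: "range e \<subseteq> carrier M_copy"
    define e' where "e' n = real_decode (e n)" for n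
    have ee: "e n = real_code (e' n) \<and> e' n \<in> {0<..1}" for n
    proof -
      have "e n \<in> real_code ` {0<..1}" using e by (auto simp: M_copy_def)
      then obtain r where r: "e n = real_code r" "r \<in> {0<..1}" by blast
      then have "e' n = r" by (simp add: e'_def)
      then show ?thesis using r by simp
    qed
    then have "range e' \<subseteq> carrier M_alg" by (auto simp: M_alg_def)
    then have "hval M_alg e' s = hval M_alg e' t" using st by (simp add: satisfies_eq_def)
    then show "hval M_copy e s = hval M_copy e t" using ee hval_M_copy[of e e'] by simp
  qed
qed

lemma point_filter_X_set:
  assumes p: "p \<in> Q" "p \<noteq> (1, 1)"
  shows "point_filter p \<in> X_set"
proof -
  have "(\<lambda>t. real_code (t p)) \<in> hoop_hom Free2 M_copy"
    by (rule hoop_homI) (use p(1) free2_range[OF _ p(1)] in \<open>auto simp: M_copy_def intro!: imageI\<close>)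
  moreover have "point_filter p = {t \<in> carrier Free2. real_code (t p) = \<one>\<^bsub>M_copy\<^esub>}"
    by (auto simp: point_filter_def M_copy_def dest: arg_cong[of _ _ real_decode])
  ultimately have "is_filter (point_filter p)"
    unfolding is_filter_def using in_variety_M_copy by blast
  moreover have "t \<leadsto>\<^bsub>Free2\<^esub> u \<in> point_filter p \<or> u \<leadsto>\<^bsub>Free2\<^esub> t \<in> point_filter p"
    if "t \<in> free2_carrier" "u \<in> free2_carrier" for t u
    using that free2_range[OF that(1) p(1)] free2_range[OF that(2) p(1)] p(1)
    by (auto simp: point_filter_def Free2_closed min_def)
  moreover have "point_filter p \<noteq> carrier Free2"
  proof
    assume "point_filter p = carrier Free2"
    then have "x0 \<in> point_filter p" "x1 \<in> point_filter p" by (auto intro: free2_carrier.intros)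
    then show False using p by (cases p) (auto simp: point_filter_def)
  qed
  ultimately show ?thesis by (simp add: X_set_def prime_filter_def)
qed

text \<open>Serves twice: open sets of filters pull back to countable unions of Borel sets, and
  almost-everywhere statements about single elements can be combined.\<close>

lemma countable_free2: "countable free2_carrier"
proof -
  define G where "G C = C \<union> (\<lambda>(f, g). f \<otimes>\<^bsub>Free2\<^esub> g) ` (C \<times> C) \<union> (\<lambda>(f, g). f \<leadsto>\<^bsub>Free2\<^esub> g) ` (C \<times> C)" for C
  define L where "L n = (G ^^ n) {x0, x1, \<one>\<^bsub>Free2\<^esub>}" for n
  have LS: "L (Suc n) = G (L n)" for n by (simp add: L_def)
  have L0: "x0 \<in> L 0" "x1 \<in> L 0" "\<one>\<^bsub>Free2\<^esub> \<in> L 0" by (auto simp: L_def)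
  have "countable (L n)" for n
    by (induction n) (auto simp: LS G_def, simp add: L_def)
  moreover have "free2_carrier \<subseteq> (\<Union>n. L n)"
  proof
    have "L m \<subseteq> L (m + k)" for m k
    proof (induction k)
      case (Suc k)
      then show ?case using LS[of "m + k"] by (auto simp: G_def)
    qed simp
    then have mono: "L m \<subseteq> L n" if "m \<le> n" for m n using that by (metis le_add_diff_inverse)
    have step: "f \<otimes>\<^bsub>Free2\<^esub> g \<in> (\<Union>n. L n) \<and> f \<leadsto>\<^bsub>Free2\<^esub> g \<in> (\<Union>n. L n)"
      if "f \<in> (\<Union>n. L n)" "g \<in> (\<Union>n. L n)" for f g
    proof -
      from that obtain m n where "f \<in> L m" "g \<in> L n" by blast
      then have "f \<in> L (max m n)" "g \<in> L (max m n)" using mono[of m "max m n"] mono[of n "max m n"] by auto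
      then have "f \<otimes>\<^bsub>Free2\<^esub> g \<in> L (Suc (max m n))" "f \<leadsto>\<^bsub>Free2\<^esub> g \<in> L (Suc (max m n))"
        unfolding LS G_def by force+
      then show ?thesis by blast
    qed
    fix t assume "t \<in> free2_carrier"
    then show "t \<in> (\<Union>n. L n)"
      by (induction rule: free2_induct) (use L0 step in blast)+
  qed
  ultimately show ?thesis by (meson countable_UN countable_subset countableI_type)
qed

section \<open>The spectrum as a topological and Borel space\<close>

lemma topspace_X_top: "topspace X_top = X_set"
proof -
  have "F \<in> (\<Union>t\<in>free2_carrier. O_open t)" if F: "F \<in> X_set" for F
  proof -
    have "F \<subseteq> free2_carrier" "F \<noteq> free2_carrier"
      using F filter_subset by (auto simp: X_set_def prime_filter_def)
    then obtain t where "t \<in> free2_carrier" "t \<notin> F" by blast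
    then show ?thesis using F by (auto simp: O_open_def)
  qed
  moreover have "topspace X_top = (\<Union>t\<in>free2_carrier. O_open t)" unfolding X_top_def by auto
  moreover have "O_open t \<subseteq> X_set" for t by (auto simp: O_open_def)
  ultimately show ?thesis by blast
qed

text \<open>By primeness and monotonicity of filters,
  \<open>O_open t \<inter> O_open u = O_open (join2 t u)\<close>, so the generating family is
  already a base.\<close>

lemma X_top_base:
  assumes "openin X_top U" "F \<in> U"
  shows "\<exists>t\<in>free2_carrier. F \<in> O_open t \<and> O_open t \<subseteq> U"
proof -
  have "generate_topology_on {O_open t |t. t \<in> free2_carrier} U"
    using assms(1) by (simp add: X_top_def openin_topology_generated_by_iff)
  then show ?thesis using assms(2)
  proof (induction arbitrary: F rule: generate_topology_on.induct)
    case (Int a b)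
    from Int.IH(1)[of F] Int.prems obtain t where t: "t \<in> free2_carrier" "F \<in> O_open t" "O_open t \<subseteq> a" by auto
    from Int.IH(2)[of F] Int.prems obtain u where u: "u \<in> free2_carrier" "F \<in> O_open u" "O_open u \<subseteq> b" by auto
    note tu = t u
    have "prime_filter F" using tu by (auto simp: O_open_def X_set_def)
    then have "F \<in> O_open (join2 t u)" using tu prime_filter_join[OF _ t(1) u(1), of F] by (auto simp: O_open_def)
    moreover have "O_open (join2 t u) \<subseteq> O_open t \<inter> O_open u"
    proof
      fix G assume G: "G \<in> O_open (join2 t u)"
      then have g: "is_filter G" by (auto simp: O_open_def X_set_def prime_filter_def)
      have "t \<notin> G" using filter_mono[OF g, of t "join2 t u"] join2_closed[OF t(1) u(1)] G
        by (auto simp: O_open_def join2_eval[OF t(1) u(1)])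
      moreover have "u \<notin> G" using filter_mono[OF g, of u "join2 t u"] join2_closed[OF t(1) u(1)] G
        by (auto simp: O_open_def join2_eval[OF t(1) u(1)])
      ultimately show "G \<in> O_open t \<inter> O_open u" using G by (auto simp: O_open_def)
    qed
    ultimately show ?case using tu join2_closed by blast
  next
    case (UN K)
    from UN.prems obtain k where k: "k \<in> K" "F \<in> k" by blast
    from UN.IH[OF this] obtain t where "t \<in> free2_carrier" "F \<in> O_open t" "O_open t \<subseteq> k" by blast
    then show ?case using k by blast
  qed auto
qed

lemma openin_O_open: "t \<in> free2_carrier \<Longrightarrow> openin X_top (O_open t)"
  unfolding X_top_def by (rule topology_generated_by_Basis) auto

lemma sets_X_borel: "openin X_top U \<Longrightarrow> U \<in> sets X_borel"
  unfolding X_borel_def using openin_subset topspace_X_top by (subst sets_measure_of) blast+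

lemma space_X_borel: "space X_borel = X_set"
  unfolding X_borel_def by (rule space_measure_of) (use openin_subset topspace_X_top in blast)

lemma Q_borel [measurable]: "Q \<in> sets borel"
  unfolding Q_def by (intro borel_Times) auto

lemma free2_neq_one_borel:
  assumes "t \<in> free2_carrier" shows "{p \<in> Q. t p \<noteq> 1} \<in> sets borel"
proof -
  have [measurable]: "t \<in> borel_measurable (restrict_space borel Q)"
    by (rule borel_measurable_continuous_on_restrict[OF free2_continuous[OF assms]])
  have "t -` (- {1}) \<inter> space (restrict_space borel Q) \<in> sets (restrict_space borel Q)" by measurable
  moreover have "t -` (- {1}) \<inter> space (restrict_space borel Q) = {p \<in> Q. t p \<noteq> 1}"
    by (auto simp: space_restrict_space)
  ultimately show ?thesis by (simp add: sets_restrict_space_iff)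
qed

lemma point_filter_measurable:
  "point_filter \<in> measurable (restrict_space lborel (Q - {(1, 1)})) X_borel"
  unfolding X_borel_def
proof (rule measurable_measure_of)
  show "{U. openin X_top U} \<subseteq> Pow X_set" using openin_subset topspace_X_top by blast
  show "point_filter \<in> space (restrict_space lborel (Q - {(1, 1)})) \<rightarrow> X_set"
    using point_filter_X_set by (auto simp: space_restrict_space)
  fix U assume "U \<in> {U. openin X_top U}"
  then have U: "openin X_top U" by simp
  \<comment> \<open>\<open>U\<close> is the union of the countably many \<open>O_open t\<close>
    inside it, and each of these pulls back to the points where t is not 1.\<close>
  define J where "J = {t \<in> free2_carrier. O_open t \<subseteq> U}"
  have Jsub: "J \<subseteq> free2_carrier" by (auto simp: J_def)
  have memU: "G \<in> U \<longleftrightarrow> (\<exists>t\<in>J. G \<in> O_open t)" for G unfolding J_def using X_top_base[OF U] by blast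
  have "point_filter p \<in> U \<longleftrightarrow> (\<exists>t\<in>J. t p \<noteq> 1)" if "p \<in> Q" "p \<noteq> (1, 1)" for p
    unfolding memU using point_filter_X_set[OF that] Jsub by (auto simp: O_open_def point_filter_def)
  then have "point_filter -` U \<inter> space (restrict_space lborel (Q - {(1, 1)}))
    = (\<Union>t\<in>J. {p \<in> Q. t p \<noteq> 1} \<inter> (Q - {(1, 1)}))"
    by (auto simp: space_restrict_space)
  moreover have "\<dots> \<in> sets borel"
    using free2_neq_one_borel Jsub countable_subset[OF Jsub countable_free2]
    by (intro sets.countable_UN'' sets.Int) auto
  ultimately show "point_filter -` U \<inter> space (restrict_space lborel (Q - {(1, 1)})) \<in> sets (restrict_space lborel (Q - {(1, 1)}))"
    by (auto simp: sets_restrict_space_iff space_restrict_space)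
qed

text \<open>A nonempty open set contains a nonempty \<open>O_open t\<close>, where t is not 1
  because every filter contains 1. The k-th iterate of \<open>F\<close> lies in
  \<open>O_open t\<close> exactly when \<open>(s ^^ k) t \<notin> F\<close>.\<close>

lemma dense_orbit_X_topI:
  assumes s: "endomorphism s" and F: "F \<in> X_set"
    and esc: "\<And>t. t \<in> free2_carrier \<Longrightarrow> t \<noteq> \<one>\<^bsub>Free2\<^esub> \<Longrightarrow> \<exists>k. (s ^^ k) t \<notin> F"
  shows "dense_orbit X_top (dual_map s) F"
proof -
  have pf: "prime_filter F" using F by (simp add: X_set_def)
  then have Fsub: "F \<subseteq> free2_carrier" using filter_subset by (auto simp: prime_filter_def)
  have pk: "prime_filter ((dual_map s ^^ k) F)" for k
    by (induction k) (use pf prime_filter_dual_map[OF s] in auto)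
  have "\<exists>k. (dual_map s ^^ k) F \<in> U" if U: "openin X_top U" "G \<in> U" for G U
  proof -
    obtain t where t: "t \<in> free2_carrier" "G \<in> O_open t" "O_open t \<subseteq> U" using X_top_base[OF U] by blast
    have "t \<noteq> \<one>\<^bsub>Free2\<^esub>" using t(2) filter_one by (auto simp: O_open_def X_set_def prime_filter_def)
    then obtain k where "(s ^^ k) t \<notin> F" using esc t(1) by blast
    then have "t \<notin> (dual_map s ^^ k) F" by (simp add: dual_map_funpow[OF s Fsub])
    then have "(dual_map s ^^ k) F \<in> O_open t" using pk[of k] t(1) by (auto simp: O_open_def X_set_def)
    then show ?thesis using t(3) by blast
  qed
  then have "x \<in> X_top closure_of {(dual_map s ^^ k) F | k. True} \<longleftrightarrow> x \<in> X_set" for x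
    unfolding in_closure_of topspace_X_top by blast
  then show ?thesis unfolding dense_orbit_def topspace_X_top by blast
qed

section \<open>The Farey endomorphism\<close>

text \<open>For \<open>q = 1\<close> the exponents a and b coincide; \<open>k\<close> is their
  common value, and the two equations are the defining terms of \<open>\<sigma>\<close> evaluated in
  M.\<close>

locale farey_endomorphism =
  fixes \<sigma> :: "(real \<times> real \<Rightarrow> real) \<Rightarrow> (real \<times> real \<Rightarrow> real)" and k :: nat
  assumes k: "k \<ge> 1" and endo: "endomorphism \<sigma>"
    and x0_eval: "\<And>p. p \<in> Q \<Longrightarrow> \<sigma> x0 p = (min (fst p) (snd p) / max (fst p) (snd p)) ^ k"
    and x1_eval: "\<And>p. p \<in> Q \<Longrightarrow> \<sigma> x1 p = max (fst p) (snd p) ^ k"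
begin

text \<open>The product \<open>P\<close> of the coordinates is min times max, and one step turns it
  into the k-th power of min. Along an orbit it never decreases if \<open>k = 1\<close> and never
  increases if \<open>k \<ge> 2\<close>, so the orbit misses an open set beyond its initial
  value.\<close>

lemma no_dense_orbit:
  assumes p: "p \<in> Q" shows "\<not> dense_orbit (top_of_set Q) (sbar \<sigma>) p"
proof
  assume "dense_orbit (top_of_set Q) (sbar \<sigma>) p"
  then have dense: "\<exists>n. (sbar \<sigma> ^^ n) p \<in> U" if U: "open U" "U \<inter> Q \<noteq> {}" for U
  proof -
    obtain x where x: "x \<in> U" "x \<in> Q" using U(2) by blast
    have "x \<in> top_of_set Q closure_of {(sbar \<sigma> ^^ n) p | n. True}"
      using \<open>dense_orbit _ _ _\<close> x(2) by (simp add: dense_orbit_def)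
    moreover have "openin (top_of_set Q) (Q \<inter> U)" using U(1) by (rule openin_open_Int)
    ultimately show ?thesis using x unfolding in_closure_of by blast
  qed
  define P where "P p = fst p * snd p" for p :: "real \<times> real"
  have Pcont: "continuous_on UNIV P" unfolding P_def by (intro continuous_intros)
  have step: "P (sbar \<sigma> r) = min (fst r) (snd r) ^ k" if r: "r \<in> Q" for r
  proof -
    have "max (fst r) (snd r) > 0" using r by (auto simp: Q_def max_def)
    then show ?thesis using r by (simp add: P_def sbar_def x0_eval x1_eval flip: power_mult_distrib)
  qed
  have P: "P r = min (fst r) (snd r) * max (fst r) (snd r)" for r
    by (auto simp: P_def min_def max_def)
  have orb: "(sbar \<sigma> ^^ n) p \<in> Q" for n
    by (induction n) (use p sbar_in_Q[OF endo] in auto)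
  have range: "0 < min (fst r) (snd r)" "min (fst r) (snd r) \<le> max (fst r) (snd r)" "max (fst r) (snd r) \<le> 1" "0 < P r" "P r \<le> 1"
    if "r \<in> Q" for r
    using that by (auto simp: Q_def P_def mult_le_one)
  show False
  proof (cases "k = 1")
    case True
    have inc: "P r \<le> P (sbar \<sigma> r)" if r: "r \<in> Q" for r
    proof -
      have "min (fst r) (snd r) * max (fst r) (snd r) \<le> min (fst r) (snd r) * 1"
        using range[OF r] by (intro mult_left_mono) auto
      then show ?thesis by (simp only: step[OF r] P[of r] True power_one_right mult_1_right)
    qed
    have "P p \<le> P ((sbar \<sigma> ^^ n) p)" for n
    proof (induction n)
      case (Suc n)
      then show ?case using inc[OF orb[of n]] by simp
    qed simp
    moreover have "open {r. P r < P p}"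
      using Pcont by (intro open_Collect_less continuous_intros) auto
    moreover have "(P p / 2, 1) \<in> {r. P r < P p} \<inter> Q"
      using range(4,5)[OF p] by (auto simp: P_def Q_def)
    ultimately show False using dense[of "{r. P r < P p}"] by (auto simp: not_less[symmetric])
  next
    case False
    then have k2: "k \<ge> 2" using k by simp
    have dec: "P (sbar \<sigma> r) \<le> P r" if r: "r \<in> Q" for r
    proof -
      have "min (fst r) (snd r) ^ k \<le> min (fst r) (snd r) ^ 2"
        using range[OF r] k2 by (intro power_decreasing) auto
      also have "\<dots> \<le> min (fst r) (snd r) * max (fst r) (snd r)"
        unfolding power2_eq_square using range[OF r] by (intro mult_left_mono) auto
      finally show ?thesis by (simp only: step[OF r] P[of r])
    qed
    have le: "P ((sbar \<sigma> ^^ n) p) \<le> P p" for n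
    proof (induction n)
      case (Suc n)
      then show ?case using dec[OF orb[of n]] by simp
    qed simp
    show False
    proof (cases "P p < 1")
      case True
      have "open {r. P p < P r}"
        using Pcont by (intro open_Collect_less continuous_intros) auto
      moreover have "(1, 1) \<in> {r. P p < P r} \<inter> Q"
        using True by (auto simp: P_def Q_def)
      ultimately show False using dense[of "{r. P p < P r}"] le by (auto simp: not_less[symmetric])
    next
      \<comment> \<open>The initial value is already maximal, so p is the corner (1,1), which is
        fixed.\<close>
      case False
      have b: "0 < fst p" "fst p \<le> 1" "0 < snd p" "snd p \<le> 1" using p by (auto simp: Q_def)
      then have "P p \<le> fst p" "P p \<le> snd p" by (auto simp: P_def mult_left_le mult_left_le_one_le)
      then have "fst p = 1" "snd p = 1" using b False by linarith+
      then have fixp: "sbar \<sigma> p = p" using p by (auto simp: sbar_def x0_eval x1_eval prod_eq_iff)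
      have "(sbar \<sigma> ^^ n) p = p" for n by (induction n) (use fixp in auto)
      moreover have "open {r :: real \<times> real. fst r < 1}"
        by (intro open_Collect_less continuous_intros)
      moreover have "(1/2, 1) \<in> {r. fst r < 1} \<inter> Q" by (simp add: Q_def)
      then have "{r. fst r < 1} \<inter> Q \<noteq> {}" by blast
      ultimately show False using dense[of "{r. fst r < 1}"] \<open>fst p = 1\<close> by simp
    qed
  qed
qed

text \<open>In logarithmic coordinates the map is positively homogeneous and sends rays to rays.
  With \<open>M\<close> and \<open>m\<close> the larger and smaller of x and 1-x, the new direction
  is \<open>m / M = stilde 1 x\<close> and the new scale is \<open>k * S * M\<close>.\<close>

lemma sbar_ray:
  assumes S: "S > 0" and x: "x \<in> {0..1}"
  obtains S' where "S' > 0" "sbar \<sigma> (ray S x) = ray S' (stilde 1 x)"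
proof -
  define M m where "M = max x (1 - x)" and "m = min x (1 - x)"
  have Mm: "M > 0" "M + m = 1" "m \<ge> 0" using x by (auto simp: M_def m_def)
  have q: "ray S x \<in> Q" by (rule ray_in_Q[OF S x])
  have "min (exp (- S * (1 - x))) (exp (- S * x)) = exp (- (S * M))"
    "max (exp (- S * (1 - x))) (exp (- S * x)) = exp (- (S * m))"
    using S by (auto simp: M_def m_def min_def max_def mult_le_cancel_left_pos algebra_simps)
  then have mm: "min (fst (ray S x)) (snd (ray S x)) = exp (- (S * M))" "max (fst (ray S x)) (snd (ray S x)) = exp (- (S * m))"
    by (simp_all add: ray_def)
  have "exp (- (S * M)) / exp (- (S * m)) = exp (- (S * (M - m)))"
    by (simp add: exp_diff[symmetric] algebra_simps)
  then have s: "sbar \<sigma> (ray S x) = (exp (- (k * S * (M - m))), exp (- (k * S * m)))"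
    by (simp add: sbar_def x0_eval[OF q] x1_eval[OF q] mm mult.assoc flip: exp_of_nat_mult)
  have T: "stilde 1 x = m / M"
    using x by (auto simp: stilde_def M_def m_def min_def max_def)
  have "M * (1 - m / M) = M - m" "M * (m / M) = m" using Mm by (simp_all add: right_diff_distrib)
  then have "ray (k * S * M) (stilde 1 x) = (exp (- (k * S * (M - m))), exp (- (k * S * m)))"
    unfolding ray_def T using Mm(1) by (simp add: mult.assoc)
  then show ?thesis using s k S Mm that[of "k * S * M"] by auto
qed

lemma sbar_funpow_ray:
  assumes S: "S > 0" and x: "x \<in> {0..1}"
  shows "\<exists>S'>0. (sbar \<sigma> ^^ n) (ray S x) = ray S' ((stilde 1 ^^ n) x)"
proof (induction n)
  case (Suc n)
  then obtain S' where S': "S' > 0" "(sbar \<sigma> ^^ n) (ray S x) = ray S' ((stilde 1 ^^ n) x)" by blast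
  obtain S'' where "S'' > 0" "sbar \<sigma> (ray S' ((stilde 1 ^^ n) x)) = ray S'' (stilde 1 ((stilde 1 ^^ n) x))"
    using sbar_ray[OF S'(1) stilde_pow_range[OF zero_less_one x]] by blast
  then show ?case using S'(2) by auto
qed (use S in auto)

text \<open>Whether t is 1 at a point other than (1,1) depends only on the direction of its ray, so
  avoiding points lie over directions that never visit \<open>W\<close>. These form a null set by
  \<open>farey_visits\<close>, and the differentiable map \<open>ray\<close> preserves
  nullity.\<close>

lemma negligible_avoiding:
  assumes t: "t \<in> free2_carrier" "t \<noteq> \<one>\<^bsub>Free2\<^esub>"
  shows "negligible {p \<in> Q. \<forall>n. t ((sbar \<sigma> ^^ n) p) = 1}"
proof -
  define f where "f x = t (ray 1 x)" for x
  have "continuous_on {0..1} (ray 1)" unfolding ray_def by (intro continuous_intros)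
  then have fcont: "continuous_on {0..1} f" unfolding f_def
    by (rule continuous_on_compose2[OF free2_continuous[OF t(1)]]) (use ray_in_Q in auto)
  define W where "W = {x \<in> {0..1}. f x \<noteq> 1}"
  have [measurable]: "W \<in> sets borel"
  proof -
    have [measurable]: "f \<in> borel_measurable (restrict_space borel {0..1})"
      by (rule borel_measurable_continuous_on_restrict[OF fcont])
    have "f -` (- {1}) \<inter> space (restrict_space borel {0..1}) \<in> sets (restrict_space borel {0..1})" by measurable
    moreover have "f -` (- {1}) \<inter> space (restrict_space borel {0..1}) = W"
      by (auto simp: space_restrict_space W_def)
    ultimately show ?thesis by (simp add: sets_restrict_space_iff)
  qed
  obtain x where x: "x \<in> {0..1}" "f x \<noteq> 1"
  proof -
    obtain p where p: "p \<in> Q" "t p < 1" using free2_neq_oneE[OF t] by blast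
    have "t (1, 1) = 1" using t(1)
      by (induction rule: free2_induct) (auto simp: Q_def)
    then have "p \<noteq> (1, 1)" using p by auto
    then obtain S y where y: "S > 0" "y \<in> {0..1}" "p = ray S y" using rayE[OF p(1)] by blast
    have "f y \<noteq> 1" unfolding f_def using free2_ray_eq_one[OF t(1) y(1,2)] p(2) y(3) by simp
    then show ?thesis by (rule that[OF y(2)])
  qed
  have "\<exists>e>0. \<forall>y\<in>{0..1}. dist x y < e \<longrightarrow> f y \<noteq> 1"
    using continuous_on_avoid[OF fcont x] .
  then obtain e where e: "e > 0" "\<And>y. y \<in> {0..1} \<Longrightarrow> dist x y < e \<Longrightarrow> f y \<noteq> 1" by blast
  \<comment> \<open>Half of \<open>e\<close> keeps the closed interval inside the neighbourhood;
    clipping to [0,1] leaves it nondegenerate even if x is an endpoint.\<close>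
  define a b where "a = max 0 (x - e / 2)" and "b = min 1 (x + e / 2)"
  have ab: "a < b" using x(1) e(1) by (auto simp: a_def b_def)
  have "{a..b} \<subseteq> W \<inter> {0..1}"
    using e by (auto simp: W_def a_def b_def dist_real_def intro!: e(2))
  then have "emeasure lborel {a..b} \<le> emeasure lborel (W \<inter> {0..1})" by (intro emeasure_mono) auto
  moreover have "emeasure lborel {a..b} > 0" using ab by simp
  ultimately have "emeasure lborel (W \<inter> {0..1}) > 0" by order
  from farey_visits[OF \<open>W \<in> sets borel\<close> this]
  have vis: "AE x in lborel. x \<in> {0..1} \<longrightarrow> (\<exists>n. (stilde 1 ^^ n) x \<in> W)" .
  define N where "N = {x \<in> {0..1}. \<forall>n. (stilde 1 ^^ n) x \<notin> W}"
  have [measurable]: "N \<in> sets borel" unfolding N_def by measurable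
  have "emeasure lborel N = 0"
    using vis by (subst (asm) AE_iff_measurable[where N = N]) (auto simp: N_def)
  then have "emeasure (lborel \<Otimes>\<^sub>M lborel) ((UNIV :: real set) \<times> N) = 0"
    by (subst lborel.emeasure_pair_measure_Times) auto
  then have "(UNIV :: real set) \<times> N \<in> null_sets lborel"
    by (auto simp: null_sets_def lborel_prod intro!: borel_Times)
  then have neg: "negligible ((UNIV :: real set) \<times> N)"
    by (simp add: negligible_iff_null_sets null_sets_completionI)
  have diff: "(\<lambda>z. ray (fst z) (snd z)) differentiable_on A" for A
  proof -
    have "((\<lambda>z. ray (fst z) (snd z)) has_derivative
      (\<lambda>h. ((fst z * snd h - fst h * (1 - snd z)) * exp (- fst z * (1 - snd z)),
            (- fst z * snd h - fst h * snd z) * exp (- fst z * snd z)))) (at z within A)" for z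
      unfolding ray_def by (auto intro!: derivative_eq_intros simp: algebra_simps fun_eq_iff)
    then show ?thesis unfolding differentiable_on_def differentiable_def by blast
  qed
  have "negligible ((\<lambda>z. ray (fst z) (snd z)) ` (UNIV \<times> N))"
    by (rule negligible_differentiable_image_negligible[OF _ neg diff]) simp
  \<comment> \<open>The point (1,1) has no direction and is added separately.\<close>
  then have "negligible ({(1, 1)} \<union> (\<lambda>z. ray (fst z) (snd z)) ` (UNIV \<times> N))" by simp
  moreover have "{p \<in> Q. \<forall>n. t ((sbar \<sigma> ^^ n) p) = 1} \<subseteq> {(1, 1)} \<union> (\<lambda>z. ray (fst z) (snd z)) ` (UNIV \<times> N)"
  proof
    fix p assume "p \<in> {p \<in> Q. \<forall>n. t ((sbar \<sigma> ^^ n) p) = 1}"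
    then have p: "p \<in> Q" "\<And>n. t ((sbar \<sigma> ^^ n) p) = 1" by auto
    show "p \<in> {(1, 1)} \<union> (\<lambda>z. ray (fst z) (snd z)) ` (UNIV \<times> N)"
    proof (cases "p = (1, 1)")
      case False
      then obtain S y where y: "S > 0" "y \<in> {0..1}" "p = ray S y" using rayE[OF p(1)] by blast
      have "(stilde 1 ^^ n) y \<notin> W" for n
      proof -
        obtain S' where S': "S' > 0" "(sbar \<sigma> ^^ n) p = ray S' ((stilde 1 ^^ n) y)"
          using sbar_funpow_ray[OF y(1,2)] y(3) by blast
        have "t (ray S' ((stilde 1 ^^ n) y)) = 1" using p(2)[of n] by (simp only: S'(2))
        then have "f ((stilde 1 ^^ n) y) = 1"
          unfolding f_def using free2_ray_eq_one[OF t(1) S'(1) stilde_pow_range[OF zero_less_one y(2)]] by blast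
        then show ?thesis by (simp add: W_def)
      qed
      then have "y \<in> N" using y(2) by (simp add: N_def)
      then show ?thesis using y(3) by (auto intro!: image_eqI[of _ _ "(S, y)"])
    qed simp
  qed
  ultimately show ?thesis by (rule negligible_subset)
qed

end

section \<open>Automorphisms, null sets and genericity\<close>

lemma automorphism_inverse:
  assumes "automorphism r"
  obtains r' where "endomorphism r'" "\<And>t. t \<in> free2_carrier \<Longrightarrow> r (r' t) = t"
proof
  let ?C = free2_carrier
  have r: "endomorphism r" "bij_betw r ?C ?C" using assms by (auto simp: automorphism_def)
  note h = hoop_homD[OF r(1)[unfolded endomorphism_def], simplified]
  have inj: "inj_on r ?C" and surj: "r ` ?C = ?C" using r(2) by (auto simp: bij_betw_def)
  show rr': "r (inv_into ?C r t) = t" if "t \<in> ?C" for t using that surj by (simp add: f_inv_into_f)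
  have cl: "inv_into ?C r t \<in> ?C" if "t \<in> ?C" for t using that surj by (simp add: inv_into_into)
  have eqI: "inv_into ?C r t = u" if "u \<in> ?C" "r u = t" for t u
    using that inj by (auto simp: inv_into_f_eq)
  show "endomorphism (inv_into ?C r)"
    unfolding endomorphism_def
    by (rule hoop_homI) (auto intro!: eqI simp: cl Free2_closed h rr')
qed

text \<open>The preimage of \<open>N\<close> is contained in the image of \<open>N\<close> under
  \<open>sbar r'\<close> for the inverse \<open>r'\<close>, and that map is locally
  Lipschitz.\<close>

lemma negligible_sbar_vimage:
  assumes r: "automorphism r" and N: "negligible N" "N \<subseteq> Q"
  shows "negligible {p \<in> Q. sbar r p \<in> N}"
proof -
  have er: "endomorphism r" using r by (simp add: automorphism_def)
  obtain r' where r': "endomorphism r'" "\<And>t. t \<in> free2_carrier \<Longrightarrow> r (r' t) = t"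
    using automorphism_inverse[OF r] by blast
  note gens = free2_carrier.intros(1,2)
  have inv: "sbar r' (sbar r p) = p" if p: "p \<in> Q" for p
  proof -
    have "r' t (sbar r p) = t p" if "t \<in> free2_carrier" for t
      using endomorphism_eval[OF er p endomorphism_closed(1)[OF r'(1) that]] r'(2)[OF that] by simp
    then show ?thesis using p gens by (simp add: sbar_def[of r'])
  qed
  have "negligible (sbar r' ` N)"
  proof (rule negligible_locally_Lipschitz_image[OF _ N(1)])
    fix p assume "p \<in> N"
    then have p: "p \<in> Q" using N(2) by blast
    obtain T B where 1: "open T" "p \<in> T" "\<And>p'. p' \<in> Q \<inter> T \<Longrightarrow> \<bar>r' x0 p' - r' x0 p\<bar> \<le> B * norm (p' - p)"
      using free2_lipschitz_at[OF endomorphism_closed(1)[OF r'(1) gens(1)] p] by blast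
    obtain T' B' where 2: "open T'" "p \<in> T'" "\<And>p'. p' \<in> Q \<inter> T' \<Longrightarrow> \<bar>r' x1 p' - r' x1 p\<bar> \<le> B' * norm (p' - p)"
      using free2_lipschitz_at[OF endomorphism_closed(1)[OF r'(1) gens(2)] p] by blast
    have "norm (sbar r' p' - sbar r' p) \<le> (B + B') * norm (p' - p)" if "p' \<in> N \<inter> (T \<inter> T')" for p'
    proof -
      have "norm (sbar r' p' - sbar r' p) \<le> \<bar>r' x0 p' - r' x0 p\<bar> + \<bar>r' x1 p' - r' x1 p\<bar>"
        using norm_Pair_le[of "r' x0 p' - r' x0 p" "r' x1 p' - r' x1 p"] by (simp add: sbar_def)
      also have "\<dots> \<le> B * norm (p' - p) + B' * norm (p' - p)"
        using 1(3)[of p'] 2(3)[of p'] that N(2) by (intro add_mono) auto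
      finally show ?thesis by (simp add: distrib_right)
    qed
    then show "\<exists>T B. open T \<and> p \<in> T \<and> (\<forall>p'\<in>N \<inter> T. norm (sbar r' p' - sbar r' p) \<le> B * norm (p' - p))"
      using 1(1,2) 2(1,2) by (intro exI[of _ "T \<inter> T'"] exI[of _ "B + B'"]) auto
  qed simp
  moreover have "{p \<in> Q. sbar r p \<in> N} \<subseteq> sbar r' ` N"
  proof
    fix p assume "p \<in> {p \<in> Q. sbar r p \<in> N}"
    then show "p \<in> sbar r' ` N" using inv[of p] by (auto intro!: image_eqI[of p _ "sbar r p"])
  qed
  ultimately show ?thesis by (rule negligible_subset)
qed

text \<open>For fixed t other than 1, the filters whose orbit misses \<open>O_open t\<close> form a
  Borel set \<open>A\<close>. Its pullback to the square consists of points that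
  \<open>sbar r\<close> sends into the null set of \<open>negligible_avoiding\<close>. Countability
  of the free algebra joins the exceptional sets.\<close>

lemma (in farey_endomorphism) generic: "generic \<sigma>"
  unfolding generic_def
proof (intro allI impI)
  fix \<mu> assume \<mu>: "alg_equiv_lambda_X \<mu>"
  then obtain r where r: "automorphism r"
    and em: "\<And>A. A \<in> sets X_borel \<Longrightarrow> emeasure \<mu> A = emeasure lambda_X (dual_map r -` A \<inter> X_set)"
    and sets: "sets \<mu> = sets X_borel"
    unfolding alg_equiv_lambda_X_def by blast
  have er: "endomorphism r" using r by (simp add: automorphism_def)
  let ?L = "restrict_space lborel (Q - {(1, 1)})"
  have "AE F in \<mu>. \<exists>n. (\<sigma> ^^ n) t \<notin> F" if t: "t \<in> free2_carrier" "t \<noteq> \<one>\<^bsub>Free2\<^esub>" for t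
  proof -
    define A where "A = X_set - (\<Union>n. O_open ((\<sigma> ^^ n) t))"
    have As: "A \<in> sets X_borel"
      unfolding A_def space_X_borel[symmetric]
      using endomorphism_closed(2)[OF endo t(1)]
      by (intro sets.compl_sets sets.countable_UN) (auto intro: sets_X_borel openin_O_open)
    define E where "E = dual_map r -` A \<inter> X_set"
    define N where "N = {p \<in> Q. \<forall>n. t ((sbar \<sigma> ^^ n) p) = 1}"
    have "negligible {p \<in> Q. sbar r p \<in> N}"
      by (rule negligible_sbar_vimage[OF r]) (use negligible_avoiding[OF t] in \<open>auto simp: N_def\<close>)
    moreover have "point_filter -` E \<inter> space ?L \<subseteq> {p \<in> Q. sbar r p \<in> N}"
    proof
      fix p assume "p \<in> point_filter -` E \<inter> space ?L"
      then have p: "p \<in> Q" "dual_map r (point_filter p) \<in> A" by (auto simp: E_def space_restrict_space)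
      have "t ((sbar \<sigma> ^^ n) (sbar r p)) = 1" for n
      proof -
        have c: "(\<sigma> ^^ n) t \<in> free2_carrier" by (rule endomorphism_closed(2)[OF endo t(1)])
        have "(\<sigma> ^^ n) t \<in> dual_map r (point_filter p)" using p(2) by (auto simp: A_def O_open_def)
        then have "r ((\<sigma> ^^ n) t) p = 1" by (simp add: dual_map_def point_filter_def)
        then show ?thesis
          using endomorphism_eval[OF er p(1) c] endomorphism_funpow_eval(2)[OF endo t(1) sbar_in_Q[OF er p(1)]] by simp
      qed
      then show "p \<in> {p \<in> Q. sbar r p \<in> N}" using p(1) sbar_in_Q[OF er p(1)] by (simp add: N_def)
    qed
    ultimately have neg: "negligible (point_filter -` E \<inter> space ?L)" by (rule negligible_subset)
    have "emeasure lambda_X E = 0"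
    \<comment> \<open>Off the sigma-algebra \<open>emeasure\<close> is 0 by convention, so a
      non-measurable \<open>E\<close> gives the same value.\<close>
    proof (cases "E \<in> sets X_borel")
      case True
      have m: "point_filter -` E \<inter> space ?L \<in> sets ?L"
        by (rule measurable_sets[OF point_filter_measurable True])
      have Qb: "Q - {(1, 1)} \<in> sets lborel" by simp
      then have mb: "point_filter -` E \<inter> space ?L \<in> sets lborel"
        using m by (simp add: sets_restrict_space_iff)
      have "emeasure lambda_X E = emeasure ?L (point_filter -` E \<inter> space ?L)"
        unfolding lambda_X_def by (rule emeasure_distr[OF point_filter_measurable True])
      also have "\<dots> = emeasure lborel (point_filter -` E \<inter> space ?L)"
        by (rule emeasure_restrict_space) (use Qb in \<open>auto simp: space_restrict_space\<close>)
      also have "\<dots> = emeasure lebesgue (point_filter -` E \<inter> space ?L)"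
        using mb by (simp add: emeasure_completion)
      also have "\<dots> = 0" using neg by (simp add: negligible_iff_null_sets null_sets_def)
      finally show ?thesis .
    qed (simp add: lambda_X_def emeasure_notin_sets)
    then have "emeasure \<mu> A = 0" using em[OF As] by (simp add: E_def)
    then have "AE F in \<mu>. F \<notin> A" using As sets by (intro AE_not_in) (auto simp: null_sets_def)
    then show ?thesis
      using AE_space by eventually_elim
        (use sets_eq_imp_space_eq[OF sets] in \<open>auto simp: A_def space_X_borel O_open_def\<close>)
  qed
  then have "AE F in \<mu>. \<forall>t\<in>free2_carrier - {\<one>\<^bsub>Free2\<^esub>}. \<exists>n. (\<sigma> ^^ n) t \<notin> F"
    using countable_free2 by (subst AE_ball_countable) auto
  then show "AE F in \<mu>. dense_orbit X_top (dual_map \<sigma>) F"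
    using AE_space
  proof eventually_elim
    case (elim F)
    then have "F \<in> X_set" using sets_eq_imp_space_eq[OF sets] by (simp add: space_X_borel)
    then show ?case using elim(1) by (intro dense_orbit_X_topI[OF endo]) auto
  qed
qed

theorem theorem4p4:
  fixes a b :: nat and q :: real
    and \<sigma> :: "(real \<times> real \<Rightarrow> real) \<Rightarrow> (real \<times> real \<Rightarrow> real)"
  assumes "a \<ge> 1" and "b \<ge> 1" and "q = real a / real b"
    and "endomorphism \<sigma>"
    and "\<sigma> x0 = (((x0 \<leadsto>\<^bsub>Free2\<^esub> x1) \<leadsto>\<^bsub>Free2\<^esub> x1) \<leadsto>\<^bsub>Free2\<^esub>
                   (x0 \<otimes>\<^bsub>Free2\<^esub> (x0 \<leadsto>\<^bsub>Free2\<^esub> x1))) [^]\<^bsub>Free2\<^esub> a"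
    and "\<sigma> x1 = ((x0 \<leadsto>\<^bsub>Free2\<^esub> x1) \<leadsto>\<^bsub>Free2\<^esub> x1) [^]\<^bsub>Free2\<^esub> b"
  shows
    "(q > 1 \<longrightarrow> (AE x in leb01. (\<lambda>n. (stilde q ^^ n) x) \<longlonglongrightarrow> 0)) \<and>
     (q < 1 \<longrightarrow>
        (\<exists>\<mu>. borel_prob01 \<mu> \<and> preserves (stilde q) \<mu> \<and> absolutely_continuous leb01 \<mu> \<and>
             exact (stilde q) \<mu> \<and>
             (\<forall>\<nu>. borel_prob01 \<nu> \<and> preserves (stilde q) \<nu> \<and> absolutely_continuous leb01 \<nu>
                    \<longrightarrow> \<nu> = \<mu>))) \<and>
     (q = 1 \<longrightarrow>
        generic \<sigma> \<and>
        \<not> (\<exists>p\<in>Q. dense_orbit (top_of_set Q) (sbar \<sigma>) p) \<and>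
        \<not> (\<exists>\<mu>. borel_prob01 \<mu> \<and> absolutely_continuous \<mu> leb01 \<and>
               preserves (stilde q) \<mu> \<and> ergodic (stilde q) \<mu>))"
proof (intro conjI impI)
  show "AE x in leb01. (\<lambda>n. (stilde q ^^ n) x) \<longlonglongrightarrow> 0" if "q > 1"
    using that by (rule stilde_AE_attracted)
next
  have "q > 0" using assms(1-3) by simp
  then show "\<exists>\<mu>. borel_prob01 \<mu> \<and> preserves (stilde q) \<mu> \<and> absolutely_continuous leb01 \<mu> \<and>
             exact (stilde q) \<mu> \<and>
             (\<forall>\<nu>. borel_prob01 \<nu> \<and> preserves (stilde q) \<nu> \<and> absolutely_continuous leb01 \<nu>
                    \<longrightarrow> \<nu> = \<mu>)" if "q < 1"
    using that by (rule stilde_exact_unique)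
next
  assume q: "q = 1"
  then have ab: "b = a" using assms(2,3) by simp
  \<comment> \<open>In M, \<open>(x -> y) -> y\<close> is the maximum and
    \<open>x * (x -> y)\<close> the minimum.\<close>
  have join: "min 1 (y / min 1 (y / x)) = max x y" "x * min 1 (y / x) = min x y"
    if "0 < x" "x \<le> 1" "0 < y" "y \<le> 1" for x y :: real
    using that by (auto simp: min_def max_def field_simps)
  interpret farey_endomorphism \<sigma> a
  proof
    fix p assume p: "p \<in> Q"
    then have b: "0 < fst p" "fst p \<le> 1" "0 < snd p" "snd p \<le> 1" by (auto simp: Q_def)
    \<comment> \<open>Hence the outer implication in \<open>\<sigma> x0\<close> is an untruncated
      quotient.\<close>
    have "min (fst p) (snd p) / max (fst p) (snd p) \<le> 1" using b by (auto simp: min_def max_def)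
    then show "\<sigma> x0 p = (min (fst p) (snd p) / max (fst p) (snd p)) ^ a"
      using p by (simp add: assms(5) join[OF b] min_absorb2)
    show "\<sigma> x1 p = max (fst p) (snd p) ^ a"
      using p by (simp add: assms(6) join[OF b] ab)
  qed (use assms in auto)
  show "generic \<sigma>" by (rule generic)
  show "\<not> (\<exists>p\<in>Q. dense_orbit (top_of_set Q) (sbar \<sigma>) p)" using no_dense_orbit by blast
  show "\<not> (\<exists>\<mu>. borel_prob01 \<mu> \<and> absolutely_continuous \<mu> leb01 \<and>
               preserves (stilde q) \<mu> \<and> ergodic (stilde q) \<mu>)"
    using farey_no_invariant_prob q by blast
qed

end
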